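(* Let $\underline b<0<\overline b$ be real numbers and let $\mu\neq\delta_0$ be a centred probability measure on $\mathbb R$ (finite first moment, mean $0$). With $F$, $F^{-1}$, $\mu_p^q$, $\rho_+$, $\pi^*$, $\mathcal M_\mu$, $\overline G^{I},\overline G^{II},\overline G^{III}$ as defined in the context, the upper bound $$\mathbb P(\overline M_\infty\ge\overline b,\ \underline M_\infty>\underline b)\le\inf\big\{\mathbb E[\overline G^{I}(K)],\mathbb E[\overline G^{II}],\mathbb E[\overline G^{III}(K')]\big\},\qquad M\in\mathcal M_\mu,$$ where the infimum is taken over $0<K'<\overline b<K$ (and where the right-hand side depends on $M$ only through $\mu$), is sharp. More precisely, exactly one of the following is true: (I) $\pi^*=F(\underline b)$ and $\rho_+^{-1}(\pi^* )-\pi^*<\frac{-\underline b}{\overline b-\underline b}$. Then there is a martingale $M\in\mathcal M_\mu$ such that $\mathbb P(\overline M_\infty\ge\overline b,\ \underline M_\infty>\underline b)=\mathbb E[\overline G^{I}(z^* )]$, where $z^*=F^{-1}(\xi)$ and $\xi$ solves $\int(x-\underline b)\,\mu_{F(\underline b)}^{\xi}(\mathrm dx)=-\underline b$. (II) $\rho_+^{-1}(\pi^* )-\pi^*\ge\frac{-\underline b}{\overline b-\underline b}$. Then there is a martingale $M\in\mathcal M_\mu$ such that $\mathbb P(\overline M_\infty\ge\overline b,\ \underline M_\infty>\underline b)=\mathbb E[\overline G^{II}]=\frac{-\underline b}{\overline b-\underline b}$. (III) $\pi^*=\rho_+(1)$ and $1-\pi^*<\frac{-\underline b}{\overline b-\underline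 b}$. Then there is a martingale $M\in\mathcal M_\mu$ such that $\mathbb P(\overline M_\infty\ge\overline b,\ \underline M_\infty>\underline b)=\mathbb E[\overline G^{III}(F^{-1}(\pi^* ))]$.
   Context: $\mathcal M_\mu$ is the set of continuous uniformly integrable martingales $M=(M_t:0\le t\le\infty)$ (on some filtered probability space) with $M_0=0$ a.s. and $M_\infty\sim\mu$. $\overline M_\infty=\sup_{t\le\infty}M_t$, $\underline M_\infty=\inf_{t\le\infty}M_t$, $H_x=\inf\{t\in[0,\infty]:M_t=x\}$ with $\inf\emptyset=\infty$. Quantile notation. $F(x)=\mu((-\infty,x])$, $F(x-)=\mu((-\infty,x))$; $\ell_\mu$ is the left endpoint of the support of $\mu$; $F^{-1}(q)=\inf\{x\in\mathbb R:F(x)\ge q\}\vee\ell_\mu$ for $q\in[0,1]$ (possibly infinite). For $0\le p\le q\le1$, $\mu_p^q$ is the sub-probability measure with $\mu_p^q((-\infty,x])=(F(x)\wedge q-p)\vee0$, of total mass $q-p$. Its barycentre is $m_p^q=(q-p)^{-1}\int x\,\mu_p^q(\mathrm dx)$ if $q>p$, and $m_p^q=F^{-1}(q)$ if $p=q$. Define $\rho_+:[F(\overline b),1]\to[0,F(\overline b-)]$ by $\rho_+(q)=\sup\{p\le F(\overline b-):m_p^q\le\overline b\}$. It is continuous and strictly decreasing, with inverse $\rho_+^{-1}:[\rho_+(1),F(\overline b-)]\to[F(\overline b),1]$. Set $$\pi^*=\inf\Big\{p\in[\rho_+(1)\vee F(\underline b),F(\overline b-)]:\rho_+^{-1}(p)-p\le\tfrac{-\underline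 b}{\overline b-\underline b}\Big\}\wedge F(\overline b-),\qquad \inf\emptyset=\infty.$$ Random variables. For $K>\underline b$ and $K'<\overline b$, $$\overline G^{I}(K)=\frac{1}{K-\underline b}\Big((M_\infty-K)^+-(\underline b-M_\infty)^+-(M_\infty-\underline b)\mathbf 1_{\{H_{\underline b}<\infty\}}\Big)+\mathbf 1_{\{M_\infty>\underline b\}},$$ where the special case $K=\infty$ is included, with $\overline G^{I}(\infty)=\mathbf 1_{\{M_\infty>\underline b\}}$; $$\overline G^{II}=\frac{M_\infty-\underline b}{\overline b-\underline b}-\frac{M_\infty-\overline b}{\overline b-\underline b}\mathbf 1_{\{H_{\overline b}<H_{\underline b},\ H_{\overline b}<\infty\}}-\frac{M_\infty-\underline b}{\overline b-\underline b}\mathbf 1_{\{H_{\underline b}<H_{\overline b},\ H_{\underline b}<\infty\}};$$ $$\overline G^{III}(K')=\frac{(M_\infty-K')^+}{\overline b-K'}+\frac{\overline b-M_\infty}{\overline b-K'}\mathbf 1_{\{\overline M_\infty\ge\overline b\}}.$$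
   Formalization: In (III), if F^{-1}(π* ) equals the upper barrier, G^III(F^{-1}(π* )) divides by zero; the equality is then read as the limit of E[G^III(K')] as K' increases to the barrier. Sharpness is read as the case-wise attainment, since sup = inf over K'>0 can fail. *)

theory Defs
  imports "HOL-Probability.Probability"
begin

text \<open>Time runs through \<^typ>\<open>ennreal\<close>, i.e. through the closed half-line from 0 to
  \<open>\<infinity>\<close>, both end points included.\<close>

definition uniformly_integrable :: "'a measure \<Rightarrow> 'i set \<Rightarrow> ('i \<Rightarrow> 'a \<Rightarrow> real) \<Rightarrow> bool" where
  "uniformly_integrable P I X \<longleftrightarrow>
     (\<forall>i\<in>I. X i \<in> borel_measurable P) \<and>
     ((\<lambda>c::real. SUP i\<in>I. \<integral>\<^sup>+\<omega>. ennreal \<bar>X i \<omega>\<bar> * indicator {\<omega>. c < \<bar>X i \<omega>\<bar>} \<omega> \<partial>P) \<longlongrightarrow> 0) at_top"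

definition martingale ::
  "'a measure \<Rightarrow> (ennreal \<Rightarrow> 'a measure) \<Rightarrow> (ennreal \<Rightarrow> 'a \<Rightarrow> real) \<Rightarrow> bool" where
  "martingale P \<F> M \<longleftrightarrow>
     (\<forall>t. M t \<in> borel_measurable (\<F> t)) \<and>
     (\<forall>t. integrable P (M t)) \<and>
     (\<forall>s t. s \<le> t \<longrightarrow> (AE \<omega> in P. real_cond_exp P (\<F> s) (M t) \<omega> = M s \<omega>))"

definition calM ::
  "real measure \<Rightarrow> 'a measure \<Rightarrow> (ennreal \<Rightarrow> 'a measure) \<Rightarrow> (ennreal \<Rightarrow> 'a \<Rightarrow> real) \<Rightarrow> bool" where
  "calM \<mu> P \<F> M \<longleftrightarrow>
     prob_space P \<and> filtration (space P) \<F> \<and> (\<forall>t. subalgebra P (\<F> t)) \<and>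
     martingale P \<F> M \<and> uniformly_integrable P UNIV M \<and>
     (\<forall>\<omega>\<in>space P. continuous_on UNIV (\<lambda>t. M t \<omega>)) \<and>
     (AE \<omega> in P. M 0 \<omega> = 0) \<and>
     distr P borel (M \<infinity>) = \<mu>"

text \<open>For a continuous path on the compact time axis the supremum and the infimum below are
  those of a bounded set of reals.\<close>

definition path_sup :: "(ennreal \<Rightarrow> 'a \<Rightarrow> real) \<Rightarrow> 'a \<Rightarrow> real" where
  "path_sup M \<omega> = (SUP t. M t \<omega>)"

definition path_inf :: "(ennreal \<Rightarrow> 'a \<Rightarrow> real) \<Rightarrow> 'a \<Rightarrow> real" where
  "path_inf M \<omega> = (INF t. M t \<omega>)"

text \<open>The infimum of the empty set is \<open>\<infinity>\<close>; hence a path that reaches \<open>x\<close> only at time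
  \<open>\<infinity>\<close> also has hitting time \<open>\<infinity>\<close>.\<close>

definition hit :: "(ennreal \<Rightarrow> 'a \<Rightarrow> real) \<Rightarrow> real \<Rightarrow> 'a \<Rightarrow> ennreal" where
  "hit M x \<omega> = Inf {t. M t \<omega> = x}"

definition cdf_left :: "real measure \<Rightarrow> real \<Rightarrow> real" where
  "cdf_left \<mu> x = measure \<mu> {..<x}"

definition supp :: "real measure \<Rightarrow> real set" where
  "supp \<mu> = {x. \<forall>U. open U \<and> x \<in> U \<longrightarrow> 0 < emeasure \<mu> U}"

definition left_end :: "real measure \<Rightarrow> ereal" where
  "left_end \<mu> = Inf (ereal ` supp \<mu>)"

definition quantile :: "real measure \<Rightarrow> real \<Rightarrow> ereal" where
  "quantile \<mu> q = max (Inf (ereal ` {x. q \<le> cdf \<mu> x})) (left_end \<mu>)"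

text \<open>The Lebesgue--Stieltjes measure with distribution function
  \<open>(F \<and> q - p) \<or> 0\<close>.\<close>

definition slice :: "real measure \<Rightarrow> real \<Rightarrow> real \<Rightarrow> real measure" where
  "slice \<mu> p q = interval_measure (\<lambda>x. max (min (cdf \<mu> x) q - p) 0)"

lemma emeasure_slice_Iic:
  assumes "real_distribution \<mu>" "0 \<le> p"
  shows "emeasure (slice \<mu> p q) {..x} = ennreal (max (min (cdf \<mu> x) q - p) 0)"
proof -
  interpret real_distribution \<mu> by fact
  have "((\<lambda>x. max (min (cdf \<mu> x) q - p) 0) \<longlongrightarrow> max (min 0 q - p) 0) at_bot"
    by (intro tendsto_intros cdf_lim_at_bot)
  moreover have "max (min 0 q - p) 0 = 0" using assms by auto
  ultimately have lim: "((\<lambda>x. max (min (cdf \<mu> x) q - p) 0) \<longlongrightarrow> 0) at_bot" by simp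
  show ?thesis unfolding slice_def
  proof (rule emeasure_interval_measure_Iic)
    show "max (min (cdf \<mu> x) q - p) 0 \<le> max (min (cdf \<mu> y) q - p) 0" if "x \<le> y" for x y
      using cdf_nondecreasing[OF that] by auto
    show "continuous (at_right a) (\<lambda>x. max (min (cdf \<mu> x) q - p) 0)" for a
      by (intro continuous_intros cdf_is_right_cont)
  qed (fact lim)
qed

definition barycentre :: "real measure \<Rightarrow> real \<Rightarrow> real \<Rightarrow> ereal" where
  "barycentre \<mu> p q =
     (if p < q then ereal ((\<integral>x. x \<partial>slice \<mu> p q) / (q - p)) else quantile \<mu> q)"

definition rho_plus :: "real measure \<Rightarrow> real \<Rightarrow> real \<Rightarrow> real" where
  "rho_plus \<mu> bu q = Sup {p. 0 \<le> p \<and> p \<le> cdf_left \<mu> bu \<and> barycentre \<mu> p q \<le> ereal bu}"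

definition rho_plus_inv :: "real measure \<Rightarrow> real \<Rightarrow> real \<Rightarrow> real" where
  "rho_plus_inv \<mu> bu = the_inv_into {cdf \<mu> bu..1} (rho_plus \<mu> bu)"

text \<open>The infimum is taken in the extended reals, so that it is \<open>\<infinity>\<close> on the empty set; the
  minimum is always finite.\<close>

definition pi_star :: "real measure \<Rightarrow> real \<Rightarrow> real \<Rightarrow> real" where
  "pi_star \<mu> bl bu = real_of_ereal (min
     (Inf (ereal ` {p \<in> {max (rho_plus \<mu> bu 1) (cdf \<mu> bl)..cdf_left \<mu> bu}.
        rho_plus_inv \<mu> bu p - p \<le> - bl / (bu - bl)}))
     (ereal (cdf_left \<mu> bu)))"

definition G_I :: "real \<Rightarrow> (ennreal \<Rightarrow> 'a \<Rightarrow> real) \<Rightarrow> ereal \<Rightarrow> 'a \<Rightarrow> real" where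
  "G_I bl M K \<omega> =
     (if K = \<infinity> then 0
      else (max (M \<infinity> \<omega> - real_of_ereal K) 0 - max (bl - M \<infinity> \<omega>) 0
             - (M \<infinity> \<omega> - bl) * of_bool (hit M bl \<omega> < \<infinity>)) / (real_of_ereal K - bl))
     + of_bool (bl < M \<infinity> \<omega>)"

definition G_II :: "real \<Rightarrow> real \<Rightarrow> (ennreal \<Rightarrow> 'a \<Rightarrow> real) \<Rightarrow> 'a \<Rightarrow> real" where
  "G_II bl bu M \<omega> =
     (M \<infinity> \<omega> - bl) / (bu - bl)
     - (M \<infinity> \<omega> - bu) / (bu - bl) * of_bool (hit M bu \<omega> < hit M bl \<omega> \<and> hit M bu \<omega> < \<infinity>)
     - (M \<infinity> \<omega> - bl) / (bu - bl) * of_bool (hit M bl \<omega> < hit M bu \<omega> \<and> hit M bl \<omega> < \<infinity>)"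

text \<open>Meaningful for \<open>K' < bu\<close> only.\<close>

definition G_III :: "real \<Rightarrow> (ennreal \<Rightarrow> 'a \<Rightarrow> real) \<Rightarrow> real \<Rightarrow> 'a \<Rightarrow> real" where
  "G_III bu M K' \<omega> =
     max (M \<infinity> \<omega> - K') 0 / (bu - K')
     + (bu - M \<infinity> \<omega>) / (bu - K') * of_bool (bu \<le> path_sup M \<omega>)"

definition touch_prob :: "real \<Rightarrow> real \<Rightarrow> 'a measure \<Rightarrow> (ennreal \<Rightarrow> 'a \<Rightarrow> real) \<Rightarrow> real" where
  "touch_prob bl bu P M = \<P>(\<omega> in P. bu \<le> path_sup M \<omega> \<and> bl < path_inf M \<omega>)"

text \<open>The strike \<open>K\<close> ranges over the extended reals above \<open>bu\<close>, so \<open>K = \<infinity>\<close> is included.\<close>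

definition upper_bound :: "real \<Rightarrow> real \<Rightarrow> 'a measure \<Rightarrow> (ennreal \<Rightarrow> 'a \<Rightarrow> real) \<Rightarrow> real" where
  "upper_bound bl bu P M = Inf
     ({\<integral>\<omega>. G_I bl M K \<omega> \<partial>P | K. ereal bu < K}
      \<union> {\<integral>\<omega>. G_II bl bu M \<omega> \<partial>P}
      \<union> {\<integral>\<omega>. G_III bu M K' \<omega> \<partial>P | K'. 0 < K' \<and> K' < bu})"

definition case_I :: "real measure \<Rightarrow> real \<Rightarrow> real \<Rightarrow> bool" where
  "case_I \<mu> bl bu \<longleftrightarrow>
     pi_star \<mu> bl bu = cdf \<mu> bl \<and>
     rho_plus_inv \<mu> bu (pi_star \<mu> bl bu) - pi_star \<mu> bl bu < - bl / (bu - bl)"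

definition case_II :: "real measure \<Rightarrow> real \<Rightarrow> real \<Rightarrow> bool" where
  "case_II \<mu> bl bu \<longleftrightarrow>
     rho_plus_inv \<mu> bu (pi_star \<mu> bl bu) - pi_star \<mu> bl bu \<ge> - bl / (bu - bl)"

definition case_III :: "real measure \<Rightarrow> real \<Rightarrow> real \<Rightarrow> bool" where
  "case_III \<mu> bl bu \<longleftrightarrow>
     pi_star \<mu> bl bu = rho_plus \<mu> bu 1 \<and> 1 - pi_star \<mu> bl bu < - bl / (bu - bl)"

definition solves_xi :: "real measure \<Rightarrow> real \<Rightarrow> real \<Rightarrow> bool" where
  "solves_xi \<mu> bl \<xi> \<longleftrightarrow>
     cdf \<mu> bl \<le> \<xi> \<and> \<xi> \<le> 1 \<and> (\<integral>x. x - bl \<partial>slice \<mu> (cdf \<mu> bl) \<xi>) = - bl"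

text \<open>Equality with the third bound at strike \<open>z\<close>. If \<open>\<mu>\<close> puts no mass above \<open>bu\<close>, the strike
  \<open>F\<^sup>-\<^sup>1(\<pi>\<^sup>*)\<close> of the third case can be equal to \<open>bu\<close>, where \<^const>\<open>G_III\<close> divides by
  zero; the value of the bound there is its limit as the strike increases to \<open>bu\<close>.\<close>

definition attains_III ::
  "real \<Rightarrow> real \<Rightarrow> 'a measure \<Rightarrow> (ennreal \<Rightarrow> 'a \<Rightarrow> real) \<Rightarrow> real \<Rightarrow> bool" where
  "attains_III bl bu P M z \<longleftrightarrow>
     (if z < bu then touch_prob bl bu P M = (\<integral>\<omega>. G_III bu M z \<omega> \<partial>P)
      else ((\<lambda>K'. \<integral>\<omega>. G_III bu M K' \<omega> \<partial>P) \<longlongrightarrow> touch_prob bl bu P M) (at_left bu))"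

text \<open>HOL cannot quantify existentially over types, so existence of a martingale on some
  filtered probability space is asserted for a space whose points are functions from the time
  axis to the reals. This loses nothing: mapping \<open>\<omega>\<close> to its path carries any continuous martingale
  to one on the space of continuous functions, with the same joint law.\<close>

type_synonym path = "ennreal \<Rightarrow> real"

end

theory Submission
  imports Defs
begin

text \<open>Each of the three variables dominates the indicator of the event path by path. By optional
  stopping, the terminal value of the martingale has mean \<open>x\<close> on the event that the level \<open>x\<close> has been
  hit, so the expectations of these variables depend on the law only.

  For sharpness, cut the law into a quantile slice \<open>(a, b)\<close> and the rest, with barycentres \<open>d\<close> and
  \<open>c\<close>. Let the martingale move from 0 to one of \<open>c\<close> and \<open>d\<close> in unit time, strictly between them before,
  and then within the convex hull of the chosen part of the law. The slice is \<open>(F(bl), \<xi>)\<close> in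
  case I, where \<open>c = bl\<close> and \<open>d > bu\<close>; a slice of mass \<open>-bl / (bu - bl)\<close> provided by the intermediate
  value theorem in case II, where \<open>c = bl\<close> and \<open>d = bu\<close>; and \<open>(\<rho>\<^sub>+(1), 1)\<close> in case III, where
  \<open>c > bl\<close> and \<open>d = bu\<close> (for \<open>\<rho>\<^sub>+(1) = 1\<close> the level \<open>bu\<close> need not be reached at all). In all three, the event is that \<open>d\<close> is chosen, and the variable in question
  equals its indicator.

  Such a martingale with a given terminal law is \<open>E(g(V) | past)\<close>, where \<open>V\<close> is uniform on the unit
  interval and its binary digits are decided one after another, in unit time each. The \<open>m\<close>-th digit
  is 1 if a Brownian motion over \<open>[m, m + 1]\<close> ends below a threshold; the conditional probability of
  this is a continuous martingale with values in \<open>(0, 1)\<close> until the digit is known.\<close>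

section \<open>Optional stopping and the upper bound\<close>

text \<open>The slices are dictated by the equality cases of the pathwise inequalities. For
  \<open>G_I\<close> with strike \<open>K\<close> equality demands terminal values between
  \<open>bl\<close> and \<open>K\<close> on the event and, off it, that \<open>bl\<close> is reached
  and the terminal value is not strictly between \<open>bl\<close> and \<open>K\<close>. For
  \<open>G_II\<close> a path must reach \<open>bl\<close> before \<open>bu\<close>, or reach
  \<open>bu\<close> and stay above \<open>bl\<close>. For \<open>G_III\<close> with strike
  \<open>K'\<close> the terminal value is at least \<open>K'\<close> on the event; off it,
  \<open>bu\<close> is not reached and the terminal value is at most \<open>K'\<close>. So the event
  has to select a middle or an upper piece of the law, cut at quantiles.

  The obstacle is to realise an arbitrary law by a martingale that is continuous up to and including
  time \<infinity> and has a controlled range. Conditional expectations of \<open>g (V x)\<close> do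
  both: they are averages of \<open>g\<close> over shrinking intervals, so they respect every bound
  of \<open>g\<close> there, and they converge to \<open>g (V x)\<close> where \<open>g\<close> is
  continuous. As \<open>g\<close> is a rearranged quantile function, this fails at countably many
  points only. Brownian motion enters only through its increments after dyadic times and its
  continuity.\<close>

lemma calM_set_integral:
  assumes C: "calM \<mu> P \<F> M" and A: "A \<in> sets (\<F> t)"
  shows "(\<integral>\<omega>\<in>A. M \<infinity> \<omega> \<partial>P) = (\<integral>\<omega>\<in>A. M t \<omega> \<partial>P)"
proof -
  interpret prob_space P using C by (simp add: calM_def)
  have sub: "subalgebra P (\<F> t)" and int: "integrable P (M \<infinity>)"
    and ae: "AE \<omega> in P. real_cond_exp P (\<F> t) (M \<infinity>) \<omega> = M t \<omega>"
    and mt: "integrable P (M t)"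
    using C by (auto simp: calM_def martingale_def)
  interpret finite_measure_subalgebra P "\<F> t" by (unfold_locales) (rule sub)
  have AP: "A \<in> sets P" using A sub by (auto simp: subalgebra_def)
  have "(\<integral>\<omega>\<in>A. M \<infinity> \<omega> \<partial>P) = (\<integral>\<omega>\<in>A. real_cond_exp P (\<F> t) (M \<infinity>) \<omega> \<partial>P)"
    by (rule real_cond_exp_intA[OF int A])
  also have "\<dots> = (\<integral>\<omega>\<in>A. M t \<omega> \<partial>P)"
    unfolding set_lebesgue_integral_def using ae AP mt by (intro integral_cong_AE) auto
  finally show ?thesis .
qed

text \<open>\<open>T\<close> is rounded up to a dyadic grid. On the event that the rounded time is
  \<open>g n k\<close>, the martingale property replaces \<open>M \<infinity>\<close> by
  \<open>M (g n k)\<close>, which by path continuity is close to \<open>x\<close> for large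
  \<open>n\<close>. The limit is taken in integrals of \<open>M \<infinity> - x\<close> only, so
  that a single integrable variable dominates.\<close>

lemma optional_stopping_level:
  assumes C: "calM \<mu> P \<F> M" and T: "stopping_time \<F> T"
    and x: "\<And>\<omega>. \<omega> \<in> space P \<Longrightarrow> T \<omega> < \<infinity> \<Longrightarrow> M (T \<omega>) \<omega> = x"
  shows "(\<integral>\<omega>. (M \<infinity> \<omega> - x) * of_bool (T \<omega> < \<infinity>) \<partial>P) = 0"
proof -
  interpret prob_space P using C by (simp add: calM_def)
  have sub: "\<And>t. subalgebra P (\<F> t)" and fil: "filtration (space P) \<F>"
    and int: "\<And>t. integrable P (M t)" and Mm: "\<And>t. M t \<in> borel_measurable (\<F> t)"
    and cont: "\<And>\<omega>. \<omega> \<in> space P \<Longrightarrow> continuous_on UNIV (\<lambda>t. M t \<omega>)"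
    using C by (auto simp: calM_def martingale_def)
  have sp: "space (\<F> t) = space P" for t using sub by (auto simp: subalgebra_def)
  have setsF: "A \<in> sets (\<F> t) \<Longrightarrow> A \<in> sets P" for A t using sub by (auto simp: subalgebra_def)
  have Tm[measurable]: "T \<in> borel_measurable P"
    by (rule measurable_stopping_time[OF T]) (use sub in \<open>auto simp: subalgebra_def\<close>)
  define g where "g n k = ennreal (real k / 2^n)" for n k :: nat
  define K where "K n \<omega> = (LEAST k. T \<omega> \<le> g n k)" for n \<omega>
  define D where "D n k = {\<omega>\<in>space P. T \<omega> \<le> g n k \<and> (\<forall>j<k. \<not> T \<omega> \<le> g n j)}" for n k
  have gmono: "j \<le> k \<Longrightarrow> g n j \<le> g n k" for n j k
    by (auto simp: g_def divide_right_mono)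
  have DF: "D n k \<in> sets (\<F> (g n k))" for n k
  proof -
    have "Measurable.pred (\<F> (g n k)) (\<lambda>\<omega>. T \<omega> \<le> g n k \<and> (\<forall>j\<in>{..<k}. \<not> T \<omega> \<le> g n j))"
      using filtration.stopping_time_le_const[OF fil T gmono] by (intro pred_intros_logic pred_intros_finite) auto
    then show ?thesis by (auto simp: pred_def sp D_def Ball_def)
  qed
  have ex: "\<exists>k. T \<omega> \<le> g n k" if "T \<omega> < \<infinity>" for n \<omega>
  proof -
    obtain r where r: "T \<omega> = ennreal r" "0 \<le> r" using \<open>T \<omega> < \<infinity>\<close> by (cases "T \<omega>") auto
    obtain k :: nat where "r * 2^n \<le> k" using real_arch_simple by blast
    then show ?thesis by (intro exI[of _ k]) (auto simp: r g_def field_simps intro!: ennreal_leI)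
  qed
  have DK: "\<omega> \<in> D n k \<longleftrightarrow> T \<omega> < \<infinity> \<and> K n \<omega> = k" if "\<omega> \<in> space P" for n k \<omega>
  proof
    assume d: "\<omega> \<in> D n k"
    then have "T \<omega> \<le> g n k" by (simp add: D_def)
    also have "g n k < \<infinity>" by (simp add: g_def)
    finally have "T \<omega> < \<infinity>" .
    moreover have "K n \<omega> = k" unfolding K_def
      by (rule Least_equality) (use d in \<open>auto simp: D_def intro!: leI\<close>)
    ultimately show "T \<omega> < \<infinity> \<and> K n \<omega> = k" by simp
  next
    assume "T \<omega> < \<infinity> \<and> K n \<omega> = k"
    then have fin: "T \<omega> < \<infinity>" and k: "k = (LEAST k. T \<omega> \<le> g n k)" by (auto simp: K_def)
    have "T \<omega> \<le> g n k" unfolding k by (rule LeastI_ex[OF ex[OF fin]])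
    moreover have "\<not> T \<omega> \<le> g n j" if "j < k" for j
      using that unfolding k by (rule not_less_Least)
    ultimately show "\<omega> \<in> D n k" using that by (simp add: D_def)
  qed
  have Zlim: "(\<lambda>n. M (g n (K n \<omega>)) \<omega>) \<longlonglongrightarrow> x" if w: "\<omega> \<in> space P" and fin: "T \<omega> < \<infinity>" for \<omega>
  proof -
    obtain r where r: "T \<omega> = ennreal r" "0 \<le> r" using fin by (cases "T \<omega>") auto
    have b1: "T \<omega> \<le> g n (K n \<omega>)" for n unfolding K_def by (rule LeastI_ex[OF ex[OF fin]])
    have b2: "g n (K n \<omega>) \<le> ennreal (r + (1/2)^n)" for n
    proof (cases "K n \<omega>")
      case 0 then show ?thesis by (simp add: g_def)
    next
      case (Suc j)
      \<comment> \<open>The grid point before the rounded time is still below \<open>T\<close>, so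
        rounding adds at most one mesh width.\<close>
      then have "j < (LEAST k. T \<omega> \<le> g n k)" unfolding K_def by linarith
      then have "\<not> T \<omega> \<le> g n j" by (rule not_less_Least)
      then have "ennreal (real j / 2^n) < ennreal r" unfolding g_def r(1) by (rule not_le_imp_less)
      then have "real j / 2^n < r" by (rule ennreal_less_iff[THEN iffD1, rotated]) simp
      moreover have "real (Suc j) / 2^n = real j / 2^n + (1/2)^n"
        by (simp add: add_divide_distrib power_one_over)
      ultimately show ?thesis unfolding Suc g_def by (intro ennreal_leI) linarith
    qed
    have "(\<lambda>n. r + (1/2)^n) \<longlonglongrightarrow> r + 0"
      by (intro tendsto_add tendsto_const LIMSEQ_power_zero) simp
    from tendsto_ennrealI[OF this] have lim: "(\<lambda>n. ennreal (r + (1/2)^n)) \<longlonglongrightarrow> T \<omega>" by (simp add: r(1))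
    have "(\<lambda>n. g n (K n \<omega>)) \<longlonglongrightarrow> T \<omega>"
      by (rule tendsto_sandwich[OF _ _ tendsto_const lim]) (simp_all add: b1 b2)
    moreover have "isCont (\<lambda>t. M t \<omega>) (T \<omega>)" using cont[OF w] by (simp add: continuous_on_eq_continuous_at)
    ultimately have "(\<lambda>n. M (g n (K n \<omega>)) \<omega>) \<longlonglongrightarrow> M (T \<omega>) \<omega>" by (rule isCont_tendsto_compose[rotated])
    then show ?thesis using x[OF w fin] by simp
  qed
  \<comment> \<open>Closeness of \<open>M (g n k)\<close> to \<open>x\<close> is made part of the
    event. It is known at time \<open>g n k\<close>, so the martingale property still applies, and
    it bounds the integrand by \<delta> with no estimate on the paths that are not yet
    close.\<close>
  define E where "E \<delta> n k = D n k \<inter> {\<omega>\<in>space P. \<bar>M (g n k) \<omega> - x\<bar> \<le> \<delta>}" for \<delta> :: real and n k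
  have EF: "E \<delta> n k \<in> sets (\<F> (g n k))" for \<delta> n k
  proof -
    have "(\<lambda>\<omega>. \<bar>M (g n k) \<omega> - x\<bar>) \<in> borel_measurable (\<F> (g n k))"
      by (intro borel_measurable_abs borel_measurable_diff Mm borel_measurable_const)
    from borel_measurable_le[OF this borel_measurable_const[of \<delta>]]
    have "{\<omega>\<in>space P. \<bar>M (g n k) \<omega> - x\<bar> \<le> \<delta>} \<in> sets (\<F> (g n k))"
      by (simp add: sp)
    then show ?thesis unfolding E_def by (rule sets.Int[OF DF])
  qed
  have EP[measurable]: "E \<delta> n k \<in> sets P" for \<delta> n k by (rule setsF[OF EF])
  have dj: "disjoint_family (E \<delta> n)" for \<delta> n
    unfolding disjoint_family_on_def
  proof (intro ballI impI equals0I)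
    fix j k \<omega> assume "j \<noteq> k" "\<omega> \<in> E \<delta> n j \<inter> E \<delta> n k"
    then have "\<omega> \<in> space P" "\<omega> \<in> D n j" "\<omega> \<in> D n k" by (auto simp: E_def)
    then show False using DK[of \<omega> n j] DK[of \<omega> n k] \<open>j \<noteq> k\<close> by simp
  qed
  have intx: "integrable P (\<lambda>\<omega>. M t \<omega> - x)" for t by (intro Bochner_Integration.integrable_diff int integrable_const)
  have bound: "\<bar>\<integral>\<omega>\<in>(\<Union>k. E \<delta> n k). (M \<infinity> \<omega> - x) \<partial>P\<bar> \<le> \<delta>" if "0 < \<delta>" for \<delta> n
  proof -
    have si: "set_integrable P A (\<lambda>\<omega>. M t \<omega> - x)" if "A \<in> sets P" for t A
      unfolding set_integrable_def using intx that by (intro integrable_mult_indicator)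
    have eq: "(\<integral>\<omega>\<in>E \<delta> n k. (M \<infinity> \<omega> - x) \<partial>P) = (\<integral>\<omega>\<in>E \<delta> n k. (M (g n k) \<omega> - x) \<partial>P)" for k
    proof -
      have "(\<integral>\<omega>\<in>E \<delta> n k. (M t \<omega> - x) \<partial>P) = (\<integral>\<omega>\<in>E \<delta> n k. M t \<omega> \<partial>P) - (\<integral>\<omega>\<in>E \<delta> n k. x \<partial>P)" for t
        unfolding set_integrable_def[symmetric]
        by (intro set_integral_diff; unfold set_integrable_def; intro integrable_mult_indicator EP int integrable_const)
      then show ?thesis using calM_set_integral[OF C EF] by simp
    qed
    have small: "\<bar>\<integral>\<omega>\<in>E \<delta> n k. (M (g n k) \<omega> - x) \<partial>P\<bar> \<le> \<delta> * measure P (E \<delta> n k)" for k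
    proof -
      have "\<bar>\<integral>\<omega>\<in>E \<delta> n k. (M (g n k) \<omega> - x) \<partial>P\<bar> \<le> (\<integral>\<omega>. \<delta> * indicator (E \<delta> n k) \<omega> \<partial>P)"
        unfolding set_lebesgue_integral_def
      proof (intro order_trans[OF integral_abs_bound] integral_mono)
        show "integrable P (\<lambda>\<omega>. \<bar>indicat_real (E \<delta> n k) \<omega> *\<^sub>R (M (g n k) \<omega> - x)\<bar>)"
          by (rule integrable_abs[OF si[OF EP, unfolded set_integrable_def]])
        show "integrable P (\<lambda>\<omega>. \<delta> * indicator (E \<delta> n k) \<omega>)"
          by (intro integrable_mult_right integrable_real_indicator EP) (simp add: emeasure_eq_measure)
      qed (auto simp: indicator_def E_def)
      then show ?thesis by simp
    qed
    have sm: "(\<lambda>k. \<delta> * measure P (E \<delta> n k)) sums (\<delta> * measure P (\<Union>k. E \<delta> n k))"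
      by (intro sums_mult finite_measure_UNION) (auto simp: dj)
    have "(\<integral>\<omega>\<in>(\<Union>k. E \<delta> n k). (M \<infinity> \<omega> - x) \<partial>P) = (\<Sum>k. (\<integral>\<omega>\<in>E \<delta> n k. (M \<infinity> \<omega> - x) \<partial>P))"
      using dj by (intro lebesgue_integral_countable_add) (auto simp: disjoint_family_on_def intro!: si)
    also have "\<bar>\<dots>\<bar> \<le> (\<Sum>k. \<delta> * measure P (E \<delta> n k))"
      unfolding eq real_norm_def[symmetric]
      by (rule norm_suminf_le) (use small sm in \<open>auto simp: sums_iff\<close>)
    also have "\<dots> = \<delta> * measure P (\<Union>k. E \<delta> n k)" using sm by (simp add: sums_iff)
    also have "\<dots> \<le> \<delta>" using that by simp
    finally show ?thesis .
  qed
  have "\<bar>\<integral>\<omega>. (M \<infinity> \<omega> - x) * of_bool (T \<omega> < \<infinity>) \<partial>P\<bar> \<le> \<delta>" if "0 < \<delta>" for \<delta>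
  proof -
    have "(\<lambda>n. \<integral>\<omega>\<in>(\<Union>k. E \<delta> n k). (M \<infinity> \<omega> - x) \<partial>P) \<longlonglongrightarrow> (\<integral>\<omega>. (M \<infinity> \<omega> - x) * of_bool (T \<omega> < \<infinity>) \<partial>P)"
      unfolding set_lebesgue_integral_def
    proof (rule integral_dominated_convergence)
      show "integrable P (\<lambda>\<omega>. \<bar>M \<infinity> \<omega> - x\<bar>)" by (rule integrable_abs[OF intx])
      show "AE \<omega> in P. (\<lambda>n. indicat_real (\<Union> (range (E \<delta> n))) \<omega> *\<^sub>R (M \<infinity> \<omega> - x)) \<longlonglongrightarrow> (M \<infinity> \<omega> - x) * of_bool (T \<omega> < \<infinity>)"
      proof (rule AE_I2)
        fix \<omega> assume w: "\<omega> \<in> space P"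
        show "(\<lambda>n. indicat_real (\<Union> (range (E \<delta> n))) \<omega> *\<^sub>R (M \<infinity> \<omega> - x)) \<longlonglongrightarrow> (M \<infinity> \<omega> - x) * of_bool (T \<omega> < \<infinity>)"
        proof (cases "T \<omega> < \<infinity>")
          case True
          have "\<forall>\<^sub>F n in sequentially. \<bar>M (g n (K n \<omega>)) \<omega> - x\<bar> < \<delta>"
            using tendstoD[OF Zlim[OF w True] that] by (simp add: dist_real_def)
          then have "\<forall>\<^sub>F n in sequentially. indicat_real (\<Union> (range (E \<delta> n))) \<omega> *\<^sub>R (M \<infinity> \<omega> - x) = (M \<infinity> \<omega> - x) * of_bool (T \<omega> < \<infinity>)"
          proof eventually_elim
            case (elim n)
            then have "\<omega> \<in> E \<delta> n (K n \<omega>)" using w True DK[OF w, of n "K n \<omega>"] by (simp add: E_def)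
            then have "\<omega> \<in> (\<Union>k. E \<delta> n k)" by blast
            then show ?case using True by (simp only: indicator_simps) simp
          qed
          then show ?thesis by (rule tendsto_eventually)
        next
          case False
          then have "\<omega> \<notin> (\<Union>k. E \<delta> n k)" for n using DK[OF w] by (simp add: E_def)
          then show ?thesis using False by (simp only: indicator_simps) simp
        qed
      qed
    qed (use borel_measurable_integrable[OF int[of \<infinity>]] in \<open>auto simp: indicator_def\<close>)
    then show ?thesis
      using bound[OF that] by (intro LIMSEQ_le_const2[OF tendsto_rabs]) auto
  qed
  then have "\<bar>\<integral>\<omega>. (M \<infinity> \<omega> - x) * of_bool (T \<omega> < \<infinity>) \<partial>P\<bar> \<le> 0"
    by (rule field_le_epsilon) simp
  then show ?thesis by simp
qed

section \<open>Hitting times and extrema of continuous paths on the compact time axis\<close>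

lemma hit_le_iff:
  assumes c: "continuous_on UNIV (\<lambda>t. M t \<omega>)" and t: "t < \<infinity>"
  shows "hit M x \<omega> \<le> t \<longleftrightarrow> (\<exists>s\<le>t. M s \<omega> = x)"
proof
  assume h: "hit M x \<omega> \<le> t"
  \<comment> \<open>Here \<open>t < \<infinity>\<close> enters: a hitting time of \<infinity> also
    stands for a level that is never reached.\<close>
  have ne: "{t. M t \<omega> = x} \<noteq> {}"
  proof
    assume "{t. M t \<omega> = x} = {}"
    then have "hit M x \<omega> = \<infinity>" by (simp add: hit_def)
    with h t show False by simp
  qed
  have "closed {t. M t \<omega> = x}"
    using continuous_closed_preimage_constant[OF c closed_UNIV, of x] by simp
  then have "hit M x \<omega> \<in> {t. M t \<omega> = x}" unfolding hit_def using ne by (rule closed_contains_Inf_cl)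
  then show "\<exists>s\<le>t. M s \<omega> = x" using h by blast
next
  assume "\<exists>s\<le>t. M s \<omega> = x"
  then obtain s where "s \<le> t" "M s \<omega> = x" by blast
  then show "hit M x \<omega> \<le> t" unfolding hit_def by (intro Inf_lower2[of s]) auto
qed

lemma hit_attained:
  assumes c: "continuous_on UNIV (\<lambda>t. M t \<omega>)" and t: "hit M x \<omega> < \<infinity>"
  shows "M (hit M x \<omega>) \<omega> = x"
proof -
  obtain s where s: "s \<le> hit M x \<omega>" "M s \<omega> = x" using hit_le_iff[of M \<omega>, OF c t, of x] by auto
  have "hit M x \<omega> \<le> s" unfolding hit_def using s by (intro Inf_lower) auto
  with s show ?thesis by simp
qed

lemma hit_le: "M s \<omega> = x \<Longrightarrow> hit M x \<omega> \<le> s"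
  unfolding hit_def by (intro Inf_lower) auto

lemma path_sup_ge_iff:
  assumes c: "continuous_on UNIV (\<lambda>t. M t \<omega>)"
  shows "b \<le> path_sup M \<omega> \<longleftrightarrow> (\<exists>t. b \<le> M t \<omega>)"
proof -
  obtain s where s: "\<And>t. M t \<omega> \<le> M s \<omega>"
    using continuous_attains_sup[OF compact_UNIV _ c] by auto
  then have "path_sup M \<omega> = M s \<omega>" unfolding path_sup_def by (intro cSup_eq_maximum) auto
  then show ?thesis using s order_trans by metis
qed

lemma path_inf_gt_iff:
  assumes c: "continuous_on UNIV (\<lambda>t. M t \<omega>)"
  shows "b < path_inf M \<omega> \<longleftrightarrow> (\<forall>t. b < M t \<omega>)"
proof -
  obtain s where s: "\<And>t. M s \<omega> \<le> M t \<omega>"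
    using continuous_attains_inf[OF compact_UNIV _ c] by auto
  then have "path_inf M \<omega> = M s \<omega>" unfolding path_inf_def by (intro cInf_eq_minimum) auto
  then show ?thesis using s less_le_trans by metis
qed

lemma path_ivt:
  fixes f :: "ennreal \<Rightarrow> real"
  assumes c: "continuous_on UNIV f" and "f s \<le> x" "x \<le> f t"
  shows "\<exists>r. f r = x"
proof -
  have "connected (f ` UNIV)" by (rule connected_continuous_image[OF c]) (simp add: connected_iff_interval)
  then have "x \<in> f ` UNIV" by (rule connectedD_interval[of "f ` UNIV" "f s" "f t"]) (use assms(2,3) in simp_all)
  then show ?thesis by auto
qed

text \<open>Turns a condition on uncountably many times into a countable one. The slack
  \<open>1 / (n + 1)\<close> is there because the dense set may miss the times at which
  \<open>b\<close> is reached; compactness recovers such a time from the approximations.\<close>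

lemma continuous_ge_iff_dense:
  fixes f :: "'a::topological_space \<Rightarrow> real"
  assumes c: "continuous_on UNIV f" and K: "compact (UNIV :: 'a set)"
    and D: "\<And>X. open X \<Longrightarrow> X \<noteq> {} \<Longrightarrow> \<exists>d\<in>D. d \<in> X"
  shows "(\<exists>t. b \<le> f t) \<longleftrightarrow> (\<forall>n::nat. \<exists>q\<in>D. b - 1 / (real n + 1) < f q)"
proof
  assume "\<exists>t. b \<le> f t"
  then obtain t where t: "b \<le> f t" by blast
  show "\<forall>n::nat. \<exists>q\<in>D. b - 1 / (real n + 1) < f q"
  proof
    fix n :: nat
    have "open {t. b - 1 / (real n + 1) < f t}" using c by (intro open_Collect_less continuous_on_const)
    moreover have "t \<in> {t. b - 1 / (real n + 1) < f t}" using t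
      by (simp add: less_le_trans[of _ b])
    ultimately show "\<exists>q\<in>D. b - 1 / (real n + 1) < f q" using D[of "{t. b - 1 / (real n + 1) < f t}"] by blast
  qed
next
  assume a: "\<forall>n::nat. \<exists>q\<in>D. b - 1 / (real n + 1) < f q"
  obtain s where s: "\<And>t. f t \<le> f s"
    using continuous_attains_sup[OF K _ c] by auto
  have "b \<le> f s"
  proof (rule ccontr)
    assume "\<not> b \<le> f s"
    then obtain n :: nat where "1 / (real n + 1) < b - f s"
      using reals_Archimedean[of "b - f s"] by (auto simp: inverse_eq_divide add.commute)
    moreover obtain q where "b - 1 / (real n + 1) < f q" using a by blast
    ultimately show False using s[of q] by linarith
  qed
  then show "\<exists>t. b \<le> f t" by blast
qed

section \<open>Measurability of hitting times and path extrema\<close>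

locale calM_mart =
  fixes \<mu> :: "real measure" and P :: "'a measure" and \<F> :: "ennreal \<Rightarrow> 'a measure"
    and M :: "ennreal \<Rightarrow> 'a \<Rightarrow> real"
  assumes calM: "calM \<mu> P \<F> M"
begin

sublocale prob_space P using calM by (simp add: calM_def)

lemma sub: "subalgebra P (\<F> t)" using calM by (simp add: calM_def)
lemma space_F: "space (\<F> t) = space P" using sub[of t] by (simp add: subalgebra_def)
lemma sets_F: "A \<in> sets (\<F> t) \<Longrightarrow> A \<in> sets P" using sub[of t] by (auto simp: subalgebra_def)
lemma fil: "filtration (space P) \<F>" using calM by (simp add: calM_def)
lemma integrable_M: "integrable P (M t)" using calM by (simp add: calM_def martingale_def)
lemma measurable_M[measurable]: "M t \<in> borel_measurable P" using integrable_M[of t] by (rule borel_measurable_integrable)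
lemma adapted_M: "M t \<in> borel_measurable (\<F> t)" using calM by (simp add: calM_def martingale_def)
lemma cont: "\<omega> \<in> space P \<Longrightarrow> continuous_on UNIV (\<lambda>t. M t \<omega>)" using calM by (simp add: calM_def)
lemma start: "AE \<omega> in P. M 0 \<omega> = 0" using calM by (simp add: calM_def)
lemma law: "distr P borel (M \<infinity>) = \<mu>" using calM by (simp add: calM_def)

lemma integral_law: "f \<in> borel_measurable borel \<Longrightarrow> (\<integral>\<omega>. f (M \<infinity> \<omega>) \<partial>P) = (\<integral>x. f x \<partial>\<mu>)" for f :: "real \<Rightarrow> real"
  unfolding law[symmetric] by (subst integral_distr) auto

text \<open>The path reaches \<open>x\<close> up to time \<open>t\<close> iff it comes arbitrarily
  close to \<open>x\<close> along countably many times up to \<open>t\<close>. The time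
  \<open>t\<close> is added to the dense set because a path may reach \<open>x\<close> at
  \<open>t\<close> only, and later times are not observable in \<open>\<F> t\<close>.\<close>

lemma stopping_time_hit: "stopping_time \<F> (hit M x)"
proof
  fix t
  obtain D :: "ennreal set" where D: "countable D" "\<And>X. open X \<Longrightarrow> X \<noteq> {} \<Longrightarrow> \<exists>d\<in>D. d \<in> X"
    using countable_dense_setE by auto
  show "Measurable.pred (\<F> t) (\<lambda>\<omega>. hit M x \<omega> \<le> t)"
  proof (cases "t = \<infinity>")
    case True then show ?thesis by simp
  next
    case False
    then have t: "t < \<infinity>" by (simp add: top.not_eq_extremum)
    let ?Q = "\<lambda>\<omega>. \<forall>n::nat. \<exists>q\<in>{q\<in>insert t D. q \<le> t}. \<bar>M q \<omega> - x\<bar> < 1 / (real n + 1)"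
    have "hit M x \<omega> \<le> t \<longleftrightarrow> ?Q \<omega>" if w: "\<omega> \<in> space (\<F> t)" for \<omega>
    proof -
      have c: "continuous_on UNIV (\<lambda>t. M t \<omega>)" using w by (simp add: space_F cont)
      have c': "continuous_on A (\<lambda>s. \<bar>M s \<omega> - x\<bar>)" for A
        by (intro continuous_intros continuous_on_subset[OF c]) simp
      have "(\<exists>s\<le>t. M s \<omega> = x) \<longleftrightarrow> ?Q \<omega>"
      proof
        assume "\<exists>s\<le>t. M s \<omega> = x"
        then obtain s where s: "s \<le> t" "M s \<omega> = x" by blast
        show "?Q \<omega>"
        proof
          fix n :: nat
          show "\<exists>q\<in>{q\<in>insert t D. q \<le> t}. \<bar>M q \<omega> - x\<bar> < 1 / (real n + 1)"
          proof (cases "s = t")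
            case True then have "t \<in> {q\<in>insert t D. q \<le> t}" "\<bar>M t \<omega> - x\<bar> < 1 / (real n + 1)" using s by simp_all
            then show ?thesis by (rule bexI[rotated])
          next
            case False
            have "open ({..<t} \<inter> {s. \<bar>M s \<omega> - x\<bar> < 1 / (real n + 1)})"
              by (intro open_Int open_lessThan open_Collect_less c' continuous_on_const)
            moreover have "s \<in> {..<t} \<inter> {s. \<bar>M s \<omega> - x\<bar> < 1 / (real n + 1)}" using s False by auto
            ultimately obtain d where "d \<in> D" "d \<in> {..<t} \<inter> {s. \<bar>M s \<omega> - x\<bar> < 1 / (real n + 1)}"
              using D(2) by blast
            then have "d \<in> {q\<in>insert t D. q \<le> t}" "\<bar>M d \<omega> - x\<bar> < 1 / (real n + 1)" by (simp_all add: less_imp_le)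
            then show ?thesis by (rule bexI[rotated])
          qed
        qed
      next
        assume a: "?Q \<omega>"
        have "compact {..t}" using closed_Int_compact[OF closed_atMost[of t] compact_UNIV] by simp
        then have "\<exists>s\<in>{..t}. \<forall>r\<in>{..t}. \<bar>M s \<omega> - x\<bar> \<le> \<bar>M r \<omega> - x\<bar>"
          by (rule continuous_attains_inf[OF _ _ c']) simp
        then obtain s where s: "s \<le> t" "\<forall>r\<in>{..t}. \<bar>M s \<omega> - x\<bar> \<le> \<bar>M r \<omega> - x\<bar>" by blast
        have "\<bar>M s \<omega> - x\<bar> < 1 / (real n + 1)" for n :: nat
        proof -
          obtain q where "q \<le> t" "\<bar>M q \<omega> - x\<bar> < 1 / (real n + 1)" using a by blast
          with s(2)[rule_format, of q] show ?thesis by simp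
        qed
        note lt = this
        have "\<not> 0 < \<bar>M s \<omega> - x\<bar>"
        proof
          assume "0 < \<bar>M s \<omega> - x\<bar>"
          then obtain n where "inverse (real (Suc n)) < \<bar>M s \<omega> - x\<bar>" using reals_Archimedean by blast
          with lt[of n] show False by (simp add: inverse_eq_divide add.commute)
        qed
        then show "\<exists>s\<le>t. M s \<omega> = x" using s(1) by auto
      qed
      then show ?thesis using hit_le_iff[of M \<omega>, OF c t, of x] by simp
    qed
    moreover have "Measurable.pred (\<F> t) ?Q"
    proof (intro pred_intros_countable measurable_pred_countable)
      show "countable {q \<in> insert t D. q \<le> t}" by (rule countable_subset[of _ "insert t D"]) (auto simp: D(1))
      fix n q assume "q \<in> {q \<in> insert t D. q \<le> t}"
      then have "sets (\<F> q) \<subseteq> sets (\<F> t)" by (intro filtration.sets_F_mono[OF fil]) simp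
      then have "M q \<in> borel_measurable (\<F> t)"
        using adapted_M[of q] measurable_mono[OF order_refl refl, of "\<F> q" "\<F> t"] by (auto simp: space_F)
      then have "(\<lambda>\<omega>. \<bar>M q \<omega> - x\<bar>) \<in> borel_measurable (\<F> t)" by (intro borel_measurable_abs borel_measurable_diff borel_measurable_const)
      from borel_measurable_less[OF this borel_measurable_const[of "1 / (real n + 1)"]]
      show "Measurable.pred (\<F> t) (\<lambda>\<omega>. \<bar>M q \<omega> - x\<bar> < 1 / (real n + 1))" unfolding pred_def .
    qed
    ultimately show ?thesis by (subst measurable_cong[where g="?Q"])
  qed
qed

lemma hit_measurable[measurable]: "hit M x \<in> borel_measurable P"
  by (rule measurable_stopping_time[OF stopping_time_hit]) (auto simp: space_F intro: sets_F)

lemma optional_stopping_hit: "(\<integral>\<omega>. (M \<infinity> \<omega> - x) * of_bool (hit M x \<omega> < \<infinity>) \<partial>P) = 0"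
  by (rule optional_stopping_level[OF calM stopping_time_hit]) (rule hit_attained, rule cont)

lemma optional_stopping_hit_before:
  "(\<integral>\<omega>. (M \<infinity> \<omega> - x) * of_bool (hit M x \<omega> < hit M y \<omega> \<and> hit M x \<omega> < \<infinity>) \<partial>P) = 0"
proof -
  \<comment> \<open>The hitting time of \<open>x\<close>, postponed to \<infinity> on the paths that
    do not meet \<open>x\<close> before \<open>y\<close>. It remains a stopping time because which
    of the two comes first is known when \<open>x\<close> is hit.\<close>
  define T where "T \<omega> = (if hit M x \<omega> < hit M y \<omega> then hit M x \<omega> else \<infinity>)" for \<omega>
  have "stopping_time \<F> T"
  proof
    fix t
    show "Measurable.pred (\<F> t) (\<lambda>\<omega>. T \<omega> \<le> t)"
    proof (cases "t = \<infinity>")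
      case True then show ?thesis by simp
    next
      case False
      interpret filtration "space P" \<F> by (rule fil)
      have "{\<omega>\<in>space P. hit M x \<omega> < hit M y \<omega>} \<in> sets (pre_sigma (hit M x))"
        using stopping_time_less[OF stopping_time_hit stopping_time_hit, of x y] by (simp add: pred_def space_pre_sigma)
      from sets_pre_sigmaD[OF stopping_time_hit this, of t]
      have "{\<omega>\<in>space P. hit M x \<omega> < hit M y \<omega> \<and> hit M x \<omega> \<le> t} \<in> sets (\<F> t)" by simp
      also have "{\<omega>\<in>space P. hit M x \<omega> < hit M y \<omega> \<and> hit M x \<omega> \<le> t} = {\<omega>\<in>space P. T \<omega> \<le> t}"
        using False by (auto simp: T_def top_unique)
      finally show ?thesis by (simp add: pred_def space_F)
    qed
  qed
  moreover have "M (T \<omega>) \<omega> = x" if "\<omega> \<in> space P" "T \<omega> < \<infinity>" for \<omega>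
    using that hit_attained[of M \<omega>, OF cont[OF that(1)], of x] by (simp add: T_def split: if_splits)
  ultimately have "(\<integral>\<omega>. (M \<infinity> \<omega> - x) * of_bool (T \<omega> < \<infinity>) \<partial>P) = 0"
    by (rule optional_stopping_level[OF calM])
  also have "(\<lambda>\<omega>. (T \<omega> < \<infinity>)) = (\<lambda>\<omega>. hit M x \<omega> < hit M y \<omega> \<and> hit M x \<omega> < \<infinity>)"
    by (auto simp: T_def fun_eq_iff)
  finally show ?thesis .
qed

lemma path_sup_pred[measurable]: "Measurable.pred P (\<lambda>\<omega>. b \<le> path_sup M \<omega>)"
proof -
  obtain D :: "ennreal set" where D: "countable D" "\<And>X. open X \<Longrightarrow> X \<noteq> {} \<Longrightarrow> \<exists>d\<in>D. d \<in> X"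
    using countable_dense_setE by auto
  have "(b \<le> path_sup M \<omega>) = (\<forall>n::nat. \<exists>q\<in>D. b - 1 / (real n + 1) < M q \<omega>)" if "\<omega> \<in> space P" for \<omega>
    unfolding path_sup_ge_iff[of M \<omega>, OF cont[OF that]]
    by (rule continuous_ge_iff_dense[OF cont[OF that] compact_UNIV D(2)])
  moreover have "Measurable.pred P (\<lambda>\<omega>. \<forall>n::nat. \<exists>q\<in>D. b - 1 / (real n + 1) < M q \<omega>)"
    by (intro pred_intros_countable measurable_pred_countable D(1)) measurable
  ultimately show ?thesis by (subst measurable_cong)
qed

lemma path_inf_pred[measurable]: "Measurable.pred P (\<lambda>\<omega>. b < path_inf M \<omega>)"
proof -
  obtain D :: "ennreal set" where D: "countable D" "\<And>X. open X \<Longrightarrow> X \<noteq> {} \<Longrightarrow> \<exists>d\<in>D. d \<in> X"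
    using countable_dense_setE by auto
  have "(b < path_inf M \<omega>) = (\<not> (\<forall>n::nat. \<exists>q\<in>D. - b - 1 / (real n + 1) < - M q \<omega>))" if "\<omega> \<in> space P" for \<omega>
    unfolding path_inf_gt_iff[of M \<omega>, OF cont[OF that]]
    by (subst continuous_ge_iff_dense[OF continuous_on_minus[OF cont[OF that]] compact_UNIV D(2), symmetric])
       (auto simp: not_le)
  moreover have "Measurable.pred P (\<lambda>\<omega>. \<not> (\<forall>n::nat. \<exists>q\<in>D. - b - 1 / (real n + 1) < - M q \<omega>))"
    by (intro pred_intros_logic pred_intros_countable measurable_pred_countable D(1)) measurable
  ultimately show ?thesis by (subst measurable_cong)
qed

lemma touch_prob_eq: "touch_prob bl bu P M = (\<integral>\<omega>. of_bool (bu \<le> path_sup M \<omega> \<and> bl < path_inf M \<omega>) \<partial>P)"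
proof -
  have "{\<omega>\<in>space P. bu \<le> path_sup M \<omega> \<and> bl < path_inf M \<omega>} \<in> sets P" by measurable
  then have "touch_prob bl bu P M = (\<integral>\<omega>. indicator {\<omega>\<in>space P. bu \<le> path_sup M \<omega> \<and> bl < path_inf M \<omega>} \<omega> \<partial>P)"
    unfolding touch_prob_def by simp
  also have "\<dots> = (\<integral>\<omega>. of_bool (bu \<le> path_sup M \<omega> \<and> bl < path_inf M \<omega>) \<partial>P)"
    by (intro Bochner_Integration.integral_cong) (auto simp: indicator_def)
  finally show ?thesis .
qed

lemma integrable_mult_of_bool:
  fixes f :: "'a \<Rightarrow> real"
  assumes "integrable P f" "Measurable.pred P Q"
  shows "integrable P (\<lambda>\<omega>. f \<omega> * of_bool (Q \<omega>))"
  by (rule Bochner_Integration.integrable_bound[OF assms(1)]) (use assms in \<open>auto\<close>)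

lemma integrable_of_bool:
  assumes "Measurable.pred P Q"
  shows "integrable P (\<lambda>\<omega>. of_bool (Q \<omega>) :: real)"
  using integrable_mult_of_bool[OF integrable_const[of 1] assms] by simp

lemma integrable_M_diff: "integrable P (\<lambda>\<omega>. M t \<omega> - x)"
  by (intro Bochner_Integration.integrable_diff integrable_M integrable_const)

lemma integrable_M_max: "integrable P (\<lambda>\<omega>. max (M t \<omega> - x) 0)" "integrable P (\<lambda>\<omega>. max (x - M t \<omega>) 0)"
  by (rule Bochner_Integration.integrable_bound[OF integrable_M_diff[of t x]]; simp add: abs_if)+

section \<open>Expectations of the three dominating variables\<close>

lemma integrable_G_I: "integrable P (G_I bl M K)"
proof -
  have "G_I bl M K = (\<lambda>\<omega>. (if K = \<infinity> then 0
      else (max (M \<infinity> \<omega> - real_of_ereal K) 0 - max (bl - M \<infinity> \<omega>) 0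
             - (M \<infinity> \<omega> - bl) * of_bool (hit M bl \<omega> < \<infinity>)) / (real_of_ereal K - bl))
     + of_bool (bl < M \<infinity> \<omega>))"
    by (simp add: fun_eq_iff G_I_def)
  moreover have "integrable P (\<lambda>\<omega>. (if K = \<infinity> then 0
      else (max (M \<infinity> \<omega> - real_of_ereal K) 0 - max (bl - M \<infinity> \<omega>) 0
             - (M \<infinity> \<omega> - bl) * of_bool (hit M bl \<omega> < \<infinity>)) / (real_of_ereal K - bl))
     + of_bool (bl < M \<infinity> \<omega>))"
    by (cases "K = \<infinity>"; simp; intro Bochner_Integration.integrable_add integrable_divide
      Bochner_Integration.integrable_diff integrable_M_max integrable_of_bool integrable_mult_of_bool integrable_M_diff; measurable)
  ultimately show ?thesis by (simp only:)
qed

lemma integral_G_I: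
  "(\<integral>\<omega>. G_I bl M K \<omega> \<partial>P) = (if K = \<infinity> then 0 else (\<integral>x. max (x - real_of_ereal K) 0 \<partial>\<mu>
      - (\<integral>x. max (bl - x) 0 \<partial>\<mu>)) / (real_of_ereal K - bl)) + (\<integral>x. of_bool (bl < x) \<partial>\<mu>)"
proof -
  have ob: "(\<integral>x. (of_bool (bl < x) :: real) \<partial>\<mu>) = (\<integral>\<omega>. of_bool (bl < M \<infinity> \<omega>) \<partial>P)"
    by (rule integral_law[where f="\<lambda>x. of_bool (bl < x)", symmetric]) measurable
  show ?thesis
  proof (cases "K = \<infinity>")
    case True then show ?thesis unfolding ob by (simp add: G_I_def)
  next
    case False
    have a: "(\<integral>x. max (x - real_of_ereal K) 0 \<partial>\<mu>) = (\<integral>\<omega>. max (M \<infinity> \<omega> - real_of_ereal K) 0 \<partial>P)"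
      "(\<integral>x. max (bl - x) 0 \<partial>\<mu>) = (\<integral>\<omega>. max (bl - M \<infinity> \<omega>) 0 \<partial>P)"
      using integral_law[where f="\<lambda>x. max (x - real_of_ereal K) 0"] integral_law[where f="\<lambda>x. max (bl - x) 0"] by simp_all
    note i = integrable_M_max integrable_of_bool integrable_mult_of_bool integrable_M_diff
    have "(\<integral>\<omega>. G_I bl M K \<omega> \<partial>P) = (\<integral>\<omega>. (max (M \<infinity> \<omega> - real_of_ereal K) 0 - max (bl - M \<infinity> \<omega>) 0
             - (M \<infinity> \<omega> - bl) * of_bool (hit M bl \<omega> < \<infinity>)) / (real_of_ereal K - bl) \<partial>P) + (\<integral>\<omega>. of_bool (bl < M \<infinity> \<omega>) \<partial>P)"
      using False unfolding G_I_def
      by (subst Bochner_Integration.integral_add[symmetric])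
        (simp; intro i integrable_divide Bochner_Integration.integrable_diff; measurable)+
    also have "(\<integral>\<omega>. (max (M \<infinity> \<omega> - real_of_ereal K) 0 - max (bl - M \<infinity> \<omega>) 0
             - (M \<infinity> \<omega> - bl) * of_bool (hit M bl \<omega> < \<infinity>)) / (real_of_ereal K - bl) \<partial>P) =
       (\<integral>\<omega>. max (M \<infinity> \<omega> - real_of_ereal K) 0 - max (bl - M \<infinity> \<omega>) 0
             - (M \<infinity> \<omega> - bl) * of_bool (hit M bl \<omega> < \<infinity>) \<partial>P) / (real_of_ereal K - bl)" by simp
    also have "(\<integral>\<omega>. max (M \<infinity> \<omega> - real_of_ereal K) 0 - max (bl - M \<infinity> \<omega>) 0
             - (M \<infinity> \<omega> - bl) * of_bool (hit M bl \<omega> < \<infinity>) \<partial>P) =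
        (\<integral>\<omega>. max (M \<infinity> \<omega> - real_of_ereal K) 0 - max (bl - M \<infinity> \<omega>) 0 \<partial>P)
          - (\<integral>\<omega>. (M \<infinity> \<omega> - bl) * of_bool (hit M bl \<omega> < \<infinity>) \<partial>P)"
      by (rule Bochner_Integration.integral_diff) (intro i Bochner_Integration.integrable_diff; measurable)+
    also have "(\<integral>\<omega>. max (M \<infinity> \<omega> - real_of_ereal K) 0 - max (bl - M \<infinity> \<omega>) 0 \<partial>P) =
       (\<integral>\<omega>. max (M \<infinity> \<omega> - real_of_ereal K) 0 \<partial>P) - (\<integral>\<omega>. max (bl - M \<infinity> \<omega>) 0 \<partial>P)"
      by (rule Bochner_Integration.integral_diff) (intro i)+
    finally show ?thesis using False optional_stopping_hit[of bl] unfolding ob a by simp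
  qed
qed

lemma integrable_G_II: "integrable P (G_II bl bu M)"
proof -
  have "integrable P (\<lambda>\<omega>. (M \<infinity> \<omega> - bl) / (bu - bl)
     - (M \<infinity> \<omega> - bu) / (bu - bl) * of_bool (hit M bu \<omega> < hit M bl \<omega> \<and> hit M bu \<omega> < \<infinity>)
     - (M \<infinity> \<omega> - bl) / (bu - bl) * of_bool (hit M bl \<omega> < hit M bu \<omega> \<and> hit M bl \<omega> < \<infinity>))"
    by (intro Bochner_Integration.integrable_diff integrable_divide integrable_mult_of_bool integrable_M integrable_const) measurable
  then show ?thesis by (simp add: G_II_def[abs_def])
qed

lemma integral_G_II: "(\<integral>\<omega>. G_II bl bu M \<omega> \<partial>P) = ((\<integral>x. x \<partial>\<mu>) - bl) / (bu - bl)"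
proof -
  let ?A = "\<lambda>\<omega>. of_bool (hit M bu \<omega> < hit M bl \<omega> \<and> hit M bu \<omega> < \<infinity>) :: real"
  let ?B = "\<lambda>\<omega>. of_bool (hit M bl \<omega> < hit M bu \<omega> \<and> hit M bl \<omega> < \<infinity>) :: real"
  have iA: "integrable P (\<lambda>\<omega>. (M \<infinity> \<omega> - bu) * ?A \<omega>)" and iB: "integrable P (\<lambda>\<omega>. (M \<infinity> \<omega> - bl) * ?B \<omega>)"
    by (rule integrable_mult_of_bool[OF integrable_M_diff]; measurable)+
  have "(\<integral>\<omega>. G_II bl bu M \<omega> \<partial>P) = (\<integral>\<omega>. ((M \<infinity> \<omega> - bl) - (M \<infinity> \<omega> - bu) * ?A \<omega> - (M \<infinity> \<omega> - bl) * ?B \<omega>) / (bu - bl) \<partial>P)"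
    unfolding G_II_def by (intro Bochner_Integration.integral_cong) (simp_all add: diff_divide_distrib)
  also have "\<dots> = (\<integral>\<omega>. (M \<infinity> \<omega> - bl) - (M \<infinity> \<omega> - bu) * ?A \<omega> - (M \<infinity> \<omega> - bl) * ?B \<omega> \<partial>P) / (bu - bl)"
    by simp
  also have "(\<integral>\<omega>. (M \<infinity> \<omega> - bl) - (M \<infinity> \<omega> - bu) * ?A \<omega> - (M \<infinity> \<omega> - bl) * ?B \<omega> \<partial>P) =
     (\<integral>\<omega>. M \<infinity> \<omega> - bl \<partial>P) - (\<integral>\<omega>. (M \<infinity> \<omega> - bu) * ?A \<omega> \<partial>P) - (\<integral>\<omega>. (M \<infinity> \<omega> - bl) * ?B \<omega> \<partial>P)"
    by (simp only: Bochner_Integration.integral_diff[OF Bochner_Integration.integrable_diff[OF integrable_M_diff iA] iB]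
       Bochner_Integration.integral_diff[OF integrable_M_diff iA])
  also have "\<dots> = (\<integral>\<omega>. M \<infinity> \<omega> - bl \<partial>P)"
    by (simp only: optional_stopping_hit_before diff_zero)
  also have "\<dots> = (\<integral>\<omega>. M \<infinity> \<omega> \<partial>P) - bl"
    by (subst Bochner_Integration.integral_diff[OF integrable_M integrable_const]) (simp add: prob_space)
  also have "(\<integral>\<omega>. M \<infinity> \<omega> \<partial>P) = (\<integral>x. x \<partial>\<mu>)" by (rule integral_law) measurable
  finally show ?thesis .
qed

text \<open>A level that is reached at time \<infinity> only is invisible to \<open>hit\<close>;
  this is the second alternative.\<close>

lemma sup_ge_iff_hit:
  assumes "0 < bu" "\<omega> \<in> space P" "M 0 \<omega> = 0"
  shows "bu \<le> path_sup M \<omega> \<longleftrightarrow> hit M bu \<omega> < \<infinity> \<or> M \<infinity> \<omega> = bu"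
proof -
  have c: "continuous_on UNIV (\<lambda>t. M t \<omega>)" by (rule cont[OF assms(2)])
  have "(\<exists>t. bu \<le> M t \<omega>) \<longleftrightarrow> (\<exists>t. M t \<omega> = bu)"
    using path_ivt[OF c, of 0 bu] assms by (metis less_imp_le order_refl)
  also have "\<dots> \<longleftrightarrow> hit M bu \<omega> < \<infinity> \<or> M \<infinity> \<omega> = bu"
  proof
    assume "\<exists>t. M t \<omega> = bu"
    then obtain t where t: "M t \<omega> = bu" by blast
    show "hit M bu \<omega> < \<infinity> \<or> M \<infinity> \<omega> = bu"
      using hit_le[of M t \<omega> bu, OF t] t by (cases "t = \<infinity>") (auto simp: top.not_eq_extremum le_less_trans)
  next
    assume "hit M bu \<omega> < \<infinity> \<or> M \<infinity> \<omega> = bu"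
    then show "\<exists>t. M t \<omega> = bu" using hit_attained[of M \<omega>, OF c, of bu] by blast
  qed
  finally show ?thesis using path_sup_ge_iff[of M \<omega>, OF c] by simp
qed

lemma integrable_G_III: "integrable P (G_III bu M K)"
proof -
  have "integrable P (\<lambda>\<omega>. max (M \<infinity> \<omega> - K) 0 / (bu - K) + (bu - M \<infinity> \<omega>) / (bu - K) * of_bool (bu \<le> path_sup M \<omega>))"
    by (intro Bochner_Integration.integrable_add Bochner_Integration.integrable_diff integrable_divide integrable_M_max integrable_mult_of_bool integrable_M integrable_const) measurable
  then show ?thesis by (simp add: G_III_def[abs_def])
qed

lemma integral_G_III:
  assumes "0 < bu"
  shows "(\<integral>\<omega>. G_III bu M K \<omega> \<partial>P) = (\<integral>x. max (x - K) 0 \<partial>\<mu>) / (bu - K)"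
proof -
  have i: "integrable P (\<lambda>\<omega>. (M \<infinity> \<omega> - bu) * of_bool (bu \<le> path_sup M \<omega>))"
    by (rule integrable_mult_of_bool[OF integrable_M_diff]) measurable
  \<comment> \<open>Almost surely the two events differ only where
    \<open>M \<infinity> \<omega> = bu\<close>, and there the other factor vanishes.\<close>
  have "(\<integral>\<omega>. (M \<infinity> \<omega> - bu) * of_bool (bu \<le> path_sup M \<omega>) \<partial>P) = (\<integral>\<omega>. (M \<infinity> \<omega> - bu) * of_bool (hit M bu \<omega> < \<infinity>) \<partial>P)"
  proof (rule integral_cong_AE)
    show "AE \<omega> in P. (M \<infinity> \<omega> - bu) * of_bool (bu \<le> path_sup M \<omega>) = (M \<infinity> \<omega> - bu) * of_bool (hit M bu \<omega> < \<infinity>)"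
      using start AE_space
    proof eventually_elim
      case (elim \<omega>)
      then show ?case using sup_ge_iff_hit[OF assms elim(2,1)] by auto
    qed
  qed measurable
  also have "\<dots> = 0" by (rule optional_stopping_hit)
  finally have z: "(\<integral>\<omega>. (M \<infinity> \<omega> - bu) * of_bool (bu \<le> path_sup M \<omega>) \<partial>P) = 0" .
  have "(\<integral>\<omega>. G_III bu M K \<omega> \<partial>P) = (\<integral>\<omega>. (max (M \<infinity> \<omega> - K) 0 - (M \<infinity> \<omega> - bu) * of_bool (bu \<le> path_sup M \<omega>)) / (bu - K) \<partial>P)"
    unfolding G_III_def by (intro Bochner_Integration.integral_cong) (auto simp: diff_divide_distrib add_divide_distrib)
  also have "\<dots> = (\<integral>\<omega>. max (M \<infinity> \<omega> - K) 0 - (M \<infinity> \<omega> - bu) * of_bool (bu \<le> path_sup M \<omega>) \<partial>P) / (bu - K)"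
    by simp
  also have "(\<integral>\<omega>. max (M \<infinity> \<omega> - K) 0 - (M \<infinity> \<omega> - bu) * of_bool (bu \<le> path_sup M \<omega>) \<partial>P) = (\<integral>\<omega>. max (M \<infinity> \<omega> - K) 0 \<partial>P)"
    unfolding Bochner_Integration.integral_diff[OF integrable_M_max(1) i] z by simp
  also have "\<dots> = (\<integral>x. max (x - K) 0 \<partial>\<mu>)" by (rule integral_law) measurable
  finally show ?thesis .
qed

section \<open>Pathwise domination of the event\<close>

lemma touch_le_G_I:
  assumes "bl < bu" "ereal bu < K" "\<omega> \<in> space P" "bl < 0" "M 0 \<omega> = 0"
  shows "of_bool (bu \<le> path_sup M \<omega> \<and> bl < path_inf M \<omega>) \<le> G_I bl M K \<omega>"
proof (cases "bl < path_inf M \<omega>")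
  case True
  have c: "continuous_on UNIV (\<lambda>t. M t \<omega>)" by (rule cont[OF assms(3)])
  have gt: "bl < M t \<omega>" for t using True path_inf_gt_iff[of M \<omega>, OF c] by blast
  then have "\<not> hit M bl \<omega> < \<infinity>" using hit_attained[of M \<omega>, OF c, of bl] less_irrefl by metis
  moreover have "bl < real_of_ereal K" if "K \<noteq> \<infinity>" using assms that by (cases K) auto
  ultimately have "G_I bl M K \<omega> \<ge> 1" unfolding G_I_def using gt[of \<infinity>] by (auto simp: max_def)
  then show ?thesis by (rule order_trans[rotated]) simp
next
  case False
  \<comment> \<open>With a terminal value above \<open>bl\<close>, the indicator contributes 1 and
    the quotient is at least -1. With a terminal value below \<open>bl\<close>, the path has crossed
    \<open>bl\<close> on its way from 0 at a finite time, and the put payoff cancels against the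
    forward.\<close>
  have "0 \<le> G_I bl M K \<omega>"
  proof (cases "K = \<infinity>")
    case True then show ?thesis by (simp add: G_I_def)
  next
    case K: False
    then have k: "bl < real_of_ereal K" using assms by (cases K) auto
    show ?thesis
    proof (cases "bl < M \<infinity> \<omega>")
      case True
      have "0 \<le> (max (M \<infinity> \<omega> - real_of_ereal K) 0 - (M \<infinity> \<omega> - bl) * of_bool (hit M bl \<omega> < \<infinity>)) / (real_of_ereal K - bl) + 1"
        using k True by (auto simp: field_simps max_def)
      then show ?thesis unfolding G_I_def using K True by (simp add: max_def)
    next
      case b: False
      have c: "continuous_on UNIV (\<lambda>t. M t \<omega>)" by (rule cont[OF assms(3)])
      show ?thesis
      proof (cases "hit M bl \<omega> < \<infinity>")
        case True
        then show ?thesis unfolding G_I_def using K b k by (simp add: max_def)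
      next
        case nh: False
        have "M \<infinity> \<omega> = bl \<or> M \<infinity> \<omega> < bl" using b by auto
        then show ?thesis
        proof
          assume "M \<infinity> \<omega> = bl" then show ?thesis unfolding G_I_def using K k by (simp add: max_def)
        next
          assume l: "M \<infinity> \<omega> < bl"
          obtain t where t: "M t \<omega> = bl" using path_ivt[OF c, of \<infinity> bl 0] l assms by auto
          with l have "t \<noteq> \<infinity>" by auto
          then have "hit M bl \<omega> < \<infinity>" using hit_le[of M t \<omega> bl, OF t] by (simp add: top.not_eq_extremum le_less_trans)
          with nh show ?thesis by simp
        qed
      qed
    qed
  qed
  then show ?thesis using False by simp
qed

text \<open>The variable is 1 if \<open>bu\<close> is hit first and 0 if \<open>bl\<close> is hit
  first. If neither is hit at a finite time, the terminal value is at least \<open>bl\<close> by the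
  intermediate value theorem, and the event then forces it to be \<open>bu\<close>.\<close>

lemma touch_le_G_II:
  assumes "bl < 0" "0 < bu" "\<omega> \<in> space P" "M 0 \<omega> = 0"
  shows "of_bool (bu \<le> path_sup M \<omega> \<and> bl < path_inf M \<omega>) \<le> G_II bl bu M \<omega>"
proof -
  have c: "continuous_on UNIV (\<lambda>t. M t \<omega>)" by (rule cont[OF assms(3)])
  have w: "0 < bu - bl" using assms by simp
  have touch: "hit M bl \<omega> = \<infinity> \<and> (hit M bu \<omega> < \<infinity> \<or> M \<infinity> \<omega> = bu)"
    if "bu \<le> path_sup M \<omega> \<and> bl < path_inf M \<omega>"
  proof
    have gt: "bl < M t \<omega>" for t using that path_inf_gt_iff[of M \<omega>, OF c] by blast
    then have "\<not> hit M bl \<omega> < \<infinity>" using hit_attained[of M \<omega>, OF c, of bl] less_irrefl by metis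
    then show "hit M bl \<omega> = \<infinity>" by (metis infinity_ennreal_def top.not_eq_extremum)
    show "hit M bu \<omega> < \<infinity> \<or> M \<infinity> \<omega> = bu" using that sup_ge_iff_hit[OF assms(2,3,4)] by blast
  qed
  consider "hit M bu \<omega> < hit M bl \<omega>" "hit M bu \<omega> < \<infinity>" | "hit M bl \<omega> < hit M bu \<omega>" "hit M bl \<omega> < \<infinity>"
    | "hit M bl \<omega> = \<infinity>" "hit M bu \<omega> = \<infinity>" | "hit M bl \<omega> = hit M bu \<omega>" "hit M bl \<omega> < \<infinity>"
    using less_linear[of "hit M bu \<omega>" "hit M bl \<omega>"] by (metis infinity_ennreal_def top.not_eq_extremum)
  then show ?thesis
  proof cases
    case 1
    then have "G_II bl bu M \<omega> = ((M \<infinity> \<omega> - bl) - (M \<infinity> \<omega> - bu)) / (bu - bl)" unfolding G_II_def diff_divide_distrib by auto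
    also have "\<dots> = 1" using w by simp
    finally show ?thesis by simp
  next
    case 2
    then have "G_II bl bu M \<omega> = 0" unfolding G_II_def by auto
    moreover have "\<not> (bu \<le> path_sup M \<omega> \<and> bl < path_inf M \<omega>)" using touch 2 by auto
    ultimately show ?thesis by simp
  next
    case 3
    then have g: "G_II bl bu M \<omega> = (M \<infinity> \<omega> - bl) / (bu - bl)" unfolding G_II_def by auto
    show ?thesis
    proof (cases "bu \<le> path_sup M \<omega> \<and> bl < path_inf M \<omega>")
      case True
      then have "M \<infinity> \<omega> = bu" using touch 3 by auto
      then show ?thesis using g w by simp
    next
      case False
      have "bl \<le> M \<infinity> \<omega>"
      proof (rule ccontr)
        assume l: "\<not> bl \<le> M \<infinity> \<omega>"
        obtain t where t: "M t \<omega> = bl" using path_ivt[OF c, of \<infinity> bl 0] l assms by auto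
        with l have "t \<noteq> \<infinity>" by auto
        then have "hit M bl \<omega> < \<infinity>" using hit_le[of M t \<omega> bl, OF t] by (simp add: top.not_eq_extremum le_less_trans)
        with 3 show False by simp
      qed
      then have "0 \<le> G_II bl bu M \<omega>" unfolding g using w by simp
      then show ?thesis by (simp only: False of_bool_eq)
    qed
  next
    case 4
    have h: "hit M bu \<omega> < \<infinity>" using 4(2) unfolding 4(1) .
    have "bl = M (hit M bl \<omega>) \<omega>" by (rule hit_attained[of M \<omega>, OF c 4(2), symmetric])
    also have "\<dots> = bu" unfolding 4(1) by (rule hit_attained[of M \<omega>, OF c h])
    finally show ?thesis using w by (simp only: diff_self less_irrefl)
  qed
qed

lemma touch_le_G_III:
  assumes "K < bu"
  shows "of_bool (bu \<le> path_sup M \<omega> \<and> bl < path_inf M \<omega>) \<le> G_III bu M K \<omega>"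
proof (cases "bu \<le> path_sup M \<omega>")
  case True
  have "1 = ((M \<infinity> \<omega> - K) + (bu - M \<infinity> \<omega>)) / (bu - K)" using assms by simp
  also have "\<dots> \<le> (max (M \<infinity> \<omega> - K) 0 + (bu - M \<infinity> \<omega>)) / (bu - K)" using assms by (intro divide_right_mono) simp_all
  also have "\<dots> = G_III bu M K \<omega>" using True by (simp add: G_III_def add_divide_distrib)
  finally show ?thesis by (rule order_trans[rotated]) simp
next
  case False
  then show ?thesis using assms by (simp add: G_III_def)
qed

lemma touch_prob_le:
  assumes G: "integrable P G" and le: "\<And>\<omega>. \<omega> \<in> space P \<Longrightarrow> M 0 \<omega> = 0 \<Longrightarrow> of_bool (bu \<le> path_sup M \<omega> \<and> bl < path_inf M \<omega>) \<le> G \<omega>"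
  shows "touch_prob bl bu P M \<le> (\<integral>\<omega>. G \<omega> \<partial>P)"
  unfolding touch_prob_eq
proof (rule integral_mono_AE[OF _ G])
  show "integrable P (\<lambda>\<omega>. of_bool (bu \<le> path_sup M \<omega> \<and> bl < path_inf M \<omega>) :: real)"
    by (rule integrable_of_bool) measurable
  show "AE \<omega> in P. of_bool (bu \<le> path_sup M \<omega> \<and> bl < path_inf M \<omega>) \<le> G \<omega>"
    using start AE_space by eventually_elim (rule le)
qed

lemma touch_prob_le_upper_bound:
  assumes "bl < 0" "0 < bu"
  shows "touch_prob bl bu P M \<le> upper_bound bl bu P M"
  unfolding upper_bound_def
proof (rule cInf_greatest)
  fix y assume "y \<in> {\<integral>\<omega>. G_I bl M K \<omega> \<partial>P | K. ereal bu < K} \<union> {\<integral>\<omega>. G_II bl bu M \<omega> \<partial>P}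
      \<union> {\<integral>\<omega>. G_III bu M K' \<omega> \<partial>P | K'. 0 < K' \<and> K' < bu}"
  then consider K where "ereal bu < K" "y = (\<integral>\<omega>. G_I bl M K \<omega> \<partial>P)" | "y = (\<integral>\<omega>. G_II bl bu M \<omega> \<partial>P)"
    | K where "K < bu" "y = (\<integral>\<omega>. G_III bu M K \<omega> \<partial>P)" by blast
  then show "touch_prob bl bu P M \<le> y"
  proof cases
    case 1
    show ?thesis unfolding 1(2)
      by (rule touch_prob_le[OF integrable_G_I]) (use assms 1 in \<open>intro touch_le_G_I; simp\<close>)
  next
    case 2
    show ?thesis unfolding 2
      by (rule touch_prob_le[OF integrable_G_II]) (use assms in \<open>intro touch_le_G_II; simp\<close>)
  next
    case 3
    show ?thesis unfolding 3(2)
      by (rule touch_prob_le[OF integrable_G_III]) (rule touch_le_G_III[OF 3(1)])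
  qed
qed blast

text \<open>The right-hand side mentions \<open>\<mu>\<close> but neither \<open>P\<close> nor
  \<open>M\<close>: this is the dependence on the law alone.\<close>

lemma upper_bound_eq:
  assumes "0 < bu"
  shows "upper_bound bl bu P M = Inf
     ({(if K = \<infinity> then 0 else (\<integral>x. max (x - real_of_ereal K) 0 \<partial>\<mu>
      - (\<integral>x. max (bl - x) 0 \<partial>\<mu>)) / (real_of_ereal K - bl)) + (\<integral>x. of_bool (bl < x) \<partial>\<mu>) | K. ereal bu < K}
      \<union> {((\<integral>x. x \<partial>\<mu>) - bl) / (bu - bl)}
      \<union> {(\<integral>x. max (x - K') 0 \<partial>\<mu>) / (bu - K') | K'. 0 < K' \<and> K' < bu})"
  unfolding upper_bound_def integral_G_I integral_G_II integral_G_III[OF assms] ..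

end

section \<open>Gaussian noise and Brownian motion\<close>

definition gauss :: "real measure" where
  "gauss = density lborel (\<lambda>x. ennreal (std_normal_density x))"

text \<open>One normal variable for each point of the time axis, of which only those at dyadic times are used:
  the statement asks for a measure on paths.\<close>

definition noise :: "path measure" where
  "noise = PiM UNIV (\<lambda>_. gauss)"

lemma sets_gauss[measurable_cong, simp]: "sets gauss = sets borel"
  by (simp add: gauss_def)

lemma space_gauss[simp]: "space gauss = UNIV"
  by (simp add: gauss_def)

interpretation gauss: prob_space gauss
  unfolding gauss_def by (rule prob_space_normal_density) simp

interpretation gauss: real_distribution gauss
  by standard simp_all

interpretation noise: prob_space noise
  unfolding noise_def by (rule prob_space_PiM) (rule gauss.prob_space_axioms)

lemma space_noise[simp]: "space noise = UNIV"
  by (simp add: noise_def space_PiM PiE_def)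

lemma sets_noise[measurable_cong]: "sets noise = sets (PiM UNIV (\<lambda>_. borel))"
  unfolding noise_def by (rule sets_PiM_cong) simp_all

lemma measurable_noise_component: "(\<lambda>x. x t) \<in> borel_measurable noise"
  unfolding noise_def by measurable

lemma measurable_noiseI:
  assumes "\<And>t. (\<lambda>x. f x t) \<in> borel_measurable M"
  shows "f \<in> M \<rightarrow>\<^sub>M noise"
  unfolding noise_def using assms
  by (intro measurable_PiM_single') (auto simp: measurable_cong_sets[OF refl sets_gauss])

lemma nn_integral_gauss:
  assumes "f \<in> borel_measurable borel"
  shows "(\<integral>\<^sup>+x. f x \<partial>gauss) = (\<integral>\<^sup>+x. ennreal (std_normal_density x) * f x \<partial>lborel)"
  unfolding gauss_def using assms by (intro nn_integral_density) auto

section \<open>Orthogonal invariance of the Gaussian product measure\<close>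

lemma std_normal_density_rotate:
  "std_normal_density ((u + v) / sqrt 2) * std_normal_density ((u - v) / sqrt 2) = std_normal_density u * std_normal_density v"
proof -
  have "- ((u + v) / sqrt 2)\<^sup>2 / 2 + - ((u - v) / sqrt 2)\<^sup>2 / 2 = - u\<^sup>2 / 2 + - v\<^sup>2 / 2"
    by (simp add: power_divide power2_eq_square field_simps)
  then have "exp (- ((u + v) / sqrt 2)\<^sup>2 / 2) * exp (- ((u - v) / sqrt 2)\<^sup>2 / 2) = exp (- u\<^sup>2 / 2) * exp (- v\<^sup>2 / 2)"
    unfolding exp_add[symmetric] by (rule arg_cong)
  then show ?thesis unfolding std_normal_density_def by simp
qed

text \<open>The orthogonal change of variables is carried out one coordinate at a time: first
  \<open>x = sqrt 2 * u - y\<close> with \<open>y\<close> fixed, then, after Fubini,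
  \<open>y = (u - v) / sqrt 2\<close> with \<open>u\<close> fixed. The factors \<open>sqrt 2\<close>
  and \<open>1 / sqrt 2\<close> cancel.\<close>

lemma nn_integral_gauss_rotate:
  assumes [measurable]: "f \<in> borel_measurable (borel \<Otimes>\<^sub>M borel)"
  shows "(\<integral>\<^sup>+y. \<integral>\<^sup>+x. f ((x + y) / sqrt 2, (x - y) / sqrt 2) \<partial>gauss \<partial>gauss) = (\<integral>\<^sup>+y. \<integral>\<^sup>+x. f (x, y) \<partial>gauss \<partial>gauss)"
proof -
  let ?d = "\<lambda>x. ennreal (std_normal_density x)" and ?s = "sqrt 2 :: real"
  have s: "2 / ?s = ?s" by (simp add: real_div_sqrt)
  have [measurable]: "(\<lambda>y. \<integral>\<^sup>+x. f ((x + y) / ?s, (x - y) / ?s) \<partial>gauss) \<in> borel_measurable borel"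
    "(\<lambda>y. \<integral>\<^sup>+x. f (x, y) \<partial>gauss) \<in> borel_measurable borel"
    by (rule gauss.borel_measurable_nn_integral, measurable)+
  have "(\<integral>\<^sup>+y. \<integral>\<^sup>+x. f ((x + y) / ?s, (x - y) / ?s) \<partial>gauss \<partial>gauss)
      = (\<integral>\<^sup>+y. ?d y * (\<integral>\<^sup>+x. ?d x * f ((x + y) / ?s, (x - y) / ?s) \<partial>lborel) \<partial>lborel)"
    by (simp add: nn_integral_gauss)
  also have "\<dots> = (\<integral>\<^sup>+y. ennreal ?s * (\<integral>\<^sup>+u. ?d y * ?d (?s * u - y) * f (u, u - ?s * y) \<partial>lborel) \<partial>lborel)"
  proof (intro nn_integral_cong)
    fix y :: real
    have "(\<integral>\<^sup>+x. ?d x * f ((x + y) / ?s, (x - y) / ?s) \<partial>lborel) = ennreal \<bar>?s\<bar> * (\<integral>\<^sup>+u. ?d (-y + ?s * u) * f ((-y + ?s * u + y) / ?s, (-y + ?s * u - y) / ?s) \<partial>lborel)"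
    proof (rule nn_integral_real_affine)
      show "(\<lambda>x. ?d x * f ((x + y) / ?s, (x - y) / ?s)) \<in> borel_measurable borel" by measurable
    qed simp
    also have "(\<lambda>u. (-y + ?s * u - y) / ?s) = (\<lambda>u. u - ?s * y)"
    proof
      fix u have "(-y + ?s * u - y) / ?s = u - (2 / ?s) * y" by (simp add: field_simps)
      then show "(-y + ?s * u - y) / ?s = u - ?s * y" by (simp only: s)
    qed
    finally have e: "(\<integral>\<^sup>+x. ?d x * f ((x + y) / ?s, (x - y) / ?s) \<partial>lborel) = ennreal ?s * (\<integral>\<^sup>+u. ?d (?s * u - y) * f (u, u - ?s * y) \<partial>lborel)"
      by (simp add: fun_eq_iff)
    have "?d y * (\<integral>\<^sup>+u. ?d (?s * u - y) * f (u, u - ?s * y) \<partial>lborel) = (\<integral>\<^sup>+u. ?d y * ?d (?s * u - y) * f (u, u - ?s * y) \<partial>lborel)"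
      unfolding mult.assoc by (rule nn_integral_cmult[symmetric]) measurable
    then show "?d y * (\<integral>\<^sup>+x. ?d x * f ((x + y) / ?s, (x - y) / ?s) \<partial>lborel) = ennreal ?s * (\<integral>\<^sup>+u. ?d y * ?d (?s * u - y) * f (u, u - ?s * y) \<partial>lborel)"
      unfolding e mult.left_commute[of "?d y" "ennreal ?s"] by (simp only:)
  qed
  also have "\<dots> = ennreal ?s * (\<integral>\<^sup>+y. (\<integral>\<^sup>+u. ?d y * ?d (?s * u - y) * f (u, u - ?s * y) \<partial>lborel) \<partial>lborel)"
    by (rule nn_integral_cmult) measurable
  also have "(\<integral>\<^sup>+y. (\<integral>\<^sup>+u. ?d y * ?d (?s * u - y) * f (u, u - ?s * y) \<partial>lborel) \<partial>lborel) = (\<integral>\<^sup>+u. (\<integral>\<^sup>+y. ?d y * ?d (?s * u - y) * f (u, u - ?s * y) \<partial>lborel) \<partial>lborel)"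
    by (rule lborel_pair.Fubini'[symmetric]) measurable
  also have "\<dots> = (\<integral>\<^sup>+u. ennreal (1 / ?s) * (\<integral>\<^sup>+v. ?d u * (?d v * f (u, v)) \<partial>lborel) \<partial>lborel)"
  proof (intro nn_integral_cong)
    fix u :: real
    have "(\<integral>\<^sup>+y. ?d y * ?d (?s * u - y) * f (u, u - ?s * y) \<partial>lborel) = ennreal \<bar>- 1 / ?s\<bar> *
      (\<integral>\<^sup>+v. ?d (u / ?s + (- 1 / ?s) * v) * ?d (?s * u - (u / ?s + (- 1 / ?s) * v)) * f (u, u - ?s * (u / ?s + (- 1 / ?s) * v)) \<partial>lborel)"
    proof (rule nn_integral_real_affine)
      show "(\<lambda>y. ?d y * ?d (?s * u - y) * f (u, u - ?s * y)) \<in> borel_measurable borel" by measurable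
    qed simp
    also have "\<dots> = ennreal (1 / ?s) * (\<integral>\<^sup>+v. ?d u * (?d v * f (u, v)) \<partial>lborel)"
    proof -
     have "?d (u / ?s + (- 1 / ?s) * v) * ?d (?s * u - (u / ?s + (- 1 / ?s) * v)) * f (u, u - ?s * (u / ?s + (- 1 / ?s) * v)) = ?d u * (?d v * f (u, v))" for v
     proof -
      have 1: "u / ?s + (- 1 / ?s) * v = (u - v) / ?s" by (simp add: diff_divide_distrib)
      have "?s * u = 2 * u / ?s" using s by (simp add: field_simps)
      then have 2: "?s * u - (u - v) / ?s = (u + v) / ?s" by (simp add: field_simps)
      have 4: "?d ((u - v) / ?s) * ?d ((u + v) / ?s) = ?d u * ?d v"
        using arg_cong[OF std_normal_density_rotate[of u v], of ennreal]
        unfolding ennreal_mult[OF normal_density_nonneg normal_density_nonneg] by (simp only: mult.commute)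
      have 3: "u - ?s * ((u - v) / ?s) = v" by simp
      show "?d (u / ?s + (- 1 / ?s) * v) * ?d (?s * u - (u / ?s + (- 1 / ?s) * v)) * f (u, u - ?s * (u / ?s + (- 1 / ?s) * v)) = ?d u * (?d v * f (u, v))"
        unfolding 1 2 3 mult.assoc[symmetric]
by (simp only: 4)
     qed
     then show ?thesis by simp
    qed
    finally show "(\<integral>\<^sup>+y. ?d y * ?d (?s * u - y) * f (u, u - ?s * y) \<partial>lborel) = ennreal (1 / ?s) * (\<integral>\<^sup>+v. ?d u * (?d v * f (u, v)) \<partial>lborel)" .
  qed
  also have "\<dots> = ennreal (1 / ?s) * (\<integral>\<^sup>+u. (\<integral>\<^sup>+v. ?d u * (?d v * f (u, v)) \<partial>lborel) \<partial>lborel)"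
    by (rule nn_integral_cmult) measurable
  also have "(\<integral>\<^sup>+u. (\<integral>\<^sup>+v. ?d u * (?d v * f (u, v)) \<partial>lborel) \<partial>lborel) = (\<integral>\<^sup>+v. (\<integral>\<^sup>+u. ?d u * (?d v * f (u, v)) \<partial>lborel) \<partial>lborel)"
    by (rule lborel_pair.Fubini') measurable
  also have "\<dots> = (\<integral>\<^sup>+v. ?d v * (\<integral>\<^sup>+u. ?d u * f (u, v) \<partial>lborel) \<partial>lborel)"
    by (intro nn_integral_cong) (simp add: nn_integral_cmult[symmetric] mult.left_commute)
  also have "\<dots> = (\<integral>\<^sup>+y. \<integral>\<^sup>+x. f (x, y) \<partial>gauss \<partial>gauss)"
    by (simp add: nn_integral_gauss)
  finally have "(\<integral>\<^sup>+y. \<integral>\<^sup>+x. f ((x + y) / ?s, (x - y) / ?s) \<partial>gauss \<partial>gauss) =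
    (ennreal ?s * ennreal (1 / ?s)) * (\<integral>\<^sup>+y. \<integral>\<^sup>+x. f (x, y) \<partial>gauss \<partial>gauss)" by (simp only: mult.assoc)
  also have "ennreal ?s * ennreal (1 / ?s) = 1" by (subst ennreal_mult[symmetric]) simp_all
  finally show ?thesis by simp
qed

lemma nn_integral_noise_insert:
  assumes f[measurable]: "f \<in> borel_measurable (PiM (insert i I) (\<lambda>_. gauss))"
  shows "(\<integral>\<^sup>+x. f x \<partial>PiM (insert i I) (\<lambda>_. gauss)) = (\<integral>\<^sup>+z. \<integral>\<^sup>+x. f (z(i := x)) \<partial>gauss \<partial>PiM I (\<lambda>_. gauss))"
proof -
  interpret I: prob_space "PiM I (\<lambda>_. gauss)" by (rule prob_space_PiM) (rule gauss.prob_space_axioms)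
  interpret pair_sigma_finite gauss "PiM I (\<lambda>_. gauss)" ..
  have [measurable]: "(\<lambda>(x, X). X(i := x)) \<in> gauss \<Otimes>\<^sub>M PiM I (\<lambda>_. gauss) \<rightarrow>\<^sub>M PiM (insert i I) (\<lambda>_. gauss)"
    by measurable
  have "(\<integral>\<^sup>+x. f x \<partial>PiM (insert i I) (\<lambda>_. gauss)) = (\<integral>\<^sup>+x. f x \<partial>distr (gauss \<Otimes>\<^sub>M PiM I (\<lambda>_. gauss)) (PiM (insert i I) (\<lambda>_. gauss)) (\<lambda>(x, X). X(i := x)))"
    by (subst distr_pair_PiM_eq_PiM) (auto intro: gauss.prob_space_axioms)
  also have "\<dots> = (\<integral>\<^sup>+p. f ((\<lambda>(x, X). X(i := x)) p) \<partial>(gauss \<Otimes>\<^sub>M PiM I (\<lambda>_. gauss)))"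
    by (rule nn_integral_distr) measurable
  also have "\<dots> = (\<integral>\<^sup>+z. \<integral>\<^sup>+x. f (z(i := x)) \<partial>gauss \<partial>PiM I (\<lambda>_. gauss))"
  proof -
    have "(\<lambda>p. f ((\<lambda>(x, X). X(i := x)) p)) \<in> borel_measurable (gauss \<Otimes>\<^sub>M PiM I (\<lambda>_. gauss))"
      by (rule measurable_compose[OF _ f]) measurable
    from nn_integral_snd[OF this] show ?thesis by simp
  qed
  finally show ?thesis .
qed

text \<open>One step of the Haar transform. The map of the two coordinates is orthogonal, so two
  independent standard normal variables remain independent and standard normal.\<close>

definition rotation :: "ennreal \<Rightarrow> ennreal \<Rightarrow> path \<Rightarrow> path" where
  "rotation i j x = x(i := (x i + x j) / sqrt 2, j := (x i - x j) / sqrt 2)"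

lemma measurable_rotation[measurable]: "rotation i j \<in> noise \<rightarrow>\<^sub>M noise"
  unfolding rotation_def by (rule measurable_noiseI) (auto simp: fun_upd_def intro!: measurable_noise_component borel_measurable_divide borel_measurable_add borel_measurable_diff)

lemma distr_rotation:
  assumes ij: "i \<noteq> j"
  shows "distr noise noise (rotation i j) = noise"
proof (rule measure_eqI)
  fix A assume "A \<in> sets (distr noise noise (rotation i j))"
  then have A[measurable]: "A \<in> sets noise" by simp
  let ?K = "UNIV - {i, j}"
  have U: "insert j ?K = UNIV - {i}" "insert i (UNIV - {i}) = UNIV" using ij by auto
  \<comment> \<open>With all other coordinates frozen, only the two-dimensional statement
    remains.\<close>
  have split: "(\<integral>\<^sup>+x. f x \<partial>noise) = (\<integral>\<^sup>+z. \<integral>\<^sup>+y. \<integral>\<^sup>+x. f (z(j := y, i := x)) \<partial>gauss \<partial>gauss \<partial>PiM ?K (\<lambda>_. gauss))"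
    if f[measurable]: "f \<in> borel_measurable noise" for f
  proof -
    have f1: "f \<in> borel_measurable (PiM (insert i (UNIV - {i})) (\<lambda>_. gauss))" using f unfolding U noise_def .
    have "(\<integral>\<^sup>+x. f x \<partial>noise) = (\<integral>\<^sup>+z. \<integral>\<^sup>+x. f (z(i := x)) \<partial>gauss \<partial>PiM (insert j ?K) (\<lambda>_. gauss))"
      unfolding noise_def using nn_integral_noise_insert[OF f1] unfolding U .
    also have "\<dots> = (\<integral>\<^sup>+z. \<integral>\<^sup>+y. \<integral>\<^sup>+x. f (z(j := y, i := x)) \<partial>gauss \<partial>gauss \<partial>PiM ?K (\<lambda>_. gauss))"
    proof (rule nn_integral_noise_insert)
      have "(\<lambda>(z, x). z(i := x)) \<in> PiM (UNIV - {i}) (\<lambda>_. gauss) \<Otimes>\<^sub>M gauss \<rightarrow>\<^sub>M PiM (insert i (UNIV - {i})) (\<lambda>_. gauss)"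
        by measurable
      then have [measurable]: "(\<lambda>(z, x). z(i := x)) \<in> PiM (insert j ?K) (\<lambda>_. gauss) \<Otimes>\<^sub>M gauss \<rightarrow>\<^sub>M noise"
        unfolding U noise_def .
      show "(\<lambda>z. \<integral>\<^sup>+x. f (z(i := x)) \<partial>gauss) \<in> borel_measurable (PiM (insert j ?K) (\<lambda>_. gauss))"
        by (rule gauss.borel_measurable_nn_integral) (use measurable_compose[OF \<open>(\<lambda>(z, x). z(i := x)) \<in> PiM (insert j ?K) (\<lambda>_. gauss) \<Otimes>\<^sub>M gauss \<rightarrow>\<^sub>M noise\<close> f] in \<open>simp add: case_prod_beta'\<close>)
    qed
    finally show ?thesis .
  qed
  have upd: "(\<lambda>p. z(j := snd p, i := fst p)) \<in> borel \<Otimes>\<^sub>M borel \<rightarrow>\<^sub>M noise" for z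
    by (rule measurable_noiseI) (auto simp: fun_upd_def intro!: measurable_noise_component borel_measurable_divide borel_measurable_add borel_measurable_diff)
  have "emeasure (distr noise noise (rotation i j)) A = (\<integral>\<^sup>+x. indicator A (rotation i j x) \<partial>noise)"
    by (subst nn_integral_indicator[symmetric], simp, subst nn_integral_distr, simp_all)
  also have "\<dots> = (\<integral>\<^sup>+z. \<integral>\<^sup>+y. \<integral>\<^sup>+x. indicator A (rotation i j (z(j := y, i := x))) \<partial>gauss \<partial>gauss \<partial>PiM ?K (\<lambda>_. gauss))"
    by (rule split) measurable
  also have "\<dots> = (\<integral>\<^sup>+z. \<integral>\<^sup>+y. \<integral>\<^sup>+x. indicator A (z(j := y, i := x)) \<partial>gauss \<partial>gauss \<partial>PiM ?K (\<lambda>_. gauss))"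
  proof (rule nn_integral_cong)
    fix z
    define g where "g p = (indicator A (z(j := snd p, i := fst p)) :: ennreal)" for p :: "real \<times> real"
    have g: "g \<in> borel_measurable (borel \<Otimes>\<^sub>M borel)"
      unfolding g_def by (rule measurable_compose[OF upd[of z] borel_measurable_indicator[OF A]])
    have "rotation i j (z(j := y, i := x)) = z(j := (x - y) / sqrt 2, i := (x + y) / sqrt 2)" for x y
      using ij by (auto simp: rotation_def fun_eq_iff)
    then have "indicator A (rotation i j (z(j := y, i := x))) = g ((x + y) / sqrt 2, (x - y) / sqrt 2)" for x y
      by (simp only: g_def fst_conv snd_conv)
    then have "(\<integral>\<^sup>+y. \<integral>\<^sup>+x. indicator A (rotation i j (z(j := y, i := x))) \<partial>gauss \<partial>gauss) = (\<integral>\<^sup>+y. \<integral>\<^sup>+x. g ((x + y) / sqrt 2, (x - y) / sqrt 2) \<partial>gauss \<partial>gauss)"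
      by (simp only:)
    also have "\<dots> = (\<integral>\<^sup>+y. \<integral>\<^sup>+x. g (x, y) \<partial>gauss \<partial>gauss)" by (rule nn_integral_gauss_rotate[OF g])
    also have "\<dots> = (\<integral>\<^sup>+y. \<integral>\<^sup>+x. indicator A (z(j := y, i := x)) \<partial>gauss \<partial>gauss)" by (simp only: g_def fst_conv snd_conv)
    finally show "(\<integral>\<^sup>+y. \<integral>\<^sup>+x. indicator A (rotation i j (z(j := y, i := x))) \<partial>gauss \<partial>gauss) = (\<integral>\<^sup>+y. \<integral>\<^sup>+x. indicator A (z(j := y, i := x)) \<partial>gauss \<partial>gauss)" .
  qed
  also have "\<dots> = (\<integral>\<^sup>+x. indicator A x \<partial>noise)"
    by (rule split[symmetric]) measurable
  finally show "emeasure (distr noise noise (rotation i j)) A = emeasure noise A" by simp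
qed simp

fun rotations :: "(nat \<Rightarrow> ennreal) \<Rightarrow> (nat \<Rightarrow> ennreal) \<Rightarrow> nat \<Rightarrow> path \<Rightarrow> path" where
  "rotations p q 0 x = x"
| "rotations p q (Suc k) x = rotation (p k) (q k) (rotations p q k x)"

lemma measurable_rotations[measurable]: "rotations p q k \<in> noise \<rightarrow>\<^sub>M noise"
proof (induction k)
  case 0
  have "rotations p q 0 = (\<lambda>x. x)" by (simp add: fun_eq_iff)
  then show ?case by simp
next
  case (Suc k)
  have "rotations p q (Suc k) = (\<lambda>x. rotation (p k) (q k) (rotations p q k x))" by (simp add: fun_eq_iff)
  then show ?case using measurable_compose[OF Suc measurable_rotation] by simp
qed

lemma distr_rotations: "(\<And>j. j < k \<Longrightarrow> p j \<noteq> q j) \<Longrightarrow> distr noise noise (rotations p q k) = noise"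
proof (induction k)
  case 0
  have "rotations p q 0 = (\<lambda>x. x)" by (simp add: fun_eq_iff)
  then show ?case by (simp add: distr_id)
next
  case (Suc k)
  have "rotations p q (Suc k) = rotation (p k) (q k) \<circ> rotations p q k" by (simp add: fun_eq_iff)
  then have "distr noise noise (rotations p q (Suc k)) = distr (distr noise noise (rotations p q k)) noise (rotation (p k) (q k))"
    by (simp add: distr_distr)
  also have "\<dots> = noise" using Suc by (simp add: distr_rotation)
  finally show ?case .
qed

lemma rotations_other: "(\<And>j. j < k \<Longrightarrow> t \<noteq> p j \<and> t \<noteq> q j) \<Longrightarrow> rotations p q k x t = x t"
  by (induction k) (auto simp: rotation_def)

lemma rotations_pair:
  assumes "j < k" "inj_on p {..<k}" "inj_on q {..<k}" "\<And>i j. i < k \<Longrightarrow> j < k \<Longrightarrow> p i \<noteq> q j"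
  shows "rotations p q k x (p j) = (x (p j) + x (q j)) / sqrt 2 \<and> rotations p q k x (q j) = (x (p j) - x (q j)) / sqrt 2"
  using assms
proof (induction k)
  case (Suc k)
  have ne: "p i \<noteq> p k" "q i \<noteq> q k" if "i < k" for i
    using that Suc.prems(2,3) by (auto dest: inj_onD)
  have pq: "p i \<noteq> q j" if "i < Suc k" "j < Suc k" for i j using Suc.prems(4) that by blast
  show ?case
  proof (cases "j = k")
    case True
    have "rotations p q k x (p k) = x (p k)" "rotations p q k x (q k) = x (q k)"
      using ne pq by (intro rotations_other; metis less_Suc_eq)+
    then show ?thesis using True pq[of k k] by (simp add: rotation_def)
  next
    case False
    then have j: "j < k" using Suc.prems(1) by simp
    have "rotations p q k x (p j) = (x (p j) + x (q j)) / sqrt 2 \<and> rotations p q k x (q j) = (x (p j) - x (q j)) / sqrt 2"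
      using j Suc.prems by (intro Suc.IH) (auto simp: inj_on_def)
    moreover have "rotation (p k) (q k) y (p j) = y (p j)" "rotation (p k) (q k) y (q j) = y (q j)" for y
      using ne[OF j] pq[of j k] pq[of k j] j by (auto simp: rotation_def)
    ultimately show ?thesis by simp
  qed
qed simp

section \<open>Dyadic nodes and Levy's midpoint construction\<close>

definition node :: "nat \<Rightarrow> nat \<Rightarrow> nat \<Rightarrow> ennreal" where
  "node m n k = ennreal (real m + real k / 2 ^ n)"

lemma node_eq_iff: "node m n i = node m n' j \<longleftrightarrow> real i / 2 ^ n = real j / 2 ^ n'"
  unfolding node_def by (subst ennreal_inj) simp_all

lemma node_less_iff: "node m n i < node m n' j \<longleftrightarrow> real i / 2 ^ n < real j / 2 ^ n'"
  unfolding node_def by (subst ennreal_less_iff) simp_all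

lemma node_even: "node m (Suc n) (2 * k) = node m n k"
  by (simp add: node_eq_iff)

lemma node_inj: "node m n i = node m n j \<longleftrightarrow> i = j"
  by (simp add: node_eq_iff)

text \<open>A node serves both as a time and as the index of a noise coordinate. By parity, an odd
  multiple of a finer mesh width is never a coarser node, so the coordinate stored there has not
  been used yet.\<close>

lemma node_neq_odd: assumes "n \<le> j" shows "node m n i \<noteq> node m (Suc j) (2 * k + 1)"
proof
  assume "node m n i = node m (Suc j) (2 * k + 1)"
  then have "real i / 2 ^ n = real (2 * k + 1) / 2 ^ Suc j" by (simp only: node_eq_iff)
  moreover have p: "(2::real) ^ Suc j = 2 ^ n * 2 ^ (Suc j - n)" using assms by (simp flip: power_add)
  ultimately have e: "real i / 2 ^ n = real (2 * k + 1) / (2 ^ n * 2 ^ (Suc j - n))" by (simp only:)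
  have "real i * 2 ^ (Suc j - n) = real i / 2 ^ n * (2 ^ n * 2 ^ (Suc j - n))" by simp
  also have "\<dots> = real (2 * k + 1)" unfolding e by simp
  finally have "real i * 2 ^ (Suc j - n) = real (2 * k + 1)" .
  then have "real (i * 2 ^ (Suc j - n)) = real (2 * k + 1)" by (simp only: of_nat_mult of_nat_power of_nat_numeral)
  then have "i * 2 ^ (Suc j - n) = 2 * k + 1" by (simp only: of_nat_eq_iff)
  moreover have "even (i * 2 ^ (Suc j - n))" using assms by simp
  ultimately show False by simp
qed

text \<open>Levy's construction, from coarse to fine. The coordinate of \<open>level m n x\<close> at \<open>node m n i\<close>, for
  \<open>i < 2 ^ n\<close>, is the increment of \<open>brown m x\<close> over the \<open>i\<close>-th dyadic interval of length \<open>2 ^ -n\<close>,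
  normalised to variance 1. To halve the intervals, rotate the pair of an increment and a fresh
  coordinate; this preserves \<^const>\<open>noise\<close>.\<close>

fun level :: "nat \<Rightarrow> nat \<Rightarrow> path \<Rightarrow> path" where
  "level m 0 x = x"
| "level m (Suc n) x = rotations (node m n) (\<lambda>k. node m (Suc n) (2 * k + 1)) (2 ^ n) (level m n x)"

lemma measurable_level[measurable]: "level m n \<in> noise \<rightarrow>\<^sub>M noise"
proof (induction n)
  case 0
  have "level m 0 = (\<lambda>x. x)" by (simp add: fun_eq_iff)
  then show ?case by simp
next
  case (Suc n)
  have "level m (Suc n) = (\<lambda>x. rotations (node m n) (\<lambda>k. node m (Suc n) (2 * k + 1)) (2 ^ n) (level m n x))" by (simp add: fun_eq_iff)
  then show ?case using measurable_compose[OF Suc measurable_rotations] by simp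
qed

lemma distr_level: "distr noise noise (level m n) = noise"
proof (induction n)
  case 0
  have "level m 0 = (\<lambda>x. x)" by (simp add: fun_eq_iff)
  then show ?case by (simp add: distr_id)
next
  case (Suc n)
  let ?r = "rotations (node m n) (\<lambda>k. node m (Suc n) (2 * k + 1)) (2 ^ n)"
  have "level m (Suc n) = ?r \<circ> level m n" by (simp add: fun_eq_iff)
  then have "distr noise noise (level m (Suc n)) = distr (distr noise noise (level m n)) noise ?r"
    by (simp add: distr_distr)
  also have "\<dots> = noise" unfolding Suc by (rule distr_rotations) (rule node_neq_odd[OF order_refl])
  finally show ?case .
qed

lemma level_fresh: "(\<And>i. i < 2 ^ n \<Longrightarrow> t \<noteq> node m n i) \<Longrightarrow> level m n x t = x t"
proof (induction n)
  case (Suc n)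
  have "t \<noteq> node m n j \<and> t \<noteq> node m (Suc n) (2 * j + 1)" if "j < 2 ^ n" for j
    using that Suc.prems[of "2 * j"] Suc.prems[of "2 * j + 1"] by (simp add: node_even)
  then have "level m (Suc n) x t = level m n x t" by (simp add: rotations_other)
  also have "\<dots> = x t"
  proof (rule Suc.IH)
    fix i :: nat assume "i < 2 ^ n"
    then show "t \<noteq> node m n i" using Suc.prems[of "2 * i"] by (simp add: node_even)
  qed
  finally show ?case .
qed simp

text \<open>Levy's midpoint rule: up to normalisation, the increments over the two halves have the
  increment over the whole interval as their sum and a fresh normal variable as their difference.
  The left half is stored at the old node, the right half at the new midpoint.\<close>

lemma level_Suc:
  assumes "k < 2 ^ n"
  shows "level m (Suc n) x (node m n k) = (level m n x (node m n k) + x (node m (Suc n) (2 * k + 1))) / sqrt 2"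
    "level m (Suc n) x (node m (Suc n) (2 * k + 1)) = (level m n x (node m n k) - x (node m (Suc n) (2 * k + 1))) / sqrt 2"
proof -
  have f: "level m n x (node m (Suc n) (2 * k + 1)) = x (node m (Suc n) (2 * k + 1))"
    by (rule level_fresh) (rule node_neq_odd[OF order_refl, symmetric])
  have "rotations (node m n) (\<lambda>k. node m (Suc n) (2 * k + 1)) (2 ^ n) y (node m n k) = (y (node m n k) + y (node m (Suc n) (2 * k + 1))) / sqrt 2 \<and>
     rotations (node m n) (\<lambda>k. node m (Suc n) (2 * k + 1)) (2 ^ n) y (node m (Suc n) (2 * k + 1)) = (y (node m n k) - y (node m (Suc n) (2 * k + 1))) / sqrt 2" for y
    by (rule rotations_pair[OF assms]) (auto simp: inj_on_def node_inj intro!: node_neq_odd[OF order_refl, simplified])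
  note r = this[of "level m n x"]
  show "level m (Suc n) x (node m n k) = (level m n x (node m n k) + x (node m (Suc n) (2 * k + 1))) / sqrt 2"
    "level m (Suc n) x (node m (Suc n) (2 * k + 1)) = (level m n x (node m n k) - x (node m (Suc n) (2 * k + 1))) / sqrt 2"
    using r unfolding f level.simps by blast+
qed

section \<open>The Schauder expansion\<close>

definition clamp :: "real \<Rightarrow> real" where "clamp z = max 0 (min 1 z)"
definition tent :: "real \<Rightarrow> real" where "tent z = max 0 (1 - \<bar>2 * z - 1\<bar>)"

text \<open>\<open>clamp (2 ^ n * t - i)\<close> is the fraction of the \<open>i\<close>-th dyadic
  interval that has elapsed by time \<open>t\<close>, and \<open>tent\<close> is the Schauder hat.
  By these identities, splitting every increment into two halves adds exactly one layer of
  hats.\<close>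

lemma clamp_tent:
  "clamp (2 * z) + clamp (2 * z - 1) = 2 * clamp z" "clamp (2 * z) - clamp (2 * z - 1) = tent z"
  by (auto simp: clamp_def tent_def max_def min_def abs_if)

lemma tent_diff_nat: "tent (real a - real b) = 0"
  by (cases "a \<le> b") (auto simp: tent_def max_def abs_if)

text \<open>A hat over an interval of length \<open>h = 2 ^ -j\<close> has a peak with standard
  deviation \<open>sqrt h / 2\<close>, that of a Brownian bridge at the midpoint; this is the factor
  \<open>1 / 2 * (1 / sqrt 2) ^ j\<close>.\<close>

definition schauder :: "nat \<Rightarrow> path \<Rightarrow> nat \<Rightarrow> real \<Rightarrow> real" where
  "schauder m x j t = (\<Sum>k<2 ^ j. 1 / 2 * (1 / sqrt 2) ^ j * x (node m (Suc j) (2 * k + 1)) * tent (2 ^ j * t - real k))"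

definition brown_partial :: "nat \<Rightarrow> path \<Rightarrow> nat \<Rightarrow> real \<Rightarrow> real" where
  "brown_partial m x n t = x (node m 0 0) * t + (\<Sum>j<n. schauder m x j t)"

text \<open>Where the series diverges, \<open>lim\<close> gives an unspecified value. At dyadic
  points all but finitely many summands vanish, and on tame paths the series converges everywhere in
  the unit interval.\<close>

definition brown :: "nat \<Rightarrow> path \<Rightarrow> real \<Rightarrow> real" where
  "brown m x t = lim (\<lambda>n. brown_partial m x n t)"

lemma sum_lessThan_double: "(\<Sum>i<2 * K. f i) = (\<Sum>k<K. f (2 * k) + f (2 * k + 1))" for f :: "nat \<Rightarrow> real"
  by (induction K) (simp_all add: algebra_simps)

text \<open>Two descriptions of one piecewise linear function. The Schauder series in the original
  coordinates yields convergence and continuity; the sum of normalised increments yields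
  independence of past and future.\<close>

lemma brown_partial_eq:
  assumes t: "0 \<le> t" "t \<le> 1"
  shows "brown_partial m x n t = (\<Sum>i<2 ^ n. (1 / sqrt 2) ^ n * level m n x (node m n i) * clamp (2 ^ n * t - real i))"
\<comment> \<open>Halving the \<open>k\<close>-th interval replaces \<open>Y * clamp z\<close> by
  \<open>(Y + f) / 2 * clamp (2 * z) + (Y - f) / 2 * clamp (2 * z - 1)\<close>, where
  \<open>f\<close> is the fresh coordinate; regrouping by \<open>Y\<close> and \<open>f\<close>
  gives the old summand and a hat.\<close>
proof (induction n)
  case 0
  then show ?case using t by (simp add: brown_partial_def clamp_def)
next
  case (Suc n)
  let ?c = "1 / sqrt 2 :: real" and ?f = "\<lambda>k. x (node m (Suc n) (2 * k + 1))" and ?Y = "\<lambda>k. level m n x (node m n k)"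
  have aux1: "c * ((Y + f) / 2) * A + c * ((Y - f) / 2) * B = c * (Y / 2 * (A + B) + f / 2 * (A - B))" for c Y f A B :: real
    by (simp add: field_simps)
  have aux2: "c * (Y / 2 * (2 * C) + f / 2 * T) = c * Y * C + 1 / 2 * c * f * T" for c Y f C T :: real
    by (simp add: field_simps)
  have c2: "?c ^ Suc n * (a / sqrt 2) = ?c ^ n * (a / 2)" for a :: real by simp
  have "(\<Sum>i<2 ^ Suc n. ?c ^ Suc n * level m (Suc n) x (node m (Suc n) i) * clamp (2 ^ Suc n * t - real i))
    = (\<Sum>k<2 ^ n. ?c ^ Suc n * level m (Suc n) x (node m (Suc n) (2 * k)) * clamp (2 ^ Suc n * t - real (2 * k))
       + ?c ^ Suc n * level m (Suc n) x (node m (Suc n) (2 * k + 1)) * clamp (2 ^ Suc n * t - real (2 * k + 1)))"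
    unfolding power_Suc by (rule sum_lessThan_double)
  also have "\<dots> = (\<Sum>k<2 ^ n. ?c ^ n * ?Y k * clamp (2 ^ n * t - real k) + 1 / 2 * ?c ^ n * ?f k * tent (2 ^ n * t - real k))"
  proof (rule sum.cong[OF refl])
    fix k :: nat assume "k \<in> {..<2 ^ n}"
    then have k: "k < 2 ^ n" by simp
    define z where "z = 2 ^ n * t - real k"
    have z: "2 ^ Suc n * t - real (2 * k) = 2 * z" "2 ^ Suc n * t - real (2 * k + 1) = 2 * z - 1" by (simp_all add: z_def)
    have "?c ^ Suc n * level m (Suc n) x (node m (Suc n) (2 * k)) * clamp (2 ^ Suc n * t - real (2 * k))
       + ?c ^ Suc n * level m (Suc n) x (node m (Suc n) (2 * k + 1)) * clamp (2 ^ Suc n * t - real (2 * k + 1))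
      = ?c ^ n * ((?Y k + ?f k) / 2) * clamp (2 * z) + ?c ^ n * ((?Y k - ?f k) / 2) * clamp (2 * z - 1)"
      unfolding z node_even level_Suc[OF k] c2 ..
    also have "\<dots> = ?c ^ n * (?Y k / 2 * (clamp (2 * z) + clamp (2 * z - 1)) + ?f k / 2 * (clamp (2 * z) - clamp (2 * z - 1)))"
      by (rule aux1)
    also have "\<dots> = ?c ^ n * ?Y k * clamp z + 1 / 2 * ?c ^ n * ?f k * tent z"
      unfolding clamp_tent by (rule aux2)
    finally show "?c ^ Suc n * level m (Suc n) x (node m (Suc n) (2 * k)) * clamp (2 ^ Suc n * t - real (2 * k))
       + ?c ^ Suc n * level m (Suc n) x (node m (Suc n) (2 * k + 1)) * clamp (2 ^ Suc n * t - real (2 * k + 1)) =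
       ?c ^ n * ?Y k * clamp (2 ^ n * t - real k) + 1 / 2 * ?c ^ n * ?f k * tent (2 ^ n * t - real k)"
      unfolding z_def .
  qed
  also have "\<dots> = brown_partial m x n t + schauder m x n t"
    unfolding Suc.IH schauder_def by (rule sum.distrib)
  also have "\<dots> = brown_partial m x (Suc n) t" by (simp add: brown_partial_def)
  finally show ?case ..
qed

lemma schauder_dyadic:
  assumes "n \<le> j" shows "schauder m x j (real k / 2 ^ n) = 0"
proof -
  have "(2::real) ^ j = 2 ^ n * 2 ^ (j - n)" using assms by (simp flip: power_add)
  then have "(2::real) ^ j * (real k / 2 ^ n) = real (k * 2 ^ (j - n))" by simp
  then show ?thesis unfolding schauder_def by (simp only: tent_diff_nat) simp
qed

lemma dyadic_le_1: assumes "k \<le> 2 ^ n" shows "real k / 2 ^ n \<le> 1"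
proof -
  have "real k \<le> real (2 ^ n)" using assms by (rule of_nat_le_iff[THEN iffD2])
  then show ?thesis by simp
qed

text \<open>Holds for every \<open>x\<close>, not just almost surely, because the partial sums are
  constant from index \<open>n\<close> on.\<close>

lemma brown_dyadic:
  assumes k: "k \<le> 2 ^ n"
  shows "brown m x (real k / 2 ^ n) = (\<Sum>i<k. (1 / sqrt 2) ^ n * level m n x (node m n i))"
proof -
  have "brown_partial m x (j + n) (real k / 2 ^ n) = brown_partial m x n (real k / 2 ^ n)" for j
    by (induction j) (simp_all add: brown_partial_def schauder_dyadic)
  then have "(\<lambda>j. brown_partial m x (j + n) (real k / 2 ^ n)) \<longlonglongrightarrow> brown_partial m x n (real k / 2 ^ n)" by simp
  then have "(\<lambda>j. brown_partial m x j (real k / 2 ^ n)) \<longlonglongrightarrow> brown_partial m x n (real k / 2 ^ n)" by (rule LIMSEQ_offset)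
  then have "brown m x (real k / 2 ^ n) = brown_partial m x n (real k / 2 ^ n)" unfolding brown_def by (rule limI)
  also have "\<dots> = (\<Sum>i<2 ^ n. (1 / sqrt 2) ^ n * level m n x (node m n i) * clamp (2 ^ n * (real k / 2 ^ n) - real i))"
    by (rule brown_partial_eq) (simp_all only: dyadic_le_1[OF k], simp)
  also have "\<dots> = (\<Sum>i<2 ^ n. if i < k then (1 / sqrt 2) ^ n * level m n x (node m n i) else 0)"
  proof (rule sum.cong[OF refl])
    fix i
    have "2 ^ n * (real k / 2 ^ n) = real k" by simp
    moreover have "clamp (real k - real i) = (if i < k then 1 else 0)" by (auto simp: clamp_def)
    ultimately show "(1 / sqrt 2) ^ n * level m n x (node m n i) * clamp (2 ^ n * (real k / 2 ^ n) - real i) =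
      (if i < k then (1 / sqrt 2) ^ n * level m n x (node m n i) else 0)" by simp
  qed
  also have "\<dots> = (\<Sum>i<k. (1 / sqrt 2) ^ n * level m n x (node m n i))"
    using k by (intro sum.mono_neutral_cong_right) auto
  finally show ?thesis .
qed

lemma brown_1: "brown m x 1 = x (node m 0 0)"
  using brown_dyadic[of 1 0 m x] by simp

lemma brown_0: "brown m x 0 = 0"
  using brown_dyadic[of 0 0 m x] by simp

lemma brown_increment:
  assumes k: "k \<le> 2 ^ n"
  shows "x (node m 0 0) = brown m x (real k / 2 ^ n) + (1 / sqrt 2) ^ n * (\<Sum>i\<in>{k..<2 ^ n}. level m n x (node m n i))"
proof -
  have "x (node m 0 0) = (\<Sum>i<2 ^ n. (1 / sqrt 2) ^ n * level m n x (node m n i))"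
    using brown_dyadic[of "2 ^ n" n m x] by (simp add: brown_1)
  also have "{..<2 ^ n} = {..<k} \<union> {k..<2 ^ n}" using k by auto
  also have "(\<Sum>i\<in>{..<k} \<union> {k..<2 ^ n}. (1 / sqrt 2) ^ n * level m n x (node m n i)) =
     (\<Sum>i<k. (1 / sqrt 2) ^ n * level m n x (node m n i)) + (\<Sum>i\<in>{k..<2 ^ n}. (1 / sqrt 2) ^ n * level m n x (node m n i))"
    by (rule sum.union_disjoint) auto
  finally show ?thesis using brown_dyadic[OF k, of m x] by (simp add: sum_distrib_left)
qed

text \<open>Since \<open>level m n\<close> stores increments over intervals at their left end points, its coordinates before
  \<open>node m n k\<close> determine the Brownian motions up to that time, and they are independent of the
  remaining increments.\<close>

definition past :: "nat \<Rightarrow> nat \<Rightarrow> nat \<Rightarrow> path measure" where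
  "past m n k = vimage_algebra UNIV (\<lambda>x. restrict (level m n x) {..<node m n k}) (PiM {..<node m n k} (\<lambda>_. borel))"

lemma space_past[simp]: "space (past m n k) = UNIV"
  by (simp add: past_def)

lemma past_level:
  assumes "t < node m n k" shows "(\<lambda>x. level m n x t) \<in> borel_measurable (past m n k)"
proof -
  have "(\<lambda>x. restrict (level m n x) {..<node m n k}) \<in> past m n k \<rightarrow>\<^sub>M PiM {..<node m n k} (\<lambda>_. borel)"
    unfolding past_def by (rule measurable_vimage_algebra1) (auto simp: space_PiM)
  from measurable_compose[OF this measurable_component_singleton, of t] assms show ?thesis by simp
qed

lemma past_coord:
  assumes "t < node m n k" "\<And>i. i < 2 ^ n \<Longrightarrow> t \<noteq> node m n i"
  shows "(\<lambda>x. x t) \<in> borel_measurable (past m n k)"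
  using past_level[OF assms(1)] level_fresh[OF assms(2)] by simp

text \<open>A hat that does not vanish at \<open>u\<close> begins before \<open>u\<close>. As its
  interval belongs to a grid at least as fine as level \<open>n\<close>, it ends at or before
  \<open>k / 2 ^ n\<close>, so its midpoint, the index of its coefficient, lies in the past.\<close>

lemma past_schauder:
  assumes j: "n \<le> j" and u: "u \<le> real k / 2 ^ n"
  shows "(\<lambda>x. schauder m x j u) \<in> borel_measurable (past m n k)"
  unfolding schauder_def
proof (rule borel_measurable_sum)
  fix i :: nat
  show "(\<lambda>x. 1 / 2 * (1 / sqrt 2) ^ j * x (node m (Suc j) (2 * i + 1)) * tent (2 ^ j * u - real i)) \<in> borel_measurable (past m n k)"
  proof (cases "real i < 2 ^ j * u")
    case True
    have p: "(2::real) ^ j = 2 ^ n * 2 ^ (j - n)" using j by (simp flip: power_add)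
    have "2 ^ j * u \<le> 2 ^ j * (real k / 2 ^ n)" using u by (intro mult_left_mono) simp_all
    also have "(2::real) ^ j * (real k / 2 ^ n) = real (k * 2 ^ (j - n))" using p by simp
    finally have "2 ^ j * u \<le> real (k * 2 ^ (j - n))" .
    with True have "real i < real (k * 2 ^ (j - n))" by (rule less_le_trans)
    then have "i < k * 2 ^ (j - n)" by (simp only: of_nat_less_iff)
    then have "2 * i + 1 < 2 * (k * 2 ^ (j - n))" by linarith
    then have "real (2 * i + 1) < real (2 * (k * 2 ^ (j - n)))" by (rule of_nat_less_iff[THEN iffD2])
    then have "real (2 * i + 1) / 2 ^ Suc j < real (2 * (k * 2 ^ (j - n))) / 2 ^ Suc j" by (rule divide_strict_right_mono) simp
    also have "real (2 * (k * 2 ^ (j - n))) / 2 ^ Suc j = real k / 2 ^ n" using p by simp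
    finally have "node m (Suc j) (2 * i + 1) < node m n k" by (simp only: node_less_iff)
    then have "(\<lambda>x. x (node m (Suc j) (2 * i + 1))) \<in> borel_measurable (past m n k)"
      by (rule past_coord) (rule node_neq_odd[OF j, symmetric])
    then show ?thesis by (intro borel_measurable_times borel_measurable_const)
  next
    case False
    then have "tent (2 ^ j * u - real i) = 0" by (simp add: tent_def)
    then show ?thesis by simp
  qed
qed

lemma past_brown:
  assumes u: "0 \<le> u" "u \<le> real k / 2 ^ n" and k: "k \<le> 2 ^ n"
  shows "(\<lambda>x. brown m x u) \<in> borel_measurable (past m n k)"
proof -
  have "real k / 2 ^ n \<le> 1" by (rule dyadic_le_1[OF k])
  then have u1: "u \<le> 1" using u by linarith
  \<comment> \<open>The coarse layers cannot be treated one by one: the coefficient of a hat that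
    straddles \<open>u\<close> looks into the future, and already the linear term contains the value
    at time 1. Their sum is therefore expressed by the increments of level \<open>n\<close>.\<close>
  have "brown m x u = lim (\<lambda>j. brown_partial m x n u + (\<Sum>i<j. schauder m x (n + i) u))" for x
  proof -
    have e: "brown_partial m x (j + n) u = brown_partial m x n u + (\<Sum>i<j. schauder m x (n + i) u)" for j
      by (induction j) (simp_all add: brown_partial_def add.commute)
    have "((\<lambda>j. brown_partial m x j u) \<longlonglongrightarrow> L) = ((\<lambda>j. brown_partial m x n u + (\<Sum>i<j. schauder m x (n + i) u)) \<longlonglongrightarrow> L)" for L
    proof
      assume "(\<lambda>j. brown_partial m x j u) \<longlonglongrightarrow> L"
      from LIMSEQ_ignore_initial_segment[OF this, of n] show "(\<lambda>j. brown_partial m x n u + (\<Sum>i<j. schauder m x (n + i) u)) \<longlonglongrightarrow> L"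
        by (simp only: e)
    next
      assume "(\<lambda>j. brown_partial m x n u + (\<Sum>i<j. schauder m x (n + i) u)) \<longlonglongrightarrow> L"
      then have "(\<lambda>j. brown_partial m x (j + n) u) \<longlonglongrightarrow> L" by (simp only: e)
      then show "(\<lambda>j. brown_partial m x j u) \<longlonglongrightarrow> L" by (rule LIMSEQ_offset)
    qed
    then show ?thesis unfolding brown_def lim_def by simp
  qed
  moreover have "(\<lambda>x. lim (\<lambda>j. brown_partial m x n u + (\<Sum>i<j. schauder m x (n + i) u))) \<in> borel_measurable (past m n k)"
  proof (intro borel_measurable_lim_metric borel_measurable_add borel_measurable_sum past_schauder le_add1 u(2))
    show "(\<lambda>x. brown_partial m x n u) \<in> borel_measurable (past m n k)"
      unfolding brown_partial_eq[OF u(1) u1]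
    proof (rule borel_measurable_sum)
      fix i :: nat
      show "(\<lambda>x. (1 / sqrt 2) ^ n * level m n x (node m n i) * clamp (2 ^ n * u - real i)) \<in> borel_measurable (past m n k)"
      proof (cases "i < k")
        case True
        then have "node m n i < node m n k" by (simp add: node_less_iff divide_strict_right_mono)
        then show ?thesis by (intro borel_measurable_times borel_measurable_const past_level)
      next
        case False
        have "2 ^ n * u \<le> 2 ^ n * (real k / 2 ^ n)" using u by (intro mult_left_mono) simp_all
        also have "\<dots> \<le> real i" using False by simp
        finally have "clamp (2 ^ n * u - real i) = 0" by (simp add: clamp_def)
        then show ?thesis by simp
      qed
    qed
  qed
  ultimately show ?thesis by simp
qed

section \<open>Freezing the past\<close>

lemma (in prob_space) distr_freeze:
  assumes ind: "indep_var S X S' Y" and f: "f \<in> S' \<rightarrow>\<^sub>M T"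
  defines "G \<equiv> vimage_algebra (space M) X S"
  shows "distr M G (\<lambda>x. x) \<Otimes>\<^sub>M distr M T (\<lambda>x. f (Y x)) = distr M (G \<Otimes>\<^sub>M T) (\<lambda>x. (x, f (Y x)))"
    "(\<lambda>x. x) \<in> M \<rightarrow>\<^sub>M G" "(\<lambda>x. f (Y x)) \<in> M \<rightarrow>\<^sub>M T"
proof -
  have X: "X \<in> M \<rightarrow>\<^sub>M S" and Y: "Y \<in> M \<rightarrow>\<^sub>M S'" using indep_var_rv1[OF ind] indep_var_rv2[OF ind] by auto
  have sub: "sets G \<subseteq> sets M" unfolding G_def by (rule sets_image_in_sets[OF refl X])
  show id: "(\<lambda>x. x) \<in> M \<rightarrow>\<^sub>M G"
    using sub by (intro measurableI) (auto simp: G_def intro!: sets.Int_space_eq2 dest: sets.sets_into_space)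
  show D: "(\<lambda>x. f (Y x)) \<in> M \<rightarrow>\<^sub>M T" by (rule measurable_compose[OF Y f])
  interpret X: prob_space "distr M G (\<lambda>x. x)" by (rule prob_space_distr[OF id])
  interpret Y: prob_space "distr M T (\<lambda>x. f (Y x))" by (rule prob_space_distr[OF D])
  have mp: "(\<lambda>x. (x, f (Y x))) \<in> M \<rightarrow>\<^sub>M G \<Otimes>\<^sub>M T" using id D by (rule measurable_Pair)
  show "distr M G (\<lambda>x. x) \<Otimes>\<^sub>M distr M T (\<lambda>x. f (Y x)) = distr M (G \<Otimes>\<^sub>M T) (\<lambda>x. (x, f (Y x)))"
  proof (rule pair_measure_eqI)
    show "sigma_finite_measure (distr M G (\<lambda>x. x))" "sigma_finite_measure (distr M T (\<lambda>x. f (Y x)))" ..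
    fix A B assume "A \<in> sets (distr M G (\<lambda>x. x))" "B \<in> sets (distr M T (\<lambda>x. f (Y x)))"
    then have A: "A \<in> sets G" and B: "B \<in> sets T" by simp_all
    obtain A' where A': "A' \<in> sets S" "A = X -` A' \<inter> space M"
      using A measurable_space[OF X] unfolding G_def by (auto simp: sets_vimage_algebra2 Pi_iff)
    let ?B = "f -` B \<inter> space S'"
    have B': "?B \<in> sets S'" by (rule measurable_sets[OF f B])
    have "emeasure (distr M G (\<lambda>x. x)) A = prob (X -` A' \<inter> space M)"
      using A A' sets.sets_into_space[of A G] by (subst emeasure_distr[OF id]) (auto simp: emeasure_eq_measure G_def Int_absorb2)
    moreover have eB: "(\<lambda>x. f (Y x)) -` B \<inter> space M = Y -` ?B \<inter> space M" using measurable_space[OF Y] by auto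
    then have "emeasure (distr M T (\<lambda>x. f (Y x))) B = prob (Y -` ?B \<inter> space M)"
      by (subst emeasure_distr[OF D B]) (simp add: emeasure_eq_measure)
    moreover have "emeasure (distr M (G \<Otimes>\<^sub>M T) (\<lambda>x. (x, f (Y x)))) (A \<times> B) = prob ((\<lambda>x. (X x, Y x)) -` (A' \<times> ?B) \<inter> space M)"
    proof (subst emeasure_distr[OF mp])
      have "(\<lambda>x. (x, f (Y x))) -` (A \<times> B) \<inter> space M = (\<lambda>x. (X x, Y x)) -` (A' \<times> ?B) \<inter> space M"
        using A'(2) measurable_space[OF Y] by auto
      then show "emeasure M ((\<lambda>x. (x, f (Y x))) -` (A \<times> B) \<inter> space M) = prob ((\<lambda>x. (X x, Y x)) -` (A' \<times> ?B) \<inter> space M)"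
        by (simp add: emeasure_eq_measure)
    qed (use A B in simp)
    ultimately show "emeasure (distr M G (\<lambda>x. x)) A * emeasure (distr M T (\<lambda>x. f (Y x))) B = emeasure (distr M (G \<Otimes>\<^sub>M T) (\<lambda>x. (x, f (Y x)))) (A \<times> B)"
      using indep_varD[OF ind A'(1) B'] by (simp add: ennreal_mult)
  qed simp
qed

text \<open>An independent variable is integrated out with the past held fixed. The past is
  represented by the identity map into the sigma-algebra \<open>G\<close> generated by
  \<open>X\<close>, so that a \<open>G\<close>-measurable integrand need not be factored through
  \<open>X\<close>.\<close>

lemma (in prob_space) integral_freeze:
  fixes g :: "'a \<times> 'c \<Rightarrow> real"
  assumes ind: "indep_var S X S' Y" and f: "f \<in> S' \<rightarrow>\<^sub>M T"
    and G: "G = vimage_algebra (space M) X S"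
    and g: "g \<in> borel_measurable (G \<Otimes>\<^sub>M T)" and int: "integrable M (\<lambda>x. g (x, f (Y x)))"
  shows "(\<integral>x. g (x, f (Y x)) \<partial>M) = (\<integral>x. (\<integral>y. g (x, y) \<partial>distr M T (\<lambda>x. f (Y x))) \<partial>M)"
proof -
  note d = distr_freeze(1)[OF ind f, folded G] and m = distr_freeze(2)[OF ind f, folded G] distr_freeze(3)[OF ind f]
  interpret X: prob_space "distr M G (\<lambda>x. x)" by (rule prob_space_distr[OF m(1)])
  interpret Y: prob_space "distr M T (\<lambda>x. f (Y x))" by (rule prob_space_distr[OF m(2)])
  interpret pair_sigma_finite "distr M G (\<lambda>x. x)" "distr M T (\<lambda>x. f (Y x))" ..
  have mp: "(\<lambda>x. (x, f (Y x))) \<in> M \<rightarrow>\<^sub>M G \<Otimes>\<^sub>M T" using m by (rule measurable_Pair)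
  have i: "integrable (distr M G (\<lambda>x. x) \<Otimes>\<^sub>M distr M T (\<lambda>x. f (Y x))) g"
    unfolding d by (subst integrable_distr_eq[OF mp g]) (rule int)
  have "(\<integral>x. g (x, f (Y x)) \<partial>M) = (\<integral>p. g p \<partial>(distr M G (\<lambda>x. x) \<Otimes>\<^sub>M distr M T (\<lambda>x. f (Y x))))"
    unfolding d by (rule integral_distr[OF mp g, symmetric])
  also have "\<dots> = (\<integral>x. (\<integral>y. g (x, y) \<partial>distr M T (\<lambda>x. f (Y x))) \<partial>distr M G (\<lambda>x. x))"
    by (rule integral_fst'[OF i, symmetric])
  also have "\<dots> = (\<integral>x. (\<integral>y. g (x, y) \<partial>distr M T (\<lambda>x. f (Y x))) \<partial>M)"
  proof (rule integral_distr[OF m(1)])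
    have "sets (G \<Otimes>\<^sub>M distr M T (\<lambda>x. f (Y x))) = sets (G \<Otimes>\<^sub>M T)" by (rule sets_pair_measure_cong) simp_all
    then have "g \<in> borel_measurable (G \<Otimes>\<^sub>M distr M T (\<lambda>x. f (Y x)))" using g by (simp cong: measurable_cong_sets)
    then have "case_prod (\<lambda>x y. g (x, y)) \<in> borel_measurable (G \<Otimes>\<^sub>M distr M T (\<lambda>x. f (Y x)))" by simp
    then show "(\<lambda>x. \<integral>y. g (x, y) \<partial>distr M T (\<lambda>x. f (Y x))) \<in> borel_measurable G"
      by (rule Y.borel_measurable_lebesgue_integral)
  qed
  finally show ?thesis .
qed

lemma distr_noise_component: "distr noise borel (\<lambda>x. x t) = gauss"
proof -
  have "distr noise gauss (\<lambda>x. x t) = gauss"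
    unfolding noise_def by (rule distr_PiM_component) (simp_all add: gauss.prob_space_axioms)
  moreover have "distr noise gauss (\<lambda>x. x t) = distr noise borel (\<lambda>x. x t)"
    by (rule distr_cong) simp_all
  ultimately show ?thesis by simp
qed

lemma measurable_level_component: "(\<lambda>x. level m n x t) \<in> borel_measurable noise"
  by (rule measurable_compose[OF measurable_level measurable_noise_component])

lemma distr_level_component: "distr noise borel (\<lambda>x. level m n x t) = gauss"
proof -
  have "distr noise borel (\<lambda>x. level m n x t) = distr (distr noise noise (level m n)) borel (\<lambda>x. x t)"
    by (subst distr_distr[OF measurable_noise_component measurable_level]) (simp add: comp_def)
  then show ?thesis by (simp add: distr_level distr_noise_component)
qed

lemma indep_level: "noise.indep_vars (\<lambda>_. borel) (\<lambda>t x. level m n x t) UNIV"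
proof (subst noise.indep_vars_iff_distr_eq_PiM)
  have "distr noise (PiM UNIV (\<lambda>_. borel)) (\<lambda>x. \<lambda>i\<in>UNIV. level m n x i) = distr noise noise (level m n)"
    by (rule distr_cong) (simp_all add: sets_noise restrict_def)
  also have "\<dots> = PiM UNIV (\<lambda>i. distr noise borel (\<lambda>x. level m n x i))"
    unfolding distr_level distr_level_component by (simp add: noise_def)
  finally show "distr noise (PiM UNIV (\<lambda>_. borel)) (\<lambda>x. \<lambda>i\<in>UNIV. level m n x i) = PiM UNIV (\<lambda>i. distr noise borel (\<lambda>x. level m n x i))" .
qed (simp_all add: measurable_level_component)

lemma integral_past_freeze:
  fixes g :: "path \<times> 'c \<Rightarrow> real"
  assumes J: "J \<inter> {..<node m n k} = {}" and f: "f \<in> PiM J (\<lambda>_. borel) \<rightarrow>\<^sub>M T"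
    and g: "g \<in> borel_measurable (past m n k \<Otimes>\<^sub>M T)" and int: "integrable noise (\<lambda>x. g (x, f (restrict (level m n x) J)))"
  shows "(\<integral>x. g (x, f (restrict (level m n x) J)) \<partial>noise)
    = (\<integral>x. (\<integral>y. g (x, y) \<partial>distr noise T (\<lambda>x. f (restrict (level m n x) J))) \<partial>noise)"
proof (rule noise.integral_freeze[where f=f and Y="\<lambda>x. restrict (level m n x) J" and g=g and G="past m n k", OF _ f _ g int])
  show "noise.indep_var (PiM {..<node m n k} (\<lambda>_. borel)) (\<lambda>x. restrict (level m n x) {..<node m n k})
    (PiM J (\<lambda>_. borel)) (\<lambda>x. restrict (level m n x) J)"
    by (rule noise.indep_var_restrict[OF indep_level]) (use J in auto)
  show "past m n k = vimage_algebra (space noise) (\<lambda>x. restrict (level m n x) {..<node m n k}) (PiM {..<node m n k} (\<lambda>_. borel))"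
    by (simp add: past_def)
qed

lemma past_subset: "sets (past m n k) \<subseteq> sets noise"
proof -
  have "(\<lambda>x. restrict (level m n x) {..<node m n k}) \<in> noise \<rightarrow>\<^sub>M PiM {..<node m n k} (\<lambda>_. borel)"
    by (rule measurable_restrict) (rule measurable_level_component)
  then have "sets (vimage_algebra UNIV (\<lambda>x. restrict (level m n x) {..<node m n k}) (PiM {..<node m n k} (\<lambda>_. borel))) \<subseteq> sets noise"
    by (intro sets_image_in_sets) simp_all
  then show ?thesis by (simp add: past_def)
qed

lemma past_measurable_noise: "f \<in> past m n k \<rightarrow>\<^sub>M S \<Longrightarrow> f \<in> noise \<rightarrow>\<^sub>M S"
  by (rule subsetD[OF measurable_mono[OF order_refl refl past_subset]]) simp_all

section \<open>The standard normal distribution function\<close>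

definition Phi :: "real \<Rightarrow> real" where "Phi = cdf gauss"

lemma gauss_singleton: "measure gauss {x} = 0"
proof -
  have "emeasure gauss {x} = (\<integral>\<^sup>+y. ennreal (std_normal_density y) * indicator {x} y \<partial>lborel)"
    unfolding gauss_def by (rule emeasure_density) auto
  also have "\<dots> = 0"
  proof -
    have "AE y in lborel. y \<noteq> x" by (rule AE_lborel_singleton)
    then have "AE y in lborel. ennreal (std_normal_density y) * indicator {x} y = 0" by eventually_elim simp
    then show ?thesis by (rule nn_integral_zero')
  qed
  finally show ?thesis by (simp add: measure_def)
qed

lemma isCont_Phi: "isCont Phi x"
  unfolding Phi_def by (simp add: gauss.isCont_cdf gauss_singleton)

lemma continuous_on_Phi: "continuous_on A Phi"
  by (simp add: isCont_Phi continuous_at_imp_continuous_on)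

lemma Phi_measurable: "Phi \<in> borel_measurable borel"
  by (rule borel_measurable_continuous_onI) (rule continuous_on_Phi)

lemma Phi_top: "(Phi \<longlongrightarrow> 1) at_top" unfolding Phi_def by (rule gauss.cdf_lim_at_top_prob)
lemma Phi_bot: "(Phi \<longlongrightarrow> 0) at_bot" unfolding Phi_def by (rule gauss.cdf_lim_at_bot)

lemma gauss_pos:
  assumes "a < b" shows "0 < measure gauss {a<..b}"
proof (rule ccontr)
  assume "\<not> ?thesis"
  then have "measure gauss {a<..b} = 0" by (simp add: zero_less_measure_iff)
  then have "emeasure gauss {a<..b} = 0" by (simp add: gauss.emeasure_eq_measure)
  then have "(\<integral>\<^sup>+y. ennreal (std_normal_density y) * indicator {a<..b} y \<partial>lborel) = 0"
    unfolding gauss_def by (subst (asm) emeasure_density) auto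
  then have "AE y in lborel. ennreal (std_normal_density y) * indicator {a<..b} y = 0"
    by (subst (asm) nn_integral_0_iff_AE) auto
  then have "AE y in lborel. y \<notin> {a<..b}"
  proof eventually_elim
    case (elim y)
    have "0 < std_normal_density y" by (rule normal_density_pos) simp
    then show ?case using elim by (auto simp: indicator_def split: if_splits)
  qed
  then have "{a<..b} \<in> null_sets lborel" using AE_iff_null_sets[of "{a<..b}" lborel] by (simp del: greaterThanAtMost_iff)
  then have "emeasure lborel {a<..b} = 0" by (rule null_setsD1)
  then show False using assms by simp
qed

lemma Phi_strict: "x < y \<Longrightarrow> Phi x < Phi y"
  using gauss.cdf_diff_eq[of x y] gauss_pos[of x y] by (simp add: Phi_def)

lemma Phi_pos: "0 < Phi x" and Phi_less_1: "Phi x < 1"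
  using Phi_strict[of "x - 1" x] Phi_strict[of x "x + 1"] gauss.cdf_nonneg[of "x - 1"] gauss.cdf_bounded_prob[of "x + 1"]
  by (simp_all add: Phi_def)

lemma Phi_onto:
  assumes "0 < p" "p < 1" obtains a where "Phi a = p"
proof -
  obtain x where x: "Phi x < p" using order_tendstoD(2)[OF Phi_bot assms(1)] eventually_happens'[OF trivial_limit_at_bot_linorder] by blast
  obtain y where y: "p < Phi y" using order_tendstoD(1)[OF Phi_top assms(2)] eventually_happens'[OF trivial_limit_at_top_linorder] by blast
  have "x \<le> y"
  proof (rule ccontr)
    assume "\<not> x \<le> y" then have "Phi y < Phi x" by (intro Phi_strict) simp
    with x y show False by simp
  qed
  then have "\<exists>a\<ge>x. a \<le> y \<and> Phi a = p"
    using x y by (intro IVT) (auto intro: isCont_Phi)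
  then show ?thesis using that by blast
qed

section \<open>Conditional probability of a threshold event\<close>

lemma distr_sum_level:
  assumes k: "k < 2 ^ n"
  shows "measure (distr noise borel (\<lambda>x. \<Sum>i\<in>{k..<2 ^ n}. level m n x (node m n i))) {..r} = Phi (r / sqrt (2 ^ n - real k))"
proof -
  let ?I = "node m n ` {k..<2 ^ n}" and ?\<sigma> = "sqrt (2 ^ n - real k)"
  have "real k < 2 ^ n" using k by (metis of_nat_less_iff of_nat_numeral of_nat_power)
  then have s: "0 < ?\<sigma>" by simp
  have inj: "inj_on (node m n) {k..<2 ^ n}" by (auto simp: inj_on_def node_inj)
  have dl: "distributed noise lborel (\<lambda>x. level m n x t) std_normal_density" for t
    unfolding distributed_def
  proof (intro conjI)
    have "distr noise lborel (\<lambda>x. level m n x t) = distr noise borel (\<lambda>x. level m n x t)" by (rule distr_cong) simp_all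
    then show "distr noise lborel (\<lambda>x. level m n x t) = density lborel (\<lambda>x. ennreal (std_normal_density x))"
      by (simp add: distr_level_component gauss_def)
  qed (simp_all add: measurable_level_component)
  have "distributed noise lborel (\<lambda>x. \<Sum>t\<in>?I. level m n x t) (normal_density (\<Sum>t\<in>?I. 0) (sqrt (\<Sum>t\<in>?I. 1\<^sup>2)))"
    by (rule noise.sum_indep_normal) (use k in \<open>auto intro: noise.indep_vars_subset[OF indep_level] dl\<close>)
  moreover have "(\<Sum>t\<in>?I. 1\<^sup>2) = (2 ^ n - real k)"
    using k by (simp add: card_image[OF inj])
  moreover have "(\<lambda>x. \<Sum>t\<in>?I. level m n x t) = (\<lambda>x. \<Sum>i\<in>{k..<2 ^ n}. level m n x (node m n i))"
    by (simp add: sum.reindex[OF inj])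
  ultimately have "distributed noise lborel (\<lambda>x. \<Sum>i\<in>{k..<2 ^ n}. level m n x (node m n i)) (normal_density 0 ?\<sigma>)"
    by simp
  then have d: "distributed noise lborel (\<lambda>x. ((\<Sum>i\<in>{k..<2 ^ n}. level m n x (node m n i)) - 0) / ?\<sigma>) std_normal_density"
    by (subst noise.normal_standard_normal_convert[OF s, symmetric])
  let ?S = "\<lambda>x. \<Sum>i\<in>{k..<2 ^ n}. level m n x (node m n i)"
  have mS: "?S \<in> borel_measurable noise" by (intro borel_measurable_sum measurable_level_component)
  have mS': "(\<lambda>x. ?S x / ?\<sigma>) \<in> borel_measurable noise" by (intro borel_measurable_divide borel_measurable_const mS)
  have "distr noise borel (\<lambda>x. ?S x / ?\<sigma>) = distr noise lborel (\<lambda>x. ?S x / ?\<sigma>)" by (rule distr_cong) simp_all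
  also have "\<dots> = gauss" using d by (simp add: distributed_def gauss_def)
  finally have g: "distr noise borel (\<lambda>x. ?S x / ?\<sigma>) = gauss" .
  have "measure (distr noise borel ?S) {..r} = measure noise {x. ?S x \<le> r}"
    by (subst measure_distr[OF mS]) (simp_all add: vimage_def)
  also have "{x. ?S x \<le> r} = {x. ?S x / ?\<sigma> \<le> r / ?\<sigma>}" using s by (simp add: divide_le_cancel)
  also have "measure noise \<dots> = measure (distr noise borel (\<lambda>x. ?S x / ?\<sigma>)) {..r / ?\<sigma>}"
    by (subst measure_distr[OF mS']) (simp_all add: vimage_def)
  also have "\<dots> = Phi (r / ?\<sigma>)" unfolding g Phi_def cdf_def ..
  finally show ?thesis .
qed

text \<open>The conditional probability of \<open>brown m x 1 \<le> a\<close> given the path up to time \<open>t\<close>.\<close>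

definition gate :: "nat \<Rightarrow> real \<Rightarrow> path \<Rightarrow> real \<Rightarrow> real" where
  "gate m a x t = (if t < 1 then Phi ((a - brown m x t) / sqrt (1 - t)) else of_bool (x (node m 0 0) \<le> a))"

lemma gate_bounds: "0 \<le> gate m a x t" "gate m a x t \<le> 1"
  by (auto simp: gate_def less_imp_le[OF Phi_pos] less_imp_le[OF Phi_less_1])

lemma gate_strict: "t < 1 \<Longrightarrow> 0 < gate m a x t \<and> gate m a x t < 1"
  by (simp add: gate_def Phi_pos Phi_less_1)

lemma gate_0: "gate m a x 0 = Phi a" by (simp add: gate_def brown_0)
lemma gate_1: "gate m a x 1 = of_bool (x (node m 0 0) \<le> a)" by (simp add: gate_def)

lemma past_gate:
  assumes u: "0 \<le> u" "u < 1" "u \<le> real k / 2 ^ n" and k: "k \<le> 2 ^ n"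
  shows "(\<lambda>x. gate m a x u) \<in> borel_measurable (past m n k)"
proof -
  have "(\<lambda>x. gate m a x u) = (\<lambda>x. Phi ((a - brown m x u) / sqrt (1 - u)))" using u by (simp add: gate_def)
  moreover have "(\<lambda>x. Phi ((a - brown m x u) / sqrt (1 - u))) \<in> borel_measurable (past m n k)"
    by (rule measurable_compose[OF _ Phi_measurable])
       (intro borel_measurable_divide borel_measurable_diff borel_measurable_const past_brown u k)
  ultimately show ?thesis by simp
qed

text \<open>The martingale property of \<open>gate\<close> between a dyadic time and time 1, tested
  against a bounded variable \<open>h\<close> of the past. Freezing the past leaves only the
  remaining increment random, and the indicator turns into a value of \<open>Phi\<close>.\<close>

lemma integral_gate:
  assumes h: "h \<in> borel_measurable (past m n k)" and B: "\<And>x. \<bar>h x\<bar> \<le> B" and k: "k < 2 ^ n"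
  shows "(\<integral>x. h x * gate m a x 1 \<partial>noise) = (\<integral>x. h x * gate m a x (real k / 2 ^ n) \<partial>noise)"
proof -
  let ?S = "\<lambda>x. \<Sum>i\<in>{k..<2 ^ n}. level m n x (node m n i)" and ?c = "(1 / sqrt 2) ^ n :: real"
    and ?d = "real k / 2 ^ n"
  let ?J = "node m n ` {k..<2 ^ n}"
  let ?f = "\<lambda>(x, y). h x * of_bool (brown m x ?d + ?c * y \<le> a)"
  have kle: "k \<le> 2 ^ n" and inj: "inj_on (node m n) {k..<2 ^ n}" using k by (auto simp: inj_on_def node_inj)
  have "real k < 2 ^ n" using k by (metis of_nat_less_iff of_nat_numeral of_nat_power)
  then have d1: "?d < 1" and kr: "0 < 2 ^ n - real k" by simp_all
  have mS: "?S \<in> borel_measurable noise" by (intro borel_measurable_sum measurable_level_component)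
  have fS: "(\<lambda>y. \<Sum>t\<in>?J. y t) \<in> PiM ?J (\<lambda>_. borel) \<rightarrow>\<^sub>M (borel :: real measure)"
    by (intro borel_measurable_sum measurable_component_singleton)
  have "?J \<inter> {..<node m n k} = {}" by (auto simp: node_less_iff divide_less_cancel)
  note fr = integral_past_freeze[OF this fS]
  have SJ: "(\<Sum>t\<in>?J. restrict (level m n x) ?J t) = ?S x" for x
    by (simp add: sum.reindex[OF inj])
  have bm: "(\<lambda>x. brown m x ?d) \<in> borel_measurable (past m n k)" by (rule past_brown) (simp_all add: kle)
  have [measurable]: "(\<lambda>p. h (fst p)) \<in> borel_measurable (past m n k \<Otimes>\<^sub>M borel)"
     "(\<lambda>p. brown m (fst p) ?d) \<in> borel_measurable (past m n k \<Otimes>\<^sub>M borel)"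
    by (rule measurable_compose[OF measurable_fst h], rule measurable_compose[OF measurable_fst bm])
  have fm: "?f \<in> borel_measurable (past m n k \<Otimes>\<^sub>M borel)"
    unfolding case_prod_beta' by measurable
  have hn: "h \<in> borel_measurable noise" by (rule past_measurable_noise[OF h])
  have bn: "(\<lambda>x. brown m x ?d) \<in> borel_measurable noise" by (rule past_measurable_noise[OF bm])
  note mS [measurable] hn [measurable] bn [measurable]
  have int: "integrable noise (\<lambda>x. ?f (x, ?S x))"
  proof (rule noise.integrable_const_bound[of _ B])
    have "\<bar>h x * of_bool Q\<bar> \<le> B" for x Q using B[of x] by (cases Q) auto
    then show "AE x in noise. norm (?f (x, ?S x)) \<le> B" by simp
    show "(\<lambda>x. ?f (x, ?S x)) \<in> borel_measurable noise"
      using hn bn mS by simp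
  qed
  have eq1: "h x * gate m a x 1 = ?f (x, ?S x)" for x
    unfolding gate_1 using brown_increment[OF kle, of x m] by simp
  have eq2: "(\<integral>y. ?f (x, y) \<partial>distr noise borel ?S) = h x * gate m a x ?d" for x
  proof -
    let ?z = "(a - brown m x ?d) / ?c"
    have c: "0 < ?c" by simp
    interpret S: prob_space "distr noise borel ?S" by (rule noise.prob_space_distr[OF mS])
    have "brown m x ?d + ?c * y \<le> a \<longleftrightarrow> y \<in> {..?z}" for y
      using c by (simp add: field_simps)
    then have "(\<integral>y. ?f (x, y) \<partial>distr noise borel ?S) = (\<integral>y. h x * indicator {..?z} y \<partial>distr noise borel ?S)"
      by (intro Bochner_Integration.integral_cong) (simp_all add: indicator_def)
    also have "\<dots> = h x * measure (distr noise borel ?S) {..?z}" by simp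
    also have "measure (distr noise borel ?S) {..?z} = Phi (?z / sqrt (2 ^ n - real k))" by (rule distr_sum_level[OF k])
    \<comment> \<open>The remaining increment is a sum of \<open>2 ^ n - k\<close> independent
      standard normals scaled by \<open>?c\<close>, so its variance is the remaining time
      \<open>1 - ?d\<close>.\<close>
    also have "?z / sqrt (2 ^ n - real k) = (a - brown m x ?d) / sqrt (1 - ?d)"
    proof -
      have "?c * sqrt (2 ^ n - real k) = sqrt ((1 / 2) ^ n * (2 ^ n - real k))"
        by (simp add: real_sqrt_mult real_sqrt_power real_sqrt_divide)
      also have "(1 / 2) ^ n * (2 ^ n - real k) = 1 - ?d" by (simp add: field_simps)
      finally show ?thesis by (simp only: divide_divide_eq_left)
    qed
    finally show ?thesis using d1 by (simp add: gate_def)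
  qed
  show ?thesis
    using fr[of ?f] fm int unfolding SJ eq1 eq2 by blast
qed

section \<open>Continuity of Brownian paths and of the gate\<close>

lemma sum_tent_le: "(\<Sum>k<K. tent (z - real k)) \<le> 1"
proof -
  \<comment> \<open>The supports of the hats of one layer do not overlap; only the hat with index
    \<open>\<lfloor>z\<rfloor>\<close> can be nonzero at \<open>z\<close>.\<close>
  have "tent (z - real k) \<le> (if k = nat \<lfloor>z\<rfloor> then 1 else 0)" for k
  proof (cases "tent (z - real k) = 0")
    case False
    then have "0 < z - real k" "z - real k < 1" by (auto simp: tent_def max_def abs_if split: if_splits)
    then have "\<lfloor>z\<rfloor> = int k" by (intro floor_unique) simp_all
    then show ?thesis by (simp add: tent_def)
  qed simp
  then have "(\<Sum>k<K. tent (z - real k)) \<le> (\<Sum>k<K. if k = nat \<lfloor>z\<rfloor> then 1 else 0)" by (intro sum_mono)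
  also have "\<dots> \<le> 1" by simp
  finally show ?thesis .
qed

lemma tent_nonneg: "0 \<le> tent z" by (simp add: tent_def)

lemma continuous_on_tent: "continuous_on A f \<Longrightarrow> continuous_on A (\<lambda>t. tent (f t))"
  unfolding tent_def by (intro continuous_intros)

text \<open>The summands of the Schauder expansion are then of order \<open>(5 / (4 * sqrt 2)) ^ j\<close>.\<close>

definition tame :: "nat \<Rightarrow> path \<Rightarrow> bool" where
  "tame m x \<longleftrightarrow> (\<forall>\<^sub>F j in sequentially. \<forall>k<2 ^ j. \<bar>x (node m (Suc j) (2 * k + 1))\<bar> \<le> (5 / 4) ^ j)"

text \<open>Markov's inequality with the fourth moment. A layer has \<open>2 ^ j\<close>
  coefficients, and \<open>2 * (4 / 5) ^ 4 < 1\<close> makes the union bound summable, whereas the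
  second moment would give \<open>2 * (4 / 5) ^ 2 > 1\<close>.\<close>

lemma gauss_tail:
  assumes "0 < r"
  shows "measure gauss {y. r < \<bar>y\<bar>} \<le> (\<integral>y. y ^ 4 \<partial>gauss) / r ^ 4"
proof -
  have "integrable lborel (\<lambda>x. std_normal_density x * x ^ 4)" by (rule integrable_std_normal_moment)
  then have i: "integrable gauss (\<lambda>y. y ^ 4)" unfolding gauss_def by (subst integrable_density) simp_all
  have "measure gauss {y. r < \<bar>y\<bar>} \<le> measure gauss {y\<in>space gauss. r ^ 4 \<le> y ^ 4}"
  proof (rule gauss.finite_measure_mono)
    show "{y. r < \<bar>y\<bar>} \<subseteq> {y \<in> space gauss. r ^ 4 \<le> y ^ 4}"
    proof
      fix y assume "y \<in> {y. r < \<bar>y\<bar>}"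
      then have "r ^ 4 \<le> \<bar>y\<bar> ^ 4" using assms by (intro power_mono) auto
      then show "y \<in> {y \<in> space gauss. r ^ 4 \<le> y ^ 4}" by (simp add: power_even_abs)
    qed
    show "{y \<in> space gauss. r ^ 4 \<le> y ^ 4} \<in> sets gauss" by measurable
  qed
  also have "\<dots> \<le> (\<integral>y. y ^ 4 \<partial>gauss) / r ^ 4"
    by (rule integral_Markov_inequality_measure[OF i, of "space gauss"]) (use assms in simp_all)
  finally show ?thesis .
qed

lemma measure_noise_component:
  assumes "A \<in> sets borel" shows "measure noise {x. x t \<in> A} = measure gauss A"
proof -
  have "measure gauss A = measure (distr noise borel (\<lambda>x. x t)) A" by (simp add: distr_noise_component)
  also have "\<dots> = measure noise {x. x t \<in> A}"
    by (subst measure_distr[OF measurable_noise_component assms]) (simp add: vimage_def)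
  finally show ?thesis ..
qed

text \<open>Borel-Cantelli. The growth rate \<open>5 / 4\<close> is chosen above the fourth root of
  2, so that the exceptional events are summable, and below \<open>sqrt 2\<close>, so that the tame
  series converges uniformly.\<close>

lemma AE_tame: "AE x in noise. tame m x"
proof -
  define A where "A j = {x :: path. \<exists>k<2 ^ j. (5 / 4) ^ j < \<bar>x (node m (Suc j) (2 * k + 1))\<bar>}" for j :: nat
  define C where "C = (\<integral>y. y ^ 4 \<partial>gauss)"
  have s: "{x. x t \<in> {y. r < \<bar>y\<bar>}} \<in> sets noise" for t and r :: real
    using measurable_sets[OF measurable_noise_component, of "{y. r < \<bar>y\<bar>}" t] by (simp add: vimage_def)
  have Aeq: "A j = (\<Union>k<2 ^ j. {x. x (node m (Suc j) (2 * k + 1)) \<in> {y. (5 / 4) ^ j < \<bar>y\<bar>}})" for j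
    by (auto simp: A_def)
  have Am: "A j \<in> sets noise" for j unfolding Aeq using s by (intro sets.finite_UN) simp_all
  have bound: "measure noise (A j) \<le> C * (2 * (4 / 5) ^ 4) ^ j" for j
  proof -
    have "measure noise (A j) \<le> (\<Sum>k<2 ^ j. measure noise {x. x (node m (Suc j) (2 * k + 1)) \<in> {y. (5 / 4) ^ j < \<bar>y\<bar>}})"
      unfolding Aeq using s by (intro measure_UNION_le) simp_all
    also have "\<dots> \<le> (\<Sum>k<(2::nat) ^ j. C / ((5 / 4) ^ j) ^ 4)"
    proof (rule sum_mono)
      fix k :: nat
      have "measure noise {x. x (node m (Suc j) (2 * k + 1)) \<in> {y. (5 / 4) ^ j < \<bar>y\<bar>}} = measure gauss {y. (5 / 4) ^ j < \<bar>y\<bar>}"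
        by (rule measure_noise_component) simp
      also have "\<dots> \<le> C / ((5 / 4) ^ j) ^ 4" unfolding C_def by (rule gauss_tail) simp
      finally show "measure noise {x. x (node m (Suc j) (2 * k + 1)) \<in> {y. (5 / 4) ^ j < \<bar>y\<bar>}} \<le> C / ((5 / 4) ^ j) ^ 4" .
    qed
    also have "\<dots> = C * (2 ^ j * (1 / ((5 / 4) ^ j) ^ 4))" by simp
    also have "(2::real) ^ j * (1 / ((5 / 4) ^ j) ^ 4) = (2 * (4 / 5) ^ 4) ^ j"
    proof -
      have "((5 / 4 :: real) ^ j) ^ 4 = ((5 / 4) ^ 4) ^ j" by (simp only: mult.commute flip: power_mult)
      then have "(2::real) ^ j * (1 / ((5 / 4) ^ j) ^ 4) = 2 ^ j * (1 / (5 / 4) ^ 4) ^ j" by (simp only: power_one_over)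
      also have "\<dots> = (2 * (1 / (5 / 4) ^ 4)) ^ j" by (rule power_mult_distrib[symmetric])
      also have "2 * (1 / (5 / 4 :: real) ^ 4) = 2 * (4 / 5) ^ 4" by (simp add: power_divide)
      finally show ?thesis .
    qed
    finally show ?thesis .
  qed
  have "summable (\<lambda>j. C * (2 * (4 / 5 :: real) ^ 4) ^ j)"
    by (intro summable_mult summable_geometric) (simp add: power4_eq_xxxx)
  then have "summable (\<lambda>j. measure noise (A j))"
    by (rule summable_comparison_test'[of _ 0]) (use bound in simp)
  then have "AE x in noise. eventually (\<lambda>n. x \<in> space noise - A n) sequentially"
    by (intro borel_cantelli_AE1 Am) (simp_all add: noise.emeasure_eq_measure)
  then show ?thesis
  proof eventually_elim
    case (elim x)
    then show ?case unfolding tame_def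
    proof eventually_elim
      case (elim j)
      then have "\<not> (\<exists>k<2 ^ j. (5 / 4) ^ j < \<bar>x (node m (Suc j) (2 * k + 1))\<bar>)" unfolding A_def by simp
      then show ?case by (meson not_less)
    qed
  qed
qed

lemma brown_continuous:
  assumes "tame m x"
  shows "continuous_on {0..1} (brown m x)"
proof -
  let ?q = "1 / sqrt 2 * (5 / 4) :: real"
  have "\<forall>\<^sub>F j in sequentially. \<forall>t\<in>{0..1}. norm (schauder m x j t) \<le> ?q ^ j"
    using assms unfolding tame_def
  proof eventually_elim
    case (elim j)
    show ?case
    proof
      fix t :: real
      have "\<bar>schauder m x j t\<bar> \<le> (\<Sum>k<2 ^ j. \<bar>1 / 2 * (1 / sqrt 2) ^ j * x (node m (Suc j) (2 * k + 1)) * tent (2 ^ j * t - real k)\<bar>)"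
        unfolding schauder_def by (rule sum_abs)
      also have "\<dots> \<le> (\<Sum>k<2 ^ j. ?q ^ j * tent (2 ^ j * t - real k))"
      proof (rule sum_mono)
        fix k :: nat assume "k \<in> {..<2 ^ j}"
        then have "\<bar>x (node m (Suc j) (2 * k + 1))\<bar> \<le> (5 / 4) ^ j" using elim by blast
        moreover have "(1 / 2 :: real) * (1 / sqrt 2) ^ j \<le> (1 / sqrt 2) ^ j" by simp
        ultimately have "1 / 2 * (1 / sqrt 2) ^ j * \<bar>x (node m (Suc j) (2 * k + 1))\<bar> \<le> (1 / sqrt 2) ^ j * (5 / 4) ^ j"
          by (intro mult_mono) simp_all
        also have "\<dots> = ?q ^ j" by (rule power_mult_distrib[symmetric])
        finally have "1 / 2 * (1 / sqrt 2) ^ j * \<bar>x (node m (Suc j) (2 * k + 1))\<bar> * tent (2 ^ j * t - real k) \<le> ?q ^ j * tent (2 ^ j * t - real k)"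
          using tent_nonneg by (rule mult_right_mono)
        then show "\<bar>1 / 2 * (1 / sqrt 2) ^ j * x (node m (Suc j) (2 * k + 1)) * tent (2 ^ j * t - real k)\<bar> \<le> ?q ^ j * tent (2 ^ j * t - real k)"
          using tent_nonneg[of "2 ^ j * t - real k"] by (simp add: abs_mult)
      qed
      also have "\<dots> = ?q ^ j * (\<Sum>k<2 ^ j. tent (2 ^ j * t - real k))" by (simp add: sum_distrib_left)
      also have "\<dots> \<le> ?q ^ j * 1" by (intro mult_left_mono sum_tent_le) simp
      finally show "norm (schauder m x j t) \<le> ?q ^ j" by simp
    qed
  qed
  moreover have "summable (\<lambda>j. ?q ^ j)"
  proof (rule summable_geometric)
    have "?q\<^sup>2 < 1\<^sup>2" by (simp add: power_mult_distrib power_divide)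
    then have "?q < 1" by (rule power2_less_imp_less) simp
    then show "norm ?q < 1" by simp
  qed
  ultimately have ul: "uniform_limit {0..1} (\<lambda>n t. \<Sum>j<n. schauder m x j t) (\<lambda>t. \<Sum>j. schauder m x j t) sequentially"
    by (rule Weierstrass_m_test_ev)
  have "continuous_on {0..1} (\<lambda>t. \<Sum>j. schauder m x j t)"
  proof (rule uniform_limit_theorem[OF _ ul])
    have "continuous_on {0..1} (\<lambda>t. \<Sum>j<n. schauder m x j t)" for n
      unfolding schauder_def by (intro continuous_on_sum continuous_on_mult continuous_on_const continuous_on_tent continuous_on_diff continuous_on_id)
    then show "\<forall>\<^sub>F n in sequentially. continuous_on {0..1} (\<lambda>t. \<Sum>j<n. schauder m x j t)" by simp
  qed simp
  then have c: "continuous_on {0..1} (\<lambda>t. x (node m 0 0) * t + (\<Sum>j. schauder m x j t))"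
    by (intro continuous_on_add continuous_on_mult continuous_on_const continuous_on_id)
  have "brown m x t = x (node m 0 0) * t + (\<Sum>j. schauder m x j t)" if "t \<in> {0..1}" for t
    unfolding brown_def brown_partial_def
    by (rule limI) (intro tendsto_add tendsto_const tendsto_uniform_limitI[OF ul that])
  then have "continuous_on {0..1} (brown m x) = continuous_on {0..1} (\<lambda>t. x (node m 0 0) * t + (\<Sum>j. schauder m x j t))"
    by (rule continuous_on_cong[OF refl])
  then show ?thesis using c by simp
qed

text \<open>The critical time is 1, where the denominator vanishes. The numerator tends to
  \<open>a - x (node m 0 0)\<close>, which is nonzero by assumption, so the argument of
  \<open>Phi\<close> diverges with the right sign and \<open>Phi\<close> tends to the
  indicator.\<close>

lemma gate_continuous:
  assumes tame: "tame m x" and ne: "x (node m 0 0) \<noteq> a"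
  shows "continuous_on {0..1} (gate m a x)"
proof -
  have bc: "continuous_on {0..1} (brown m x)" by (rule brown_continuous[OF tame])
  let ?F = "\<lambda>t. Phi ((a - brown m x t) / sqrt (1 - t))"
  have cF: "continuous_on {0..<1} ?F"
    by (rule continuous_on_compose2[OF continuous_on_Phi[of UNIV]])
       (auto intro!: continuous_intros continuous_on_subset[OF bc])
  show ?thesis unfolding continuous_on_def
  proof
    fix t :: real assume t: "t \<in> {0..1}"
    show "(gate m a x \<longlongrightarrow> gate m a x t) (at t within {0..1})"
    proof (cases "t < 1")
      case True
      have "(?F \<longlongrightarrow> ?F t) (at t within {0..<1})" using cF t True unfolding continuous_on_def by simp
      moreover have "at t within {0..<1} = at t within {0..1}"
        by (rule at_within_nhd[of t "{..<1}"]) (use True in auto)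
      ultimately have "(?F \<longlongrightarrow> ?F t) (at t within {0..1})" by simp
      moreover have "\<forall>\<^sub>F s in at t within {0..1}. gate m a x s = ?F s"
        using order_tendstoD(2)[OF tendsto_ident_at True] by eventually_elim (simp add: gate_def)
      ultimately show ?thesis using True by (simp add: gate_def tendsto_cong)
    next
      case False
      then have t1: "t = 1" using t by simp
      let ?W = "at (1::real) within {0..1}"
      have ev: "\<forall>\<^sub>F s in ?W. s < 1" unfolding eventually_at_filter by (rule always_eventually) auto
      have "((\<lambda>s. sqrt (1 - s)) \<longlongrightarrow> sqrt (1 - 1)) ?W" by (intro tendsto_intros)
      then have s0: "((\<lambda>s. sqrt (1 - s)) \<longlongrightarrow> 0) ?W" by simp
      have top: "filterlim (\<lambda>s. inverse (sqrt (1 - s))) at_top ?W"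
        by (rule filterlim_inverse_at_top[OF s0]) (use ev in eventually_elim, simp)
      have "(brown m x \<longlongrightarrow> brown m x 1) ?W" using bc unfolding continuous_on_def by simp
      then have lb: "((\<lambda>s. a - brown m x s) \<longlongrightarrow> a - x (node m 0 0)) ?W" by (intro tendsto_diff tendsto_const) (simp add: brown_1)
      have eqF: "\<forall>\<^sub>F s in ?W. gate m a x s = Phi ((a - brown m x s) * inverse (sqrt (1 - s)))"
        using ev by eventually_elim (simp add: gate_def divide_inverse)
      have "((\<lambda>s. Phi ((a - brown m x s) * inverse (sqrt (1 - s)))) \<longlongrightarrow> gate m a x 1) ?W"
      proof (cases "x (node m 0 0) < a")
        case True
        then have "filterlim (\<lambda>s. (a - brown m x s) * inverse (sqrt (1 - s))) at_top ?W"
          by (intro filterlim_tendsto_pos_mult_at_top[OF lb _ top]) simp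
        from filterlim_compose[OF Phi_top this] show ?thesis using True by (simp add: gate_1)
      next
        case False
        then have "filterlim (\<lambda>s. (a - brown m x s) * inverse (sqrt (1 - s))) at_bot ?W"
          using ne by (intro filterlim_tendsto_neg_mult_at_bot[OF lb _ top]) simp
        from filterlim_compose[OF Phi_bot this] show ?thesis using False ne by (simp add: gate_1)
      qed
      then show ?thesis unfolding t1 using eqF by (simp add: tendsto_cong)
    qed
  qed
qed

lemma AE_node_neq: "AE x in noise. x (node m 0 0) \<noteq> a"
proof -
  have "measure noise {x. x (node m 0 0) \<in> {a}} = 0"
    unfolding measure_noise_component[OF borel_singleton[OF sets.empty_sets]] by (rule gauss_singleton)
  moreover have "{x. x (node m 0 0) \<in> {a}} \<in> sets noise"
    using measurable_sets[OF measurable_noise_component, of "{a}" "node m 0 0"] by (simp add: vimage_def)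
  ultimately have "{x. x (node m 0 0) \<in> {a}} \<in> null_sets noise" by (simp add: null_sets_def noise.emeasure_eq_measure)
  from AE_not_in[OF this] show ?thesis by simp
qed

section \<open>Binary expansion of a uniform variable\<close>

definition unif :: "real measure" where
  "unif = density lborel (\<lambda>u. ennreal (indicator {0<..<1} u))"

lemma sets_unif[measurable_cong, simp]: "sets unif = sets borel" by (simp add: unif_def)
lemma space_unif[simp]: "space unif = UNIV" by (simp add: unif_def)

lemma integral_unif:
  fixes f :: "real \<Rightarrow> real"
  assumes "f \<in> borel_measurable borel"
  shows "(\<integral>u. f u \<partial>unif) = (LINT u:{0<..<1}|lborel. f u)"
  unfolding unif_def set_lebesgue_integral_def by (rule integral_density) (use assms in simp_all)

lemma integrable_unif:
  fixes f :: "real \<Rightarrow> real"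
  assumes "f \<in> borel_measurable borel"
  shows "integrable unif f \<longleftrightarrow> set_integrable lborel {0<..<1} f"
  unfolding unif_def set_integrable_def by (rule integrable_density) (use assms in simp_all)

interpretation unif: prob_space unif
proof
  have "emeasure unif UNIV = (\<integral>\<^sup>+u. ennreal (indicator {0<..<1} u) * indicator (UNIV :: real set) u \<partial>lborel)"
    unfolding unif_def by (rule emeasure_density) simp_all
  also have "\<dots> = (\<integral>\<^sup>+u. indicator {0<..<1::real} u \<partial>lborel)"
    by (rule nn_integral_cong) (simp add: indicator_def)
  also have "\<dots> = emeasure lborel {0<..<1::real}" by (rule nn_integral_indicator) simp
  finally show "emeasure unif (space unif) = 1" by simp
qed

interpretation unif: real_distribution unif by standard simp_all

text \<open>The mean of \<open>f\<close> over the interval from \<open>l\<close> to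
  \<open>l + w\<close>. Written as an integral against a fixed measure, it is visibly measurable in
  \<open>l\<close> and \<open>w\<close>, and it is the form in which it appears when a uniform
  variable is integrated out.\<close>

definition avg :: "(real \<Rightarrow> real) \<Rightarrow> real \<Rightarrow> real \<Rightarrow> real" where
  "avg f l w = (\<integral>u. f (l + w * u) \<partial>unif)"

lemma affine_indicator:
  fixes l w u :: real
  assumes "0 < w"
  shows "indicator {l<..<l + w} (l + w * u) = (indicator {0<..<1} u :: real)"
proof -
  have "l < l + w * u \<longleftrightarrow> 0 < u" using assms by (simp add: zero_less_mult_iff)
  moreover have "l + w * u < l + w \<longleftrightarrow> u < 1" using assms by simp
  ultimately show ?thesis by (simp add: indicator_def)
qed

lemma avg_eq:
  fixes f :: "real \<Rightarrow> real"
  assumes f: "f \<in> borel_measurable borel" and w: "0 < w"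
  shows "avg f l w = (LINT u:{l<..<l + w}|lborel. f u) / w"
proof -
  have [measurable]: "f \<in> borel_measurable borel" by (rule f)
  have "(LINT u:{l<..<l + w}|lborel. f u) = \<bar>w\<bar> *\<^sub>R (\<integral>u. indicator {l<..<l + w} (l + w * u) *\<^sub>R f (l + w * u) \<partial>lborel)"
    unfolding set_lebesgue_integral_def by (rule lborel_integral_real_affine) (use w in simp)
  also have "\<dots> = w * (LINT u:{0<..<1}|lborel. f (l + w * u))"
    unfolding affine_indicator[OF w] set_lebesgue_integral_def using w by simp
  also have "(LINT u:{0<..<1}|lborel. f (l + w * u)) = avg f l w"
    unfolding avg_def by (rule integral_unif[symmetric]) measurable
  finally show ?thesis using w by simp
qed

lemma integrable_affine:
  fixes f :: "real \<Rightarrow> real"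
  assumes f: "f \<in> borel_measurable borel" and w: "0 < w"
  shows "integrable unif (\<lambda>u. f (l + w * u)) \<longleftrightarrow> set_integrable lborel {l<..<l + w} f"
proof -
  have [measurable]: "f \<in> borel_measurable borel" by (rule f)
  have "integrable unif (\<lambda>u. f (l + w * u)) \<longleftrightarrow> integrable lborel (\<lambda>u. indicator {l<..<l + w} (l + w * u) *\<^sub>R f (l + w * u))"
    unfolding affine_indicator[OF w] set_integrable_def[symmetric] by (rule integrable_unif) measurable
  also have "\<dots> \<longleftrightarrow> set_integrable lborel {l<..<l + w} f"
    unfolding set_integrable_def using lborel_integrable_real_affine_iff[of w "\<lambda>u. indicator {l<..<l + w} u *\<^sub>R f u" l] w by simp
  finally show ?thesis .
qed

lemma set_integral_split:
  fixes f :: "real \<Rightarrow> real"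
  assumes "a < b" "b < c" and i: "set_integrable lborel {a<..<c} f"
  shows "(LINT u:{a<..<c}|lborel. f u) = (LINT u:{a<..<b}|lborel. f u) + (LINT u:{b<..<c}|lborel. f u)"
proof -
  have i1: "set_integrable lborel {a<..<b} f" "set_integrable lborel {b<..<c} f"
    using assms by (auto intro: set_integrable_subset[OF i])
  have "(LINT u:{a<..<c}|lborel. f u) = (LINT u:{a<..<b} \<union> {b<..<c}|lborel. f u)"
    unfolding set_lebesgue_integral_def
  proof (rule integral_cong_AE)
    show "AE u in lborel. indicator {a<..<c} u *\<^sub>R f u = indicator ({a<..<b} \<union> {b<..<c}) u *\<^sub>R f u"
      using AE_lborel_singleton[of b] by eventually_elim (use assms in \<open>auto simp: indicator_def\<close>)
    show "(\<lambda>u. indicator {a<..<c} u *\<^sub>R f u) \<in> borel_measurable lborel"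
      using i unfolding set_integrable_def by (rule borel_measurable_integrable)
    have "set_integrable lborel ({a<..<b} \<union> {b<..<c}) f" using assms by (auto intro: set_integrable_subset[OF i])
    then show "(\<lambda>u. indicator ({a<..<b} \<union> {b<..<c}) u *\<^sub>R f u) \<in> borel_measurable lborel"
      unfolding set_integrable_def by (rule borel_measurable_integrable)
  qed
  also have "\<dots> = (LINT u:{a<..<b}|lborel. f u) + (LINT u:{b<..<c}|lborel. f u)"
    by (rule set_integral_Un) (use i1 in auto)
  finally show ?thesis .
qed

lemma avg_split:
  fixes f :: "real \<Rightarrow> real"
  assumes f: "f \<in> borel_measurable borel" and w: "0 < w" and q: "0 < q" "q < 1" and i: "set_integrable lborel {l<..<l + w} f"
  shows "avg f l w = (1 - q) * avg f l ((1 - q) * w) + q * avg f (l + (1 - q) * w) (q * w)"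
proof -
  have e: "l + (1 - q) * w + q * w = l + w" by (simp add: algebra_simps)
  have lt: "l < l + (1 - q) * w" "l + (1 - q) * w < l + w" using w q by simp_all
  have "avg f l w = ((LINT u:{l<..<l + (1 - q) * w}|lborel. f u) + (LINT u:{l + (1 - q) * w<..<l + w}|lborel. f u)) / w"
    unfolding avg_eq[OF f w] set_integral_split[OF lt i] ..
  moreover have "(1 - q) * avg f l ((1 - q) * w) = (LINT u:{l<..<l + (1 - q) * w}|lborel. f u) / w"
    using q w by (subst avg_eq[OF f]) simp_all
  moreover have "q * avg f (l + (1 - q) * w) (q * w) = (LINT u:{l + (1 - q) * w<..<l + w}|lborel. f u) / w"
    using q w by (subst avg_eq[OF f]) (simp_all add: e)
  ultimately show ?thesis by (simp add: add_divide_distrib)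
qed

lemma AE_unif: "AE u in unif. 0 < u \<and> u < 1"
  unfolding unif_def by (subst AE_density) (auto simp: indicator_def)

lemma avg_greater:
  fixes f :: "real \<Rightarrow> real"
  assumes f: "f \<in> borel_measurable borel" and w: "0 < w" and i: "set_integrable lborel {l<..<l + w} f"
    and gt: "\<And>u. l < u \<Longrightarrow> u < l + w \<Longrightarrow> c < f u"
  shows "c < avg f l w"
proof -
  have ae: "AE u in unif. c < f (l + w * u)"
    using AE_unif by eventually_elim (use w in \<open>auto intro!: gt\<close>)
  have "(\<integral>u. c \<partial>unif) < (\<integral>u. f (l + w * u) \<partial>unif)"
    by (rule unif.integral_less_AE_space) (use ae integrable_affine[OF f w, of l] i unif.emeasure_space_1 in auto)
  then show ?thesis by (simp add: avg_def unif.prob_space[simplified])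
qed

lemma avg_uminus: "avg (\<lambda>u. - f u) l w = - avg f l w"
  by (simp add: avg_def)

lemma avg_less:
  fixes f :: "real \<Rightarrow> real"
  assumes f: "f \<in> borel_measurable borel" and w: "0 < w" and i: "set_integrable lborel {l<..<l + w} f"
    and lt: "\<And>u. l < u \<Longrightarrow> u < l + w \<Longrightarrow> f u < c"
  shows "avg f l w < c"
  using avg_greater[of "\<lambda>u. - f u" w l "-c"] assms by (auto simp: avg_uminus set_integrable_def)

lemma avg_abs_le:
  fixes f :: "real \<Rightarrow> real"
  assumes f: "f \<in> borel_measurable borel" and w: "0 < w" and i: "set_integrable lborel {0<..<1} f" and l: "0 \<le> l" "l + w \<le> 1"
  shows "\<bar>avg f l w\<bar> \<le> (LINT u:{0<..<1}|lborel. \<bar>f u\<bar>) / w"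
proof -
  have sub: "{l<..<l + w} \<subseteq> {0<..<1}" using l by auto
  have ia: "set_integrable lborel {0<..<1} (\<lambda>u. \<bar>f u\<bar>)" using set_integrable_abs[OF i] .
  have "\<bar>LINT u:{l<..<l + w}|lborel. f u\<bar> \<le> (LINT u:{l<..<l + w}|lborel. \<bar>f u\<bar>)"
    using set_integral_norm_bound[OF set_integrable_subset[OF i _ sub]] by simp
  also have "\<dots> \<le> (LINT u:{0<..<1}|lborel. \<bar>f u\<bar>)"
    unfolding set_lebesgue_integral_def
  proof (rule integral_mono)
    show "integrable lborel (\<lambda>u. indicator {l<..<l + w} u *\<^sub>R \<bar>f u\<bar>)" "integrable lborel (\<lambda>u. indicator {0<..<1} u *\<^sub>R \<bar>f u\<bar>)"
      using set_integrable_subset[OF ia _ sub] ia unfolding set_integrable_def by simp_all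
    show "indicator {l<..<l + w} u *\<^sub>R \<bar>f u\<bar> \<le> indicator {0<..<1} u *\<^sub>R \<bar>f u\<bar>" for u
      using sub by (auto simp: indicator_def)
  qed
  finally show ?thesis unfolding avg_eq[OF f w] using w by (simp add: divide_right_mono)
qed

lemma cdf_unif: "cdf unif y = clamp y"
proof -
  have "emeasure unif {..y} = (\<integral>\<^sup>+u. ennreal (indicator {0<..<1} u) * indicator {..y} u \<partial>lborel)"
    unfolding unif_def by (rule emeasure_density) simp_all
  also have "\<dots> = (\<integral>\<^sup>+u. indicator ({0<..<1} \<inter> {..y}) u \<partial>lborel)"
    by (rule nn_integral_cong) (simp add: indicator_def)
  also have "\<dots> = emeasure lborel ({0<..<1} \<inter> {..y})" by (rule nn_integral_indicator) simp
  finally have "emeasure unif {..y} = emeasure lborel ({0<..<1} \<inter> {..y})" .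
  then have "measure unif {..y} = measure lborel ({0<..<1} \<inter> {..y})" by (simp add: measure_def)
  also have "\<dots> = clamp y"
  proof -
    consider "y \<le> 0" | "0 < y" "y < 1" | "1 \<le> y" by linarith
    then show ?thesis
    proof cases
      case 1 then have "{0<..<1} \<inter> {..y} = {}" by auto
      then show ?thesis using 1 by (simp add: clamp_def)
    next
      case 2 then have "{0<..<1} \<inter> {..y} = {0<..y}" by auto
      then show ?thesis using 2 by (simp add: clamp_def)
    next
      case 3 then have "{0<..<1} \<inter> {..y} = {0<..<1}" by auto
      then show ?thesis using 3 by (simp add: clamp_def)
    qed
  qed
  finally show ?thesis by (simp add: cdf_def)
qed

section \<open>Binary digits and the law of the tail\<close>

definition digit :: "(nat \<Rightarrow> real) \<Rightarrow> nat \<Rightarrow> path \<Rightarrow> bool" where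
  "digit a m x \<longleftrightarrow> x (node m 0 0) \<le> a m"

text \<open>The number whose binary digits after the point are the digits \<open>m\<close>,
  \<open>m + 1\<close>, and so on.\<close>

definition tail :: "(nat \<Rightarrow> real) \<Rightarrow> nat \<Rightarrow> path \<Rightarrow> real" where
  "tail a m x = (\<Sum>i. of_bool (digit a (m + i) x) / 2 ^ Suc i)"

lemma tail_summable: "summable (\<lambda>i. of_bool (digit a (m + i) x) / (2::real) ^ Suc i)"
proof (rule summable_comparison_test'[of "\<lambda>i. (1/2::real) ^ Suc i" 0])
  show "summable (\<lambda>i. (1/2::real) ^ Suc i)" by (subst summable_Suc_iff) (rule summable_geometric, simp)
  show "norm (of_bool (digit a (m + i) x) / (2::real) ^ Suc i) \<le> (1/2) ^ Suc i" for i
    by (cases "digit a (m + i) x") (simp_all add: power_one_over)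
qed

lemma tail_Suc: "tail a m x = (of_bool (digit a m x) + tail a (Suc m) x) / 2"
proof -
  have "tail a m x = of_bool (digit a m x) / 2 + (\<Sum>i. of_bool (digit a (m + Suc i) x) / 2 ^ Suc (Suc i))"
    unfolding tail_def using suminf_split_head[OF tail_summable[of a m x]] by simp
  also have "(\<Sum>i. of_bool (digit a (m + Suc i) x) / 2 ^ Suc (Suc i)) = (\<Sum>i. of_bool (digit a (Suc m + i) x) / (2::real) ^ Suc i / 2)"
    by simp
  also have "\<dots> = tail a (Suc m) x / 2"
    unfolding tail_def by (rule suminf_divide[OF tail_summable])
  finally show ?thesis by (simp add: add_divide_distrib)
qed

lemma tail_bounds: "0 \<le> tail a m x" "tail a m x \<le> 1"
proof -
  show "0 \<le> tail a m x" unfolding tail_def by (rule suminf_nonneg[OF tail_summable]) simp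
  have "tail a m x \<le> (\<Sum>i. (1/2::real) ^ Suc i)" unfolding tail_def
  proof (rule suminf_le[OF _ tail_summable])
    show "of_bool (digit a (m + i) x) / (2::real) ^ Suc i \<le> (1/2) ^ Suc i" for i
      by (cases "digit a (m + i) x") (simp_all add: power_one_over)
    show "summable (\<lambda>i. (1/2::real) ^ Suc i)" by (subst summable_Suc_iff) (rule summable_geometric, simp)
  qed
  also have "\<dots> = 1" using power_half_series by (simp add: sums_iff)
  finally show "tail a m x \<le> 1" .
qed

lemma measurable_digit:
  assumes "(\<lambda>x. x (node m 0 0)) \<in> borel_measurable M"
  shows "Measurable.pred M (\<lambda>x. digit a m x)"
  unfolding digit_def pred_def using borel_measurable_le[OF assms borel_measurable_const[of "a m"]] .

lemma measurable_tail:
  assumes "\<And>i. (\<lambda>x. x (node (m + i) 0 0)) \<in> borel_measurable M"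
  shows "(\<lambda>x. tail a m x) \<in> borel_measurable M"
  unfolding tail_def
proof (rule borel_measurable_suminf)
  fix i
  have [measurable]: "Measurable.pred M (\<lambda>x. digit a (m + i) x)" by (rule measurable_digit[OF assms])
  show "(\<lambda>x. of_bool (digit a (m + i) x) / (2::real) ^ Suc i) \<in> borel_measurable M" by measurable
qed

lemma measurable_tail_noise: "(\<lambda>x. tail a m x) \<in> borel_measurable noise"
  by (rule measurable_tail) (rule measurable_noise_component)

text \<open>The past before time \<open>m\<close> uses the coordinates with index below
  \<open>m\<close>, the tail those with index \<open>m\<close>, \<open>m + 1\<close>, and so on. At
  level 0 no rotation has taken place, so the two are independent.\<close>

lemma integral_past_tail:
  fixes g :: "path \<times> real \<Rightarrow> real"
  assumes g: "g \<in> borel_measurable (past m 0 0 \<Otimes>\<^sub>M borel)" and int: "integrable noise (\<lambda>x. g (x, tail a m x))"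
  shows "(\<integral>x. g (x, tail a m x) \<partial>noise) = (\<integral>x. (\<integral>y. g (x, y) \<partial>distr noise borel (tail a m)) \<partial>noise)"
proof -
  let ?J = "{node m 0 0..}"
  have J: "?J \<inter> {..<node m 0 0} = {}" by auto
  have nJ: "node (m + i) 0 0 \<in> ?J" for i by (auto simp: node_def intro!: ennreal_leI)
  have f: "(\<lambda>y. tail a m y) \<in> PiM ?J (\<lambda>_. borel) \<rightarrow>\<^sub>M borel"
    by (rule measurable_tail) (rule measurable_component_singleton[OF nJ])
  have e: "tail a m (restrict (level m 0 x) ?J) = tail a m x" for x
    unfolding tail_def digit_def using nJ by simp
  have int': "integrable noise (\<lambda>x. g (x, tail a m (restrict (level m 0 x) ?J)))" using int by (simp only: e)
  show ?thesis using integral_past_freeze[where f="tail a m", OF J f g int'] by (simp only: e)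
qed

lemma node_less_Suc: "i < m \<Longrightarrow> node i 0 0 < node m n k"
  unfolding node_def by (subst ennreal_less_iff) (auto intro: less_le_trans[of _ "real m"])

lemma past_digit:
  assumes "i < m" shows "(\<lambda>x. x (node i 0 0)) \<in> borel_measurable (past m n k)"
proof (rule past_coord)
  show "node i 0 0 < node m n k" by (rule node_less_Suc[OF assms])
  show "node i 0 0 \<noteq> node m n j" for j using node_less_Suc[OF assms, of n j] by simp
qed

text \<open>Conditioning on the next digit gives the recursion \<open>rec\<close> for the
  distribution functions, and \<open>clamp\<close> satisfies the same one. One of the points
  \<open>2 * y\<close> and \<open>2 * y - 1\<close> always lies where both functions are 0 or both
  are 1, so the distance to \<open>clamp\<close> halves at each step.\<close>

lemma distr_tail:
  assumes a: "\<And>i. m \<le> i \<Longrightarrow> Phi (a i) = 1 / 2"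
  shows "distr noise borel (tail a m) = unif"
proof -
  define F where "F m y = measure noise {x. tail a m x \<le> y}" for m y
  have mt: "(\<lambda>x. tail a m x) \<in> borel_measurable noise" for m by (rule measurable_tail_noise)
  have F0: "F m y = 0" if "y < 0" for m y
  proof -
    have "{x. tail a m x \<le> y} = {}" using tail_bounds(1)[of a m] that by (auto simp: not_le intro: less_le_trans)
    then show ?thesis by (simp add: F_def)
  qed
  have F1: "F m y = 1" if "1 \<le> y" for m y
  proof -
    have "{x. tail a m x \<le> y} = UNIV" using tail_bounds(2)[of a m] that by (auto intro: order_trans)
    then show ?thesis using noise.prob_space by (simp add: F_def)
  qed
  have Fdistr: "F m y = measure (distr noise borel (tail a m)) {..y}" for m y
    by (subst measure_distr) (use mt[of m] in \<open>simp_all add: F_def vimage_def\<close>)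
  have pdig: "measure noise {x. digit a i x} = 1 / 2" if "m \<le> i" for i
  proof -
    have "measure noise {x. digit a i x} = measure (distr noise borel (\<lambda>x. x (node i 0 0))) {..a i}"
      by (subst measure_distr[OF measurable_noise_component]) (simp_all add: digit_def[abs_def] vimage_def)
    also have "\<dots> = Phi (a i)" by (simp add: distr_noise_component Phi_def cdf_def)
    finally show ?thesis using a[OF that] by simp
  qed
  have rec: "F i y = (F (Suc i) (2 * y) + F (Suc i) (2 * y - 1)) / 2" if "m \<le> i" for i y
  proof -
    let ?g = "\<lambda>p. of_bool ((of_bool (digit a i (fst p)) + snd p) / 2 \<le> y) :: real"
    have dm: "Measurable.pred (past (Suc i) 0 0) (\<lambda>x. digit a i x)" by (rule measurable_digit) (rule past_digit, simp)
    have [measurable]: "Measurable.pred (past (Suc i) 0 0 \<Otimes>\<^sub>M borel) (\<lambda>p. digit a i (fst p))"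
      by (rule measurable_compose[OF measurable_fst dm])
    have g: "?g \<in> borel_measurable (past (Suc i) 0 0 \<Otimes>\<^sub>M borel)" by measurable
    have lower[measurable]: "Measurable.pred noise (\<lambda>x. digit a i x)" by (rule measurable_digit) (rule measurable_noise_component)
    note mt[measurable]
    have int: "integrable noise (\<lambda>x. ?g (x, tail a (Suc i) x))"
      by (rule noise.integrable_const_bound[of _ 1]) (simp_all, measurable)
    interpret T: prob_space "distr noise borel (tail a (Suc i))" by (rule noise.prob_space_distr) (use mt[of "Suc i"] in simp)
    have "F i y = (\<integral>x. indicator {x. tail a i x \<le> y} x \<partial>noise)" by (simp add: F_def)
    also have "\<dots> = (\<integral>x. ?g (x, tail a (Suc i) x) \<partial>noise)"
      by (intro Bochner_Integration.integral_cong) (auto simp: indicator_def tail_Suc[of a i])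
    also have "\<dots> = (\<integral>x. (\<integral>z. ?g (x, z) \<partial>distr noise borel (tail a (Suc i))) \<partial>noise)"
      by (rule integral_past_tail[OF g int])
    also have "\<dots> = (\<integral>x. F (Suc i) (2 * y) + (F (Suc i) (2 * y - 1) - F (Suc i) (2 * y)) * indicator {x. digit a i x} x \<partial>noise)"
    proof (rule Bochner_Integration.integral_cong[OF refl])
      fix x
      have "(\<integral>z. ?g (x, z) \<partial>distr noise borel (tail a (Suc i))) = (\<integral>z. indicator {..2 * y - of_bool (digit a i x)} z \<partial>distr noise borel (tail a (Suc i)))"
        by (intro Bochner_Integration.integral_cong) (auto simp: indicator_def field_simps)
      also have "\<dots> = F (Suc i) (2 * y - of_bool (digit a i x))" by (simp add: Fdistr)
      finally show "(\<integral>z. ?g (x, z) \<partial>distr noise borel (tail a (Suc i))) = F (Suc i) (2 * y) + (F (Suc i) (2 * y - 1) - F (Suc i) (2 * y)) * indicator {x. digit a i x} x"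
        by (cases "digit a i x") simp_all
    qed
    also have "\<dots> = F (Suc i) (2 * y) + (F (Suc i) (2 * y - 1) - F (Suc i) (2 * y)) * measure noise {x. digit a i x}"
    proof -
      have "{x. digit a i x} \<in> sets noise" using lower by (simp add: pred_def)
      then have "integrable noise (\<lambda>x. (F (Suc i) (2 * y - 1) - F (Suc i) (2 * y)) * indicator {x. digit a i x} x)"
        by (intro integrable_mult_right integrable_real_indicator) (simp_all add: noise.emeasure_eq_measure)
      then show ?thesis by (subst Bochner_Integration.integral_add) (simp_all add: noise.prob_space[simplified])
    qed
    finally show ?thesis unfolding pdig[OF that] by (simp add: field_simps)
  qed
  have close: "\<bar>F i y - clamp y\<bar> \<le> (1 / 2) ^ n" if "m \<le> i" for n i y
    using that
  proof (induction n arbitrary: i y)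
    case 0
    have "0 \<le> F i y" "F i y \<le> 1" by (simp_all add: F_def)
    moreover have "0 \<le> clamp y" "clamp y \<le> 1" by (simp_all add: clamp_def)
    ultimately show ?case by (simp add: abs_le_iff)
  next
    case (Suc n)
    have IH: "\<bar>F (Suc i) z - clamp z\<bar> \<le> (1 / 2) ^ n" for z by (rule Suc.IH) (use Suc.prems in simp)
    have e: "F i y - clamp y = ((F (Suc i) (2 * y) - clamp (2 * y)) + (F (Suc i) (2 * y - 1) - clamp (2 * y - 1))) / 2"
      unfolding rec[OF Suc.prems] using clamp_tent(1)[of y] by (simp add: field_simps)
    show ?case
    proof (cases "2 * y < 1")
      case True
      then have "F (Suc i) (2 * y - 1) = 0" "clamp (2 * y - 1) = 0" by (simp_all add: F0 clamp_def)
      then show ?thesis unfolding e using IH[of "2 * y"] by simp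
    next
      case False
      then have "F (Suc i) (2 * y) = 1" "clamp (2 * y) = 1" by (simp_all add: F1 clamp_def)
      then show ?thesis unfolding e using IH[of "2 * y - 1"] by simp
    qed
  qed
  have "F m y = clamp y" for y
  proof -
    have "(\<lambda>n. (1 / 2 :: real) ^ n) \<longlonglongrightarrow> 0" by (rule LIMSEQ_power_zero) simp
    then have "\<bar>F m y - clamp y\<bar> \<le> 0" by (rule LIMSEQ_le_const) (use close[OF order_refl] in blast)
    then show ?thesis by simp
  qed
  then show ?thesis
    by (intro cdf_unique) (use mt[of m] in \<open>auto simp: fun_eq_iff cdf_unif cdf_def[of "distr _ _ _"] Fdistr[symmetric] unif.real_distribution_axioms\<close>)
qed

section \<open>A continuous martingale with prescribed terminal value\<close>

text \<open>The assumption \<open>g_cont\<close> is what makes the martingale converge to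
  \<open>g (V x)\<close> at time \<infinity>; monotone functions and their piecewise translates
  satisfy it. The number \<open>p\<close> is the probability that the first digit is 1.\<close>

locale embedding =
  fixes p :: real and g :: "real \<Rightarrow> real"
  assumes p: "0 < p" "p < 1"
    and g_meas: "g \<in> borel_measurable borel"
    and g_int: "set_integrable lborel {0<..<1} g"
    and g_cont: "countable {u \<in> {0<..<1}. \<not> isCont g u}"
begin

definition digit_prob :: "nat \<Rightarrow> real" where "digit_prob m = (if m = 0 then p else 1 / 2)"
definition threshold :: "nat \<Rightarrow> real" where "threshold m = (SOME a. Phi a = digit_prob m)"

lemma digit_prob: "0 < digit_prob m" "digit_prob m < 1" using p by (auto simp: digit_prob_def)

lemma Phi_threshold: "Phi (threshold m) = digit_prob m"
  unfolding threshold_def by (rule someI_ex) (metis Phi_onto digit_prob)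

abbreviation D :: "nat \<Rightarrow> path \<Rightarrow> bool" where "D \<equiv> digit threshold"

fun width :: "nat \<Rightarrow> path \<Rightarrow> real" where
  "width 0 x = 1"
| "width (Suc m) x = (if D m x then digit_prob m else 1 - digit_prob m) * width m x"

fun left :: "nat \<Rightarrow> path \<Rightarrow> real" where
  "left 0 x = 0"
| "left (Suc m) x = left m x + (if D m x then (1 - digit_prob m) * width m x else 0)"

lemma width_pos: "0 < width m x"
  using digit_prob by (induction m) auto

lemma left_nonneg: "0 \<le> left m x"
  using digit_prob width_pos by (induction m) (auto intro!: add_nonneg_nonneg mult_nonneg_nonneg simp: less_imp_le)

lemma left_width_Suc: "left (Suc m) x + width (Suc m) x \<le> left m x + width m x"
  using digit_prob[of m] width_pos[of m x] by (auto simp: algebra_simps)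

lemma left_width_le: "left m x + width m x \<le> 1"
proof (induction m)
  case (Suc m) then show ?case using left_width_Suc[of m x] by linarith
qed simp

lemma width_le: "width (Suc m) x \<le> (1 / 2) ^ m"
proof (induction m)
  case 0 show ?case using digit_prob[of 0] by simp
next
  case (Suc m)
  have "width (Suc (Suc m)) x = 1 / 2 * width (Suc m) x" unfolding width.simps(2)[of "Suc m"] by (simp add: digit_prob_def)
  then show ?case unfolding power_Suc using Suc by linarith
qed

text \<open>A bound that is uniform over the finitely many intervals of stage \<open>m\<close>. It
  makes the averages of \<open>g\<close> over them bounded although \<open>g\<close> need not
  be.\<close>

lemma width_ge: "\<exists>c>0. \<forall>x. c \<le> width m x"
proof (induction m)
  case 0 show ?case by (intro exI[of _ 1]) simp
next
  case (Suc m)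
  then obtain c where c: "0 < c" "\<And>x. c \<le> width m x" by blast
  have "min (digit_prob m) (1 - digit_prob m) * c \<le> width (Suc m) x" for x
    using c(2)[of x] c(1) digit_prob[of m] unfolding width.simps by (intro mult_mono) auto
  moreover have "0 < min (digit_prob m) (1 - digit_prob m) * c" using c(1) digit_prob[of m] by simp
  ultimately show ?case by blast
qed

text \<open>The point with digits \<open>D 0 x, D 1 x, \<dots>\<close>, where the first digit splits the unit interval in the
  ratio \<open>1 - p : p\<close> and the others bisect. After \<open>m\<close> digits it is known to lie between \<open>left m x\<close> and
  \<open>left m x + width m x\<close>.\<close>

definition V :: "path \<Rightarrow> real" where "V x = left 1 x + width 1 x * tail threshold 1 x"

lemma V_eq: "V x = left (Suc m) x + width (Suc m) x * tail threshold (Suc m) x"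
proof (induction m)
  case 0 then show ?case by (simp add: V_def)
next
  case (Suc m)
  have t: "tail threshold (Suc m) x = (of_bool (D (Suc m) x) + tail threshold (Suc (Suc m)) x) / 2" by (rule tail_Suc)
  have q: "digit_prob (Suc m) = 1 / 2" by (simp add: digit_prob_def)
  show ?case unfolding Suc t left.simps(2)[of "Suc m"] width.simps(2)[of "Suc m"] q
    by (cases "D (Suc m) x") (simp_all add: algebra_simps)
qed

lemma V_bounds: "left (Suc m) x \<le> V x" "V x \<le> left (Suc m) x + width (Suc m) x"
proof -
  have "0 \<le> width (Suc m) x * tail threshold (Suc m) x"
    by (rule mult_nonneg_nonneg[OF less_imp_le[OF width_pos] tail_bounds(1)])
  then show "left (Suc m) x \<le> V x" unfolding V_eq[of x m] by linarith
  have "width (Suc m) x * tail threshold (Suc m) x \<le> width (Suc m) x * 1"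
    by (rule mult_left_mono[OF tail_bounds(2) less_imp_le[OF width_pos]])
  then show "V x \<le> left (Suc m) x + width (Suc m) x" unfolding V_eq[of x m] by linarith
qed

text \<open>The conditional expectation of \<open>g (V x)\<close> when the first \<open>m\<close>
  digits are known. \<open>upper\<close> and \<open>lower\<close> are its values after the next
  digit turns out to be 1 or 0.\<close>

definition val :: "nat \<Rightarrow> path \<Rightarrow> real" where "val m x = avg g (left m x) (width m x)"
definition upper :: "nat \<Rightarrow> path \<Rightarrow> real" where "upper m x = avg g (left m x + (1 - digit_prob m) * width m x) (digit_prob m * width m x)"
definition lower :: "nat \<Rightarrow> path \<Rightarrow> real" where "lower m x = avg g (left m x) ((1 - digit_prob m) * width m x)"

lemma g_int_sub: "0 \<le> l \<Longrightarrow> l + w \<le> 1 \<Longrightarrow> set_integrable lborel {l<..<l + w} g"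
  by (rule set_integrable_subset[OF g_int]) auto

lemma val_split: "val m x = (1 - digit_prob m) * lower m x + digit_prob m * upper m x"
  unfolding val_def upper_def lower_def
  by (rule avg_split[OF g_meas width_pos digit_prob g_int_sub[OF left_nonneg left_width_le]])

lemma val_Suc: "val (Suc m) x = (if D m x then upper m x else lower m x)"
  by (simp add: val_def upper_def lower_def)

lemma upper_interval: "left m x \<le> left m x + (1 - digit_prob m) * width m x" "left m x + (1 - digit_prob m) * width m x + digit_prob m * width m x = left m x + width m x" "0 < digit_prob m * width m x"
  using digit_prob[of m] width_pos[of m x] by (simp_all add: algebra_simps mult_left_le)

lemma lower_interval: "0 < (1 - digit_prob m) * width m x" "left m x + (1 - digit_prob m) * width m x \<le> left m x + width m x"
  using digit_prob[of m] width_pos[of m x] by (simp_all add: algebra_simps)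

lemma upper_greater:
  assumes "\<And>u. left m x < u \<Longrightarrow> u < left m x + width m x \<Longrightarrow> c < g u"
  shows "c < upper m x" "c < lower m x"
proof -
  note b = left_nonneg[of m x] left_width_le[of m x] upper_interval[of m x] lower_interval[of m x]
  show "c < upper m x" unfolding upper_def
    by (rule avg_greater[OF g_meas b(5) g_int_sub]) (use b in \<open>auto intro!: assms\<close>)
  show "c < lower m x" unfolding lower_def
    by (rule avg_greater[OF g_meas b(6) g_int_sub]) (use b in \<open>auto intro!: assms\<close>)
qed

lemma upper_less:
  assumes "\<And>u. left m x < u \<Longrightarrow> u < left m x + width m x \<Longrightarrow> g u < c"
  shows "upper m x < c" "lower m x < c"
proof -
  note b = left_nonneg[of m x] left_width_le[of m x] upper_interval[of m x] lower_interval[of m x]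
  show "upper m x < c" unfolding upper_def
    by (rule avg_less[OF g_meas b(5) g_int_sub]) (use b in \<open>auto intro!: assms\<close>)
  show "lower m x < c" unfolding lower_def
    by (rule avg_less[OF g_meas b(6) g_int_sub]) (use b in \<open>auto intro!: assms\<close>)
qed

lemma upper_lower_bounded: "\<exists>B. \<forall>x. \<bar>upper m x\<bar> \<le> B \<and> \<bar>lower m x\<bar> \<le> B"
proof -
  obtain c where c: "0 < c" "\<And>x. c \<le> width m x" using width_ge by blast
  let ?q = "min (digit_prob m) (1 - digit_prob m)" and ?N = "LINT u:{0<..<1}|lborel. \<bar>g u\<bar>"
  have q: "0 < ?q" using digit_prob[of m] by simp
  have N: "0 \<le> ?N" unfolding set_lebesgue_integral_def by (rule integral_nonneg_AE) simp
  have "\<bar>upper m x\<bar> \<le> ?N / (?q * c) \<and> \<bar>lower m x\<bar> \<le> ?N / (?q * c)" for x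
  proof
    note b = left_nonneg[of m x] left_width_le[of m x] upper_interval[of m x] lower_interval[of m x]
    have 1: "?q * c \<le> digit_prob m * width m x" using c(2)[of x] c(1) digit_prob[of m] by (intro mult_mono) auto
    have 2: "?q * c \<le> (1 - digit_prob m) * width m x" using c(2)[of x] c(1) digit_prob[of m] by (intro mult_mono) auto
    have "\<bar>upper m x\<bar> \<le> ?N / (digit_prob m * width m x)" unfolding upper_def
      by (rule avg_abs_le[OF g_meas b(5) g_int]) (use b in linarith)+
    also have "\<dots> \<le> ?N / (?q * c)" using 1 N q c(1) by (intro divide_left_mono) (auto intro: mult_pos_pos b)
    finally show "\<bar>upper m x\<bar> \<le> ?N / (?q * c)" .
    have "\<bar>lower m x\<bar> \<le> ?N / ((1 - digit_prob m) * width m x)" unfolding lower_def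
      by (rule avg_abs_le[OF g_meas b(6) g_int]) (use b in linarith)+
    also have "\<dots> \<le> ?N / (?q * c)" using 2 N q c(1) by (intro divide_left_mono) (auto intro: mult_pos_pos b)
    finally show "\<bar>lower m x\<bar> \<le> ?N / (?q * c)" .
  qed
  then show ?thesis by blast
qed

text \<open>The conditional expectation of \<open>g (V x)\<close> at time \<open>m + s\<close>: the
  digits before \<open>m\<close> are known, and \<open>gate\<close> is the conditional probability
  that digit \<open>m\<close> will be 1.\<close>

definition X :: "nat \<Rightarrow> path \<Rightarrow> real \<Rightarrow> real" where
  "X m x s = lower m x + (upper m x - lower m x) * gate m (threshold m) x s"

lemma X_0: "X m x 0 = val m x"
  unfolding X_def gate_0 Phi_threshold val_split by (simp add: algebra_simps)

lemma X_1: "X m x 1 = val (Suc m) x"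
  unfolding X_def gate_1 val_Suc digit_def by simp

lemma X_convex: "X m x s = (1 - gate m (threshold m) x s) * lower m x + gate m (threshold m) x s * upper m x"
  by (simp add: X_def algebra_simps)

lemma X_bounded: "\<exists>B. \<forall>x s. \<bar>X m x s\<bar> \<le> B"
proof -
  obtain B where B: "\<And>x. \<bar>upper m x\<bar> \<le> B" "\<And>x. \<bar>lower m x\<bar> \<le> B" using upper_lower_bounded by blast
  have "\<bar>X m x s\<bar> \<le> B" for x s
  proof -
    let ?u = "gate m (threshold m) x s"
    have u: "0 \<le> ?u" "?u \<le> 1" by (rule gate_bounds)+
    have "\<bar>X m x s\<bar> \<le> \<bar>(1 - ?u) * lower m x\<bar> + \<bar>?u * upper m x\<bar>" unfolding X_convex by (rule abs_triangle_ineq)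
    also have "\<dots> = (1 - ?u) * \<bar>lower m x\<bar> + ?u * \<bar>upper m x\<bar>" using u by (simp add: abs_mult)
    also have "\<dots> \<le> (1 - ?u) * B + ?u * B" using u B by (intro add_mono mult_left_mono) simp_all
    also have "\<dots> = B" by (simp add: algebra_simps)
    finally show ?thesis .
  qed
  then show ?thesis by blast
qed

text \<open>A strict bound for \<open>g\<close> on the current interval passes to averages over both
  parts and to their convex combinations. With its mirror image this confines the paths to the
  convex hull.\<close>

lemma X_greater:
  assumes "\<And>u. left m x < u \<Longrightarrow> u < left m x + width m x \<Longrightarrow> c < g u"
  shows "c < X m x s"
proof -
  let ?u = "gate m (threshold m) x s"
  have u: "0 \<le> ?u" "?u \<le> 1" by (rule gate_bounds)+
  have g: "c < upper m x" "c < lower m x" using upper_greater[OF assms] by blast+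
  have "c < min (upper m x) (lower m x)" using g by simp
  also have "\<dots> = (1 - ?u) * min (upper m x) (lower m x) + ?u * min (upper m x) (lower m x)" by (simp add: algebra_simps)
  also have "\<dots> \<le> X m x s" unfolding X_convex using u by (intro add_mono mult_left_mono) simp_all
  finally show ?thesis .
qed

lemma X_less:
  assumes "\<And>u. left m x < u \<Longrightarrow> u < left m x + width m x \<Longrightarrow> g u < c"
  shows "X m x s < c"
proof -
  let ?u = "gate m (threshold m) x s"
  have u: "0 \<le> ?u" "?u \<le> 1" by (rule gate_bounds)+
  have g: "upper m x < c" "lower m x < c" using upper_less[OF assms] by blast+
  have "X m x s \<le> (1 - ?u) * max (upper m x) (lower m x) + ?u * max (upper m x) (lower m x)"
    unfolding X_convex using u by (intro add_mono mult_left_mono) simp_all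
  also have "\<dots> = max (upper m x) (lower m x)" by (simp add: algebra_simps)
  also have "\<dots> < c" using g by simp
  finally show ?thesis .
qed

text \<open>The intervals shrink to \<open>V x\<close>, so near a continuity point \<open>g\<close>
  is almost constant on them. Uniformity in \<open>s\<close> is what continuity of the path at time
  \<infinity> requires.\<close>

lemma X_limit:
  assumes V: "0 < V x" "V x < 1" and c: "isCont g (V x)" and e: "0 < e"
  shows "\<exists>N. \<forall>m\<ge>N. \<forall>s. \<bar>X m x s - g (V x)\<bar> < e"
proof -
  obtain d where d: "0 < d" "\<And>u. \<bar>u - V x\<bar> < d \<Longrightarrow> \<bar>g u - g (V x)\<bar> < e"
    using c e unfolding continuous_at_eps_delta dist_real_def by blast
  obtain N where N: "(1 / 2 :: real) ^ N < d" using real_arch_pow_inv[OF d(1), of "1/2"] by auto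
  have "\<bar>X m x s - g (V x)\<bar> < e" if m: "Suc N \<le> m" for m s
  proof -
    obtain k where k: "m = Suc k" "N \<le> k" using m by (cases m) auto
    have "(1 / 2 :: real) ^ k \<le> (1 / 2) ^ N" using k by (intro power_decreasing) simp_all
    then have w: "width m x < d" using width_le[of k x] N unfolding k(1) by linarith
    have near: "g (V x) - e < g u \<and> g u < g (V x) + e" if "left m x < u" "u < left m x + width m x" for u
    proof -
      have "\<bar>u - V x\<bar> < d" using V_bounds[where m=k and x=x] that w unfolding k(1) by linarith
      then have "\<bar>g u - g (V x)\<bar> < e" by (rule d(2))
      then show ?thesis by linarith
    qed
    have "g (V x) - e < X m x s" by (rule X_greater) (use near in blast)
    moreover have "X m x s < g (V x) + e" by (rule X_less) (use near in blast)
    ultimately have "\<bar>X m x s - g (V x)\<bar> < e" by linarith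
    then show ?thesis by linarith
  qed
  then show ?thesis by blast
qed

lemma left_digit: "D 0 x \<Longrightarrow> 1 - p \<le> left (Suc m) x" "\<not> D 0 x \<Longrightarrow> left (Suc m) x + width (Suc m) x \<le> 1 - p"
proof -
  have mono: "left k x \<le> left (Suc k) x" for k using digit_prob[of k] width_pos[of k x] by (simp add: less_imp_le)
  show "1 - p \<le> left (Suc m) x" if "D 0 x"
  proof (induction m)
    case 0 then show ?case using that by (simp add: digit_prob_def)
  next
    case (Suc m) then show ?case using mono[of "Suc m"] by linarith
  qed
  show "left (Suc m) x + width (Suc m) x \<le> 1 - p" if "\<not> D 0 x"
  proof (induction m)
    case 0 then show ?case using that by (simp add: digit_prob_def)
  next
    case (Suc m) then show ?case using left_width_Suc[of "Suc m" x] by linarith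
  qed
qed

lemma V_digit: "D 0 x \<Longrightarrow> 1 - p \<le> V x" "\<not> D 0 x \<Longrightarrow> V x \<le> 1 - p"
  using left_digit[of x 0] V_bounds[where m=0 and x=x] by linarith+

section \<open>Measurability with respect to the past\<close>

lemma measurable_avg:
  assumes "l \<in> borel_measurable M" "w \<in> borel_measurable M"
  shows "(\<lambda>x. avg g (l x) (w x)) \<in> borel_measurable M"
proof -
  have [measurable]: "g \<in> borel_measurable borel" "l \<in> borel_measurable M" "w \<in> borel_measurable M" by (fact g_meas assms)+
  have "(\<lambda>(x, u). g (l x + w x * u)) \<in> borel_measurable (M \<Otimes>\<^sub>M unif)" by measurable
  then show ?thesis unfolding avg_def by (rule unif.borel_measurable_lebesgue_integral)
qed

lemma measurable_seg:
  assumes "\<And>i. i < m \<Longrightarrow> (\<lambda>x. x (node i 0 0)) \<in> borel_measurable M"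
  shows "left m \<in> borel_measurable M \<and> width m \<in> borel_measurable M"
  using assms
proof (induction m)
  case 0
  have "left 0 = (\<lambda>x. 0)" "width 0 = (\<lambda>x. 1)" by (simp_all add: fun_eq_iff)
  then show ?case by simp
next
  case (Suc m)
  then have [measurable]: "left m \<in> borel_measurable M" "width m \<in> borel_measurable M" by auto
  have [measurable]: "Measurable.pred M (\<lambda>x. D m x)" by (rule measurable_digit) (rule Suc.prems, simp)
  have "left (Suc m) = (\<lambda>x. left m x + (if D m x then (1 - digit_prob m) * width m x else 0))"
    "width (Suc m) = (\<lambda>x. (if D m x then digit_prob m else 1 - digit_prob m) * width m x)" by (simp_all add: fun_eq_iff)
  then show ?case by simp
qed

lemma measurable_upper_lower:
  assumes "\<And>i. i < m \<Longrightarrow> (\<lambda>x. x (node i 0 0)) \<in> borel_measurable M"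
  shows "upper m \<in> borel_measurable M" "lower m \<in> borel_measurable M" "val m \<in> borel_measurable M"
proof -
  have [measurable]: "left m \<in> borel_measurable M" "width m \<in> borel_measurable M" using measurable_seg[OF assms] by auto
  have "(\<lambda>x. upper m x) \<in> borel_measurable M" unfolding upper_def by (rule measurable_avg) measurable
  then show "upper m \<in> borel_measurable M" by simp
  have "(\<lambda>x. lower m x) \<in> borel_measurable M" unfolding lower_def by (rule measurable_avg) measurable
  then show "lower m \<in> borel_measurable M" by simp
  have "(\<lambda>x. val m x) \<in> borel_measurable M" unfolding val_def by (rule measurable_avg) measurable
  then show "val m \<in> borel_measurable M" by simp
qed

lemma past_X:
  assumes u: "0 \<le> u" "u < 1" "u \<le> real k / 2 ^ n" and k: "k \<le> 2 ^ n"
  shows "(\<lambda>x. X m x u) \<in> borel_measurable (past m n k)"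
proof -
  have "upper m \<in> borel_measurable (past m n k)" "lower m \<in> borel_measurable (past m n k)"
    by (rule measurable_upper_lower; rule past_digit; assumption)+
  then show ?thesis unfolding X_def
    by (intro borel_measurable_add borel_measurable_times borel_measurable_diff past_gate[OF u k])
qed

text \<open>\<open>level m n\<close> rotates only coordinates with index at least \<open>m\<close>.
  Everything that earlier unit intervals depend on is read off unchanged.\<close>

lemma past_earlier:
  assumes j: "j < m" shows "sets (past j 0 1) \<subseteq> sets (past m n k)"
proof -
  have "(\<lambda>x. restrict (level j 0 x) {..<node j 0 1}) \<in> past m n k \<rightarrow>\<^sub>M PiM {..<node j 0 1} (\<lambda>_. borel)"
  proof (rule measurable_restrict)
    fix t assume "t \<in> {..<node j 0 1}"
    then have "t < node j 0 1" by simp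
    also have "node j 0 1 \<le> node m 0 0" unfolding node_def using j by (intro ennreal_leI) simp
    finally have t: "t < node m 0 0" .
    have ge: "node m 0 0 \<le> node m n i" for i unfolding node_def by (intro ennreal_leI) simp
    have "(\<lambda>x. x t) \<in> borel_measurable (past m n k)"
      by (rule past_coord) (use t ge less_le_trans in \<open>blast, force\<close>)
    then show "(\<lambda>x. level j 0 x t) \<in> borel_measurable (past m n k)" by simp
  qed
  then have "sets (vimage_algebra UNIV (\<lambda>x. restrict (level j 0 x) {..<node j 0 1}) (PiM {..<node j 0 1} (\<lambda>_. borel))) \<subseteq> sets (past m n k)"
    by (intro sets_image_in_sets) simp_all
  then show ?thesis by (simp add: past_def)
qed

lemma level_past_next: "t < node (Suc m) 0 0 \<Longrightarrow> (\<lambda>x. level m n x t) \<in> borel_measurable (past (Suc m) 0 0)"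
proof (induction n arbitrary: t)
  case 0
  then show ?case using past_level[of t "Suc m" 0 0] by simp
next
  case (Suc n)
  let ?o = "\<lambda>k. node m (Suc n) (2 * k + 1)"
  have fresh: "(\<lambda>x. x s) \<in> borel_measurable (past (Suc m) 0 0)" if "s < node (Suc m) 0 0" for s
    using past_level[OF that] by simp
  have lt: "node m i k < node (Suc m) 0 0" if "k < 2 ^ i" for i k
  proof -
    have "real k < real (2 ^ i)" using that by (rule of_nat_less_iff[THEN iffD2])
    then have "real k / 2 ^ i < 1" by simp
    then have "real m + real k / 2 ^ i < real (Suc m) + real 0 / 2 ^ 0" by simp
    then show ?thesis unfolding node_def by (subst ennreal_less_iff) simp_all
  qed
  consider k where "k < 2 ^ n" "t = node m n k" | k where "k < 2 ^ n" "t = ?o k" | "\<And>k. k < 2 ^ n \<Longrightarrow> t \<noteq> node m n k \<and> t \<noteq> ?o k" by blast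
  then show ?case
  proof cases
    case 1
    have "(\<lambda>x. (level m n x (node m n k) + x (?o k)) / sqrt 2) \<in> borel_measurable (past (Suc m) 0 0)"
      by (intro borel_measurable_divide borel_measurable_add borel_measurable_const Suc.IH fresh lt) (use 1 in simp_all)
    then show ?thesis using level_Suc(1)[OF 1(1)] 1(2) by simp
  next
    case 2
    have "(\<lambda>x. (level m n x (node m n k) - x (?o k)) / sqrt 2) \<in> borel_measurable (past (Suc m) 0 0)"
      by (intro borel_measurable_divide borel_measurable_diff borel_measurable_const Suc.IH fresh lt) (use 2 in simp_all)
    then show ?thesis unfolding 2(2) level_Suc(2)[OF 2(1)] .
  next
    case 3
    then have "level m (Suc n) x t = level m n x t" for x by (simp add: rotations_other)
    then show ?thesis using Suc.IH[OF Suc.prems] by simp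
  qed
qed

lemma past_next:
  assumes k: "k \<le> 2 ^ n" shows "sets (past m n k) \<subseteq> sets (past (Suc m) 0 0)"
proof -
  have "real k / 2 ^ n \<le> 1" by (rule dyadic_le_1[OF k])
  then have le: "node m n k \<le> node (Suc m) 0 0" unfolding node_def by (intro ennreal_leI) simp
  have "(\<lambda>x. restrict (level m n x) {..<node m n k}) \<in> past (Suc m) 0 0 \<rightarrow>\<^sub>M PiM {..<node m n k} (\<lambda>_. borel)"
    by (rule measurable_restrict, rule level_past_next) (use le in \<open>auto intro: less_le_trans\<close>)
  then have "sets (vimage_algebra UNIV (\<lambda>x. restrict (level m n x) {..<node m n k}) (PiM {..<node m n k} (\<lambda>_. borel))) \<subseteq> sets (past (Suc m) 0 0)"
    by (intro sets_image_in_sets) simp_all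
  then show ?thesis by (simp add: past_def)
qed

section \<open>The law of the selected point\<close>

lemma measurable_seg_noise: "left m \<in> borel_measurable noise" "width m \<in> borel_measurable noise"
  using measurable_seg[of m noise] measurable_noise_component by auto

lemma measurable_V: "V \<in> borel_measurable noise"
proof -
  have e: "V = (\<lambda>x. left 1 x + width 1 x * tail threshold 1 x)" by (rule ext) (rule V_def)
  show ?thesis unfolding e by (intro borel_measurable_add borel_measurable_times measurable_seg_noise measurable_tail_noise)
qed

text \<open>Given the past, the undecided digits form an independent uniform variable placed in the
  current interval. At least one digit has to be known, since only those from index 1 on are
  fair.\<close>

lemma integral_V_past:
  fixes f :: "real \<Rightarrow> real"
  assumes h: "h \<in> borel_measurable (past (Suc m) 0 0)" and f: "f \<in> borel_measurable borel"
    and int: "integrable noise (\<lambda>x. h x * f (V x))"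
  shows "(\<integral>x. h x * f (V x) \<partial>noise) = (\<integral>x. h x * avg f (left (Suc m) x) (width (Suc m) x) \<partial>noise)"
proof -
  let ?g = "\<lambda>q. h (fst q) * f (left (Suc m) (fst q) + width (Suc m) (fst q) * snd q)"
  have "left (Suc m) \<in> borel_measurable (past (Suc m) 0 0)" "width (Suc m) \<in> borel_measurable (past (Suc m) 0 0)"
    using measurable_seg[of "Suc m" "past (Suc m) 0 0"] past_digit by auto
  from measurable_compose[OF measurable_fst this(1)] measurable_compose[OF measurable_fst this(2)] measurable_compose[OF measurable_fst h]
  have [measurable]: "(\<lambda>q. left (Suc m) (fst q)) \<in> borel_measurable (past (Suc m) 0 0 \<Otimes>\<^sub>M borel)"
     "(\<lambda>q. width (Suc m) (fst q)) \<in> borel_measurable (past (Suc m) 0 0 \<Otimes>\<^sub>M borel)" "(\<lambda>q. h (fst q)) \<in> borel_measurable (past (Suc m) 0 0 \<Otimes>\<^sub>M borel)" .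
  have [measurable]: "f \<in> borel_measurable borel" by (rule f)
  have g: "?g \<in> borel_measurable (past (Suc m) 0 0 \<Otimes>\<^sub>M borel)" by measurable
  have d: "distr noise borel (tail threshold (Suc m)) = unif"
    by (rule distr_tail) (simp add: Phi_threshold digit_prob_def)
  have e: "?g (x, tail threshold (Suc m) x) = h x * f (V x)" for x by (simp add: V_eq[of x m])
  have int': "integrable noise (\<lambda>x. ?g (x, tail threshold (Suc m) x))" using int unfolding e .
  have "(\<integral>x. ?g (x, tail threshold (Suc m) x) \<partial>noise) = (\<integral>x. (\<integral>y. ?g (x, y) \<partial>unif) \<partial>noise)"
    using integral_past_tail[OF g int'] unfolding d .
  also have "(\<lambda>x. (\<integral>y. ?g (x, y) \<partial>unif)) = (\<lambda>x. h x * avg f (left (Suc m) x) (width (Suc m) x))"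
    by (simp add: avg_def fun_eq_iff)
  finally show ?thesis unfolding e .
qed

lemma prob_D0: "(\<integral>x. of_bool (D 0 x) \<partial>noise) = p"
proof -
  have "(\<integral>x. of_bool (D 0 x) \<partial>noise) = (\<integral>x. (indicator {x. x (node 0 0 0) \<in> {..threshold 0}} x :: real) \<partial>noise)"
    by (rule Bochner_Integration.integral_cong) (simp_all add: digit_def indicator_def)
  also have "\<dots> = measure gauss {..threshold 0}" using measure_noise_component[of "{..threshold 0}" "node 0 0 0"] by simp
  also have "\<dots> = p" using Phi_threshold[of 0] by (simp add: Phi_def cdf_def digit_prob_def)
  finally show ?thesis .
qed

lemma pred_D: "Measurable.pred noise (\<lambda>x. D m x)"
  by (rule measurable_digit) (rule measurable_noise_component)

text \<open>Conditioning on the first digit yields averages over the parts of length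
  \<open>1 - p\<close> and \<open>p\<close> with just these lengths as weights, which
  \<open>avg_split\<close> recombines.\<close>

lemma distr_V: "distr noise borel V = unif"
proof (rule measure_eqI)
  fix B assume "B \<in> sets (distr noise borel V)"
  then have B[measurable]: "B \<in> sets borel" by simp
  let ?f = "indicator B :: real \<Rightarrow> real"
  have fm: "?f \<in> borel_measurable borel" by measurable
  note measurable_V[measurable] pred_D[measurable]
  interpret V: prob_space "distr noise borel V" by (rule noise.prob_space_distr[OF measurable_V])
  have int: "integrable noise (\<lambda>x. 1 * ?f (V x))"
    by (rule noise.integrable_const_bound[of _ 1]) (simp_all add: indicator_def)
  have "measure (distr noise borel V) B = (\<integral>x. ?f x \<partial>distr noise borel V)" by simp
  also have "\<dots> = (\<integral>x. 1 * ?f (V x) \<partial>noise)" by (subst integral_distr[OF measurable_V]) simp_all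
  also have "\<dots> = (\<integral>x. 1 * avg ?f (left (Suc 0) x) (width (Suc 0) x) \<partial>noise)"
    by (rule integral_V_past[OF _ fm int]) simp
  also have "\<dots> = (\<integral>x. avg ?f 0 (1 - p) + (avg ?f (1 - p) p - avg ?f 0 (1 - p)) * of_bool (D 0 x) \<partial>noise)"
    by (rule Bochner_Integration.integral_cong) (auto simp: digit_prob_def)
  also have "\<dots> = avg ?f 0 (1 - p) + (avg ?f (1 - p) p - avg ?f 0 (1 - p)) * p"
  proof -
    have "integrable noise (\<lambda>x. of_bool (D 0 x) :: real)"
      by (rule noise.integrable_const_bound[of _ 1]) simp_all
    then show ?thesis by (subst Bochner_Integration.integral_add) (simp_all add: prob_D0 noise.prob_space[simplified])
  qed
  also have "\<dots> = avg ?f 0 1"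
  proof -
    have "integrable unif ?f" by (rule unif.integrable_const_bound[of _ 1]) simp_all
    then have "set_integrable lborel {0<..<0 + 1} ?f" unfolding integrable_unif[OF fm] by simp
    from avg_split[OF fm _ p this] show ?thesis by (simp add: algebra_simps)
  qed
  also have "\<dots> = measure unif B" by (simp add: avg_def)
  finally show "emeasure (distr noise borel V) B = emeasure unif B"
    by (simp add: V.emeasure_eq_measure unif.emeasure_eq_measure)
qed simp

lemma integrable_gV: "integrable noise (\<lambda>x. g (V x))"
proof -
  have "integrable (distr noise borel V) g" unfolding distr_V integrable_unif[OF g_meas] by (rule g_int)
  then show ?thesis by (subst (asm) integrable_distr_eq[OF measurable_V g_meas])
qed

text \<open>Conditions for a continuous path that converges to \<open>g (V x)\<close>. The cut point
  \<open>1 - p\<close> is excluded so that the first digit places \<open>V x\<close> in the interior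
  of one of the two parts.\<close>

definition good :: "path \<Rightarrow> bool" where
  "good x \<longleftrightarrow> (\<forall>m. tame m x) \<and> (\<forall>m. x (node m 0 0) \<noteq> threshold m) \<and> 0 < V x \<and> V x < 1 \<and> V x \<noteq> 1 - p \<and> isCont g (V x)"

lemma AE_good: "AE x in noise. good x"
proof -
  let ?C = "insert (1 - p) {u \<in> {0<..<1}. \<not> isCont g u}"
  have c: "countable ?C" using g_cont by simp
  have "AE u in lborel. u \<notin> ?C"
    using countable_imp_null_set_lborel[OF c] by (rule AE_not_in)
  then have "AE u in unif. u \<notin> ?C" unfolding unif_def by (subst AE_density) auto
  then have "AE u in unif. 0 < u \<and> u < 1 \<and> u \<noteq> 1 - p \<and> isCont g u"
    using AE_unif by eventually_elim auto
  then have "AE u in distr noise borel V. 0 < u \<and> u < 1 \<and> u \<noteq> 1 - p \<and> isCont g u" unfolding distr_V .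
  from AE_distrD[OF measurable_V this] have "AE x in noise. 0 < V x \<and> V x < 1 \<and> V x \<noteq> 1 - p \<and> isCont g (V x)" .
  moreover have "AE x in noise. \<forall>m. tame m x" unfolding AE_all_countable using AE_tame by blast
  moreover have "AE x in noise. \<forall>m. x (node m 0 0) \<noteq> threshold m" unfolding AE_all_countable using AE_node_neq by blast
  ultimately show ?thesis by eventually_elim (auto simp: good_def)
qed

lemma X_continuous: "good x \<Longrightarrow> continuous_on {0..1} (X m x)"
  unfolding X_def good_def
  by (intro continuous_on_add continuous_on_mult continuous_on_const gate_continuous) auto

lemma measurable_X_noise: "0 \<le> u \<Longrightarrow> u < 1 \<Longrightarrow> (\<lambda>x. X m x u) \<in> borel_measurable noise"
  by (rule past_measurable_noise[OF past_X[of u 1 0]]) simp_all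

section \<open>The martingale property at dyadic and at real times\<close>

lemma integrable_bounded_mult:
  assumes A: "A \<in> sets noise" and f: "f \<in> borel_measurable noise" and B: "\<And>x. \<bar>f x\<bar> \<le> B"
  shows "integrable noise (\<lambda>x. indicator A x * f x :: real)"
proof (rule noise.integrable_const_bound[of _ "max B 0"])
  have "\<bar>indicator A x * f x\<bar> \<le> max B 0" for x using B[of x] by (auto simp: indicator_def)
  then show "AE x in noise. norm (indicator A x * f x) \<le> max B 0" by simp
  show "(\<lambda>x. indicator A x * f x) \<in> borel_measurable noise" using A f by measurable
qed

text \<open>Two stages of conditioning: averaging over the digits after the \<open>m\<close>-th
  replaces \<open>g (V x)\<close> by its conditional expectation at time \<open>m + 1\<close>, and
  the martingale property of \<open>gate\<close> leads back to the dyadic time inside the unit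
  interval.\<close>

lemma integral_dyadic:
  assumes A: "A \<in> sets (past m n k)" and k: "k < 2 ^ n"
  shows "(\<integral>x. indicator A x * g (V x) \<partial>noise) = (\<integral>x. indicator A x * X m x (real k / 2 ^ n) \<partial>noise)"
proof -
  have kle: "k \<le> 2 ^ n" using k by simp
  have AN: "A \<in> sets noise" and AS: "A \<in> sets (past (Suc m) 0 0)"
    using A past_subset[of m n k] past_next[OF kle, of m] by blast+
  have iV: "integrable noise (\<lambda>x. indicator A x * g (V x))"
    using integrable_mult_indicator[OF AN integrable_gV] by simp
  have "(\<integral>x. indicator A x * g (V x) \<partial>noise) = (\<integral>x. indicator A x * val (Suc m) x \<partial>noise)"
    unfolding val_def by (rule integral_V_past[OF _ g_meas iV]) (use AS in measurable)
  also have "\<dots> = (\<integral>x. indicator A x * lower m x + (indicator A x * (upper m x - lower m x)) * gate m (threshold m) x 1 \<partial>noise)"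
    unfolding X_1[symmetric] X_def by (simp add: algebra_simps)
  finally have E0: "(\<integral>x. indicator A x * g (V x) \<partial>noise) = (\<integral>x. indicator A x * lower m x + (indicator A x * (upper m x - lower m x)) * gate m (threshold m) x 1 \<partial>noise)" .
  have E1: "(\<integral>x. indicator A x * lower m x + (indicator A x * (upper m x - lower m x)) * gate m (threshold m) x 1 \<partial>noise) = (\<integral>x. indicator A x * lower m x \<partial>noise) + (\<integral>x. (indicator A x * (upper m x - lower m x)) * gate m (threshold m) x 1 \<partial>noise)"
    and E2: "(\<integral>x. indicator A x * lower m x \<partial>noise) + (\<integral>x. (indicator A x * (upper m x - lower m x)) * gate m (threshold m) x (real k / 2 ^ n) \<partial>noise)
      = (\<integral>x. indicator A x * lower m x + (indicator A x * (upper m x - lower m x)) * gate m (threshold m) x (real k / 2 ^ n) \<partial>noise)"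
    and E3: "(\<integral>x. (indicator A x * (upper m x - lower m x)) * gate m (threshold m) x 1 \<partial>noise) = (\<integral>x. (indicator A x * (upper m x - lower m x)) * gate m (threshold m) x (real k / 2 ^ n) \<partial>noise)"
  proof -
    obtain B where B: "\<And>x. \<bar>upper m x\<bar> \<le> B" "\<And>x. \<bar>lower m x\<bar> \<le> B" using upper_lower_bounded by blast
    have ud: "upper m \<in> borel_measurable (past m n k)" "lower m \<in> borel_measurable (past m n k)"
      by (rule measurable_upper_lower; rule past_digit; assumption)+
    note udn = past_measurable_noise[OF ud(1)] past_measurable_noise[OF ud(2)]
    have d: "real k / 2 ^ n < 1" using k by (metis divide_less_eq_1_pos of_nat_less_iff of_nat_numeral of_nat_power zero_less_numeral zero_less_power)
    have diff: "\<bar>upper m x - lower m x\<bar> \<le> B + B" for x using B(1)[of x] B(2)[of x] by linarith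
    have gm: "(\<lambda>x. gate m (threshold m) x (real k / 2 ^ n)) \<in> borel_measurable noise"
      by (rule past_measurable_noise[OF past_gate[of _ k n]]) (use d kle in simp_all)
    have gm1: "(\<lambda>x. gate m (threshold m) x 1) \<in> borel_measurable noise"
      unfolding gate_1 using pred_D[of m] unfolding digit_def by measurable
    have bd: "\<bar>(upper m x - lower m x) * gate m (threshold m) x s\<bar> \<le> B + B" for x s
    proof -
      have "\<bar>(upper m x - lower m x) * gate m (threshold m) x s\<bar> \<le> \<bar>upper m x - lower m x\<bar> * 1"
        unfolding abs_mult using gate_bounds[of m "threshold m" x s] by (intro mult_left_mono) simp_all
      then show ?thesis using diff[of x] by simp
    qed
    have i1: "integrable noise (\<lambda>x. indicator A x * lower m x)" by (rule integrable_bounded_mult[OF AN udn(2) B(2)])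
    have i2: "integrable noise (\<lambda>x. (indicator A x * (upper m x - lower m x)) * gate m (threshold m) x s)"
      if "(\<lambda>x. gate m (threshold m) x s) \<in> borel_measurable noise" for s
      unfolding mult.assoc by (rule integrable_bounded_mult[OF AN _ bd]) (intro borel_measurable_times borel_measurable_diff udn that)
    show "(\<integral>x. indicator A x * lower m x + (indicator A x * (upper m x - lower m x)) * gate m (threshold m) x 1 \<partial>noise) = (\<integral>x. indicator A x * lower m x \<partial>noise) + (\<integral>x. (indicator A x * (upper m x - lower m x)) * gate m (threshold m) x 1 \<partial>noise)"
      by (rule Bochner_Integration.integral_add[OF i1 i2[OF gm1]])
    show "(\<integral>x. indicator A x * lower m x \<partial>noise) + (\<integral>x. (indicator A x * (upper m x - lower m x)) * gate m (threshold m) x (real k / 2 ^ n) \<partial>noise)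
      = (\<integral>x. indicator A x * lower m x + (indicator A x * (upper m x - lower m x)) * gate m (threshold m) x (real k / 2 ^ n) \<partial>noise)"
      by (rule Bochner_Integration.integral_add[OF i1 i2[OF gm], symmetric])
    show "(\<integral>x. (indicator A x * (upper m x - lower m x)) * gate m (threshold m) x 1 \<partial>noise) = (\<integral>x. (indicator A x * (upper m x - lower m x)) * gate m (threshold m) x (real k / 2 ^ n) \<partial>noise)"
    proof (rule integral_gate[OF _ _ k])
      show "(\<lambda>x. indicator A x * (upper m x - lower m x)) \<in> borel_measurable (past m n k)"
        by (intro borel_measurable_times borel_measurable_diff ud borel_measurable_indicator A)
      show "\<bar>indicator A x * (upper m x - lower m x)\<bar> \<le> B + B" for x
        using diff[of x] B(1)[of x] by (auto simp: indicator_def)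
    qed
  qed
  show ?thesis unfolding E0 E1 E3 E2
    by (rule Bochner_Integration.integral_cong[OF refl]) (simp add: X_def algebra_simps)
qed

text \<open>The approximation is from above, so that an event known at time \<open>s\<close> belongs
  to the past of every \<open>k n / 2 ^ n\<close>.\<close>

lemma dyadic_approx:
  fixes s :: real
  assumes s: "0 \<le> s" "s < 1"
  defines "k \<equiv> \<lambda>n. Suc (nat \<lfloor>s * 2 ^ n\<rfloor>)"
  shows "s \<le> real (k n) / 2 ^ n" "(\<lambda>n. real (k n) / 2 ^ n) \<longlonglongrightarrow> s" "\<forall>\<^sub>F n in sequentially. k n < 2 ^ n"
proof -
  have nn: "0 \<le> \<lfloor>s * 2 ^ n\<rfloor>" for n using s by simp
  have rk: "real (k n) = of_int \<lfloor>s * 2 ^ n\<rfloor> + 1" for n unfolding k_def using nn[of n] by simp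
  have "s * 2 ^ n \<le> real (k n)" for n unfolding rk by linarith
  then show pi_low: "s \<le> real (k n) / 2 ^ n" for n by (simp add: field_simps)
  have "real (k n) \<le> s * 2 ^ n + 1" for n unfolding rk by linarith
  then have hi: "real (k n) / 2 ^ n \<le> s + (1 / 2) ^ n" for n by (simp add: field_simps power_one_over)
  have "(\<lambda>n. s + (1 / 2) ^ n) \<longlonglongrightarrow> s + 0" by (intro tendsto_add tendsto_const LIMSEQ_power_zero) simp
  then have l: "(\<lambda>n. s + (1 / 2) ^ n) \<longlonglongrightarrow> s" by simp
  show lim: "(\<lambda>n. real (k n) / 2 ^ n) \<longlonglongrightarrow> s"
    by (rule tendsto_sandwich[OF _ _ tendsto_const l]) (simp_all add: pi_low hi)
  show "\<forall>\<^sub>F n in sequentially. k n < 2 ^ n"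
    using order_tendstoD(2)[OF lim s(2)]
  proof eventually_elim
    case (elim n)
    then have "real (k n) < real (2 ^ n)" by (simp add: field_simps)
    then show ?case by (simp only: of_nat_less_iff)
  qed
qed

text \<open>Continuity in time and boundedness of \<open>X m\<close> carry the dyadic identity to
  \<open>s\<close>. The event is required to be in the past only up to a null set, because the
  filtration lives on \<open>good_paths\<close>, a set fixed without regard to the past.\<close>

lemma integral_real_time:
  assumes s: "0 \<le> s" "s < 1" and A: "A \<in> sets noise"
    and past: "\<And>n k. k < 2 ^ n \<Longrightarrow> s \<le> real k / 2 ^ n \<Longrightarrow> \<exists>A'\<in>sets (past m n k). AE x in noise. x \<in> A' \<longleftrightarrow> x \<in> A"
  shows "(\<integral>x. indicator A x * g (V x) \<partial>noise) = (\<integral>x. indicator A x * X m x s \<partial>noise)"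
proof -
  define k where "k n = Suc (nat \<lfloor>s * 2 ^ n\<rfloor>)" for n
  note k = dyadic_approx[OF s, folded k_def]
  obtain B where B: "\<And>x u. \<bar>X m x u\<bar> \<le> B" using X_bounded by blast
  have eq: "(\<integral>x. indicator A x * g (V x) \<partial>noise) = (\<integral>x. indicator A x * X m x (real (k n) / 2 ^ n) \<partial>noise)" if kn: "k n < 2 ^ n" for n
  proof -
    obtain A' where A': "A' \<in> sets (past m n (k n))" "AE x in noise. x \<in> A' \<longleftrightarrow> x \<in> A" using past[OF kn k(1)] by blast
    have A'N: "A' \<in> sets noise" using A'(1) past_subset by blast
    have d: "real (k n) / 2 ^ n < 1" using kn by (metis divide_less_eq_1_pos of_nat_less_iff of_nat_numeral of_nat_power zero_less_numeral zero_less_power)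
    have Xm: "(\<lambda>x. X m x (real (k n) / 2 ^ n)) \<in> borel_measurable noise" by (rule measurable_X_noise) (use d in simp_all)
    have gV: "(\<lambda>x. g (V x)) \<in> borel_measurable noise" using integrable_gV by (rule borel_measurable_integrable)
    have "(\<integral>x. indicator A x * g (V x) \<partial>noise) = (\<integral>x. indicator A' x * g (V x) \<partial>noise)"
    proof (rule integral_cong_AE)
      show "AE x in noise. indicator A x * g (V x) = indicator A' x * g (V x)" using A'(2) by eventually_elim (simp add: indicator_def)
    qed (use A A'N gV in measurable)
    also have "\<dots> = (\<integral>x. indicator A' x * X m x (real (k n) / 2 ^ n) \<partial>noise)" by (rule integral_dyadic[OF A'(1) kn])
    also have "\<dots> = (\<integral>x. indicator A x * X m x (real (k n) / 2 ^ n) \<partial>noise)"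
    proof (rule integral_cong_AE)
      show "AE x in noise. indicator A' x * X m x (real (k n) / 2 ^ n) = indicator A x * X m x (real (k n) / 2 ^ n)" using A'(2) by eventually_elim (simp add: indicator_def)
    qed (use A A'N Xm in measurable)
    finally show ?thesis .
  qed
  have ev1: "\<forall>\<^sub>F n in sequentially. real (k n) / 2 ^ n < 1" by (rule order_tendstoD(2)[OF k(2) s(2)])
  \<comment> \<open>The dyadic times can reach or exceed 1 for small \<open>n\<close>, where
    measurability of \<open>X\<close> is not at hand. The cap lies strictly between \<open>s\<close>
    and 1 and is inactive for large \<open>n\<close>.\<close>
  define c where "c n = min (real (k n) / 2 ^ n) ((s + 1) / 2)" for n
  have c: "0 \<le> c n" "c n < 1" for n using s by (auto simp: c_def min_less_iff_disj)
  have cs: "s \<le> c n" for n using k(1)[of n] s by (auto simp: c_def)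
  have "s < (s + 1) / 2" using s by simp
  from order_tendstoD(2)[OF k(2) this] have evc: "\<forall>\<^sub>F n in sequentially. c n = real (k n) / 2 ^ n"
    by eventually_elim (simp add: c_def)
  have cl: "c \<longlonglongrightarrow> s" using k(2) evc by (simp add: tendsto_cong)
  have Xc: "(\<lambda>x. X m x (c n)) \<in> borel_measurable noise" for n by (rule measurable_X_noise[OF c])
  have Xs: "(\<lambda>x. X m x s) \<in> borel_measurable noise" by (rule measurable_X_noise[OF s])
  have "(\<lambda>n. \<integral>x. indicator A x * X m x (c n) \<partial>noise) \<longlonglongrightarrow> (\<integral>x. indicator A x * X m x s \<partial>noise)"
  proof (rule integral_dominated_convergence[where w="\<lambda>_. max B 0"])
    show "(\<lambda>x. indicator A x * X m x s) \<in> borel_measurable noise" using A Xs by measurable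
    show "(\<lambda>x. indicator A x * X m x (c n)) \<in> borel_measurable noise" for n using A Xc by measurable
    show "AE x in noise. (\<lambda>n. indicator A x * X m x (c n)) \<longlonglongrightarrow> indicator A x * X m x s"
      using AE_good
    proof eventually_elim
      case (elim x)
      have "(\<lambda>n. X m x (c n)) \<longlonglongrightarrow> X m x s"
        by (rule continuous_on_tendsto_compose[OF X_continuous[OF elim] cl]) (use s c in \<open>auto intro!: always_eventually less_imp_le\<close>)
      then show ?case by (intro tendsto_mult tendsto_const)
    qed
    show "AE x in noise. norm (indicator A x * X m x (c n)) \<le> max B 0" for n
    proof (rule AE_I2)
      fix x show "norm (indicator A x * X m x (c n)) \<le> max B 0" using B[of x "c n"] by (auto simp: indicator_def)
    qed
  qed simp
  moreover have "\<forall>\<^sub>F n in sequentially. (\<integral>x. indicator A x * X m x (c n) \<partial>noise) = (\<integral>x. indicator A x * g (V x) \<partial>noise)"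
    using k(3) evc by eventually_elim (simp add: eq)
  ultimately have "(\<lambda>n. \<integral>x. indicator A x * g (V x) \<partial>noise) \<longlonglongrightarrow> (\<integral>x. indicator A x * X m x s \<partial>noise)"
    by (rule Lim_transform_eventually)
  then show ?thesis by (rule LIMSEQ_unique[OF tendsto_const])
qed

end

section \<open>Uniform integrability of conditional expectations of one variable\<close>

lemma uniformly_integrable_closed:
  fixes M :: "'i \<Rightarrow> 'a \<Rightarrow> real" and X :: "'a \<Rightarrow> real"
  assumes "prob_space P" and M: "\<And>i. integrable P (M i)" and X: "integrable P X"
    and cl: "\<And>i B. B \<in> sets borel \<Longrightarrow> (\<integral>\<omega>. X \<omega> * of_bool (M i \<omega> \<in> B) \<partial>P) = (\<integral>\<omega>. M i \<omega> * of_bool (M i \<omega> \<in> B) \<partial>P)"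
  shows "uniformly_integrable P UNIV M"
proof -
  interpret prob_space P by fact
  have Mm[measurable]: "M i \<in> borel_measurable P" for i using M by (rule borel_measurable_integrable)
  have Xm[measurable]: "X \<in> borel_measurable P" using X by (rule borel_measurable_integrable)
  have ib: "integrable P (\<lambda>\<omega>. f \<omega> * of_bool (Q \<omega>))" if "integrable P f" "Measurable.pred P Q" for f :: "'a \<Rightarrow> real" and Q
    by (rule Bochner_Integration.integrable_bound[OF that(1)]) (use that in auto)
  let ?E = "\<integral>\<omega>. \<bar>X \<omega>\<bar> \<partial>P"
  have iX: "integrable P (\<lambda>\<omega>. \<bar>X \<omega>\<bar>)" by (rule integrable_abs[OF X])
  have iM: "integrable P (\<lambda>\<omega>. \<bar>M i \<omega>\<bar>)" for i by (rule integrable_abs[OF M])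
  \<comment> \<open>The sign of \<open>M i\<close> splits the event into two that are determined by
    \<open>M i\<close>, and on each of them \<open>X\<close> may be substituted.\<close>
  have step: "(\<integral>\<omega>. \<bar>M i \<omega>\<bar> * of_bool (c < \<bar>M i \<omega>\<bar>) \<partial>P) \<le> (\<integral>\<omega>. \<bar>X \<omega>\<bar> * of_bool (c < \<bar>M i \<omega>\<bar>) \<partial>P)" if "0 < c" for c i
  proof -
    let ?p = "\<lambda>\<omega>. of_bool (M i \<omega> \<in> {c<..}) :: real" and ?n = "\<lambda>\<omega>. of_bool (M i \<omega> \<in> {..<-c}) :: real"
    have i: "integrable P (\<lambda>\<omega>. Y \<omega> * ?p \<omega>)" "integrable P (\<lambda>\<omega>. Y \<omega> * ?n \<omega>)" if "integrable P Y" for Y :: "'a \<Rightarrow> real"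
      by (rule ib[OF that]; measurable)+
    have "(\<integral>\<omega>. \<bar>M i \<omega>\<bar> * of_bool (c < \<bar>M i \<omega>\<bar>) \<partial>P) = (\<integral>\<omega>. M i \<omega> * ?p \<omega> - M i \<omega> * ?n \<omega> \<partial>P)"
      by (rule Bochner_Integration.integral_cong[OF refl]) (use that in \<open>auto simp: abs_if\<close>)
    also have "\<dots> = (\<integral>\<omega>. M i \<omega> * ?p \<omega> \<partial>P) - (\<integral>\<omega>. M i \<omega> * ?n \<omega> \<partial>P)"
      by (rule Bochner_Integration.integral_diff[OF i(1)[OF M] i(2)[OF M]])
    also have "\<dots> = (\<integral>\<omega>. X \<omega> * ?p \<omega> \<partial>P) - (\<integral>\<omega>. X \<omega> * ?n \<omega> \<partial>P)"
      by (subst (1 2) cl) simp_all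
    also have "\<dots> = (\<integral>\<omega>. X \<omega> * ?p \<omega> - X \<omega> * ?n \<omega> \<partial>P)"
      by (rule Bochner_Integration.integral_diff[OF i(1)[OF X] i(2)[OF X], symmetric])
    also have "\<dots> \<le> (\<integral>\<omega>. \<bar>X \<omega>\<bar> * of_bool (c < \<bar>M i \<omega>\<bar>) \<partial>P)"
    proof (rule integral_mono[OF Bochner_Integration.integrable_diff[OF i(1)[OF X] i(2)[OF X]]])
      show "integrable P (\<lambda>\<omega>. \<bar>X \<omega>\<bar> * of_bool (c < \<bar>M i \<omega>\<bar>))" by (rule ib[OF iX]) measurable
      show "X \<omega> * ?p \<omega> - X \<omega> * ?n \<omega> \<le> \<bar>X \<omega>\<bar> * of_bool (c < \<bar>M i \<omega>\<bar>)" for \<omega>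
        using that by (auto simp: abs_if)
    qed
    finally show ?thesis .
  qed
  have prob: "measure P {\<omega>\<in>space P. c < \<bar>M i \<omega>\<bar>} \<le> ?E / c" if "0 < c" for c i
  proof -
    have s: "{\<omega>\<in>space P. c < \<bar>M i \<omega>\<bar>} \<in> sets P" by measurable
    have "c * measure P {\<omega>\<in>space P. c < \<bar>M i \<omega>\<bar>} = (\<integral>\<omega>. c * indicator {\<omega>\<in>space P. c < \<bar>M i \<omega>\<bar>} \<omega> \<partial>P)" using s by simp
    also have "\<dots> \<le> (\<integral>\<omega>. \<bar>M i \<omega>\<bar> * of_bool (c < \<bar>M i \<omega>\<bar>) \<partial>P)"
    proof (rule integral_mono)
      show "integrable P (\<lambda>\<omega>. c * indicator {\<omega>\<in>space P. c < \<bar>M i \<omega>\<bar>} \<omega>)"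
        by (intro integrable_mult_right integrable_real_indicator s) (simp add: emeasure_eq_measure)
      show "integrable P (\<lambda>\<omega>. \<bar>M i \<omega>\<bar> * of_bool (c < \<bar>M i \<omega>\<bar>))" by (rule ib[OF iM]) measurable
    qed (simp add: indicator_def)
    also have "\<dots> \<le> (\<integral>\<omega>. \<bar>X \<omega>\<bar> * of_bool (c < \<bar>M i \<omega>\<bar>) \<partial>P)" by (rule step[OF that])
    also have "\<dots> \<le> ?E"
    proof (rule integral_mono[OF _ iX])
      show "integrable P (\<lambda>\<omega>. \<bar>X \<omega>\<bar> * of_bool (c < \<bar>M i \<omega>\<bar>))" by (rule ib[OF iX]) measurable
    qed simp
    finally show ?thesis using that by (simp add: field_simps)
  qed
  \<comment> \<open>A bound free of \<open>i\<close>: on the event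
    \<open>c < \<bar>M i \<omega>\<bar>\<close>, whose probability is at most \<open>?E / c\<close>,
    the variable \<open>\<bar>X \<omega>\<bar>\<close> is cut at \<open>sqrt c\<close>. The part
    below contributes at most \<open>sqrt c * (?E / c)\<close>, the part above does not involve
    \<open>i\<close>.\<close>
  define h where "h c = (\<integral>\<omega>. \<bar>X \<omega>\<bar> * of_bool (sqrt c < \<bar>X \<omega>\<bar>) \<partial>P) + ?E / sqrt c" for c
  have bound: "(\<integral>\<^sup>+\<omega>. ennreal \<bar>M i \<omega>\<bar> * indicator {\<omega>. c < \<bar>M i \<omega>\<bar>} \<omega> \<partial>P) \<le> ennreal (h c)" if c: "0 < c" for i c
  proof -
    have s: "{\<omega>\<in>space P. c < \<bar>M i \<omega>\<bar>} \<in> sets P" by measurable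
    have "(\<integral>\<^sup>+\<omega>. ennreal \<bar>M i \<omega>\<bar> * indicator {\<omega>. c < \<bar>M i \<omega>\<bar>} \<omega> \<partial>P) = (\<integral>\<^sup>+\<omega>. ennreal (\<bar>M i \<omega>\<bar> * of_bool (c < \<bar>M i \<omega>\<bar>)) \<partial>P)"
      by (rule nn_integral_cong) (simp add: indicator_def)
    also have "\<dots> = ennreal (\<integral>\<omega>. \<bar>M i \<omega>\<bar> * of_bool (c < \<bar>M i \<omega>\<bar>) \<partial>P)"
    proof (rule nn_integral_eq_integral)
      show "integrable P (\<lambda>\<omega>. \<bar>M i \<omega>\<bar> * of_bool (c < \<bar>M i \<omega>\<bar>))" by (rule ib[OF iM]) measurable
    qed simp
    also have "\<dots> \<le> ennreal (h c)"
    proof (rule ennreal_leI)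
      have "(\<integral>\<omega>. \<bar>M i \<omega>\<bar> * of_bool (c < \<bar>M i \<omega>\<bar>) \<partial>P) \<le> (\<integral>\<omega>. \<bar>X \<omega>\<bar> * of_bool (c < \<bar>M i \<omega>\<bar>) \<partial>P)" by (rule step[OF c])
      also have "\<dots> \<le> (\<integral>\<omega>. \<bar>X \<omega>\<bar> * of_bool (sqrt c < \<bar>X \<omega>\<bar>) + sqrt c * indicator {\<omega>\<in>space P. c < \<bar>M i \<omega>\<bar>} \<omega> \<partial>P)"
      proof (rule integral_mono)
        show "integrable P (\<lambda>\<omega>. \<bar>X \<omega>\<bar> * of_bool (c < \<bar>M i \<omega>\<bar>))" by (rule ib[OF iX]) measurable
        show "integrable P (\<lambda>\<omega>. \<bar>X \<omega>\<bar> * of_bool (sqrt c < \<bar>X \<omega>\<bar>) + sqrt c * indicator {\<omega>\<in>space P. c < \<bar>M i \<omega>\<bar>} \<omega>)"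
          by (intro Bochner_Integration.integrable_add ib[OF iX] integrable_mult_right integrable_real_indicator s) (measurable, simp add: emeasure_eq_measure)
        show "\<bar>X \<omega>\<bar> * of_bool (c < \<bar>M i \<omega>\<bar>) \<le> \<bar>X \<omega>\<bar> * of_bool (sqrt c < \<bar>X \<omega>\<bar>) + sqrt c * indicator {\<omega>\<in>space P. c < \<bar>M i \<omega>\<bar>} \<omega>"
          if "\<omega> \<in> space P" for \<omega>
          using that c by (cases "c < \<bar>M i \<omega>\<bar>"; cases "sqrt c < \<bar>X \<omega>\<bar>") (simp_all add: indicator_def)
      qed
      also have "\<dots> = (\<integral>\<omega>. \<bar>X \<omega>\<bar> * of_bool (sqrt c < \<bar>X \<omega>\<bar>) \<partial>P) + sqrt c * measure P {\<omega>\<in>space P. c < \<bar>M i \<omega>\<bar>}"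
      proof (subst Bochner_Integration.integral_add)
        show "integrable P (\<lambda>\<omega>. \<bar>X \<omega>\<bar> * of_bool (sqrt c < \<bar>X \<omega>\<bar>))" by (rule ib[OF iX]) measurable
        show "integrable P (\<lambda>\<omega>. sqrt c * indicator {\<omega>\<in>space P. c < \<bar>M i \<omega>\<bar>} \<omega>)"
          by (intro integrable_mult_right integrable_real_indicator s) (simp add: emeasure_eq_measure)
      qed (use s in simp)
      also have "\<dots> \<le> h c"
      proof -
        have "sqrt c * measure P {\<omega>\<in>space P. c < \<bar>M i \<omega>\<bar>} \<le> sqrt c * (?E / c)" using c by (intro mult_left_mono prob) simp_all
        also have "\<dots> = ?E / sqrt c"
        proof -
          have "c = sqrt c * sqrt c" using c by simp
          then show ?thesis using c by (metis (no_types, lifting) mult.commute nonzero_mult_divide_mult_cancel_right real_sqrt_eq_zero_cancel_iff order_less_irrefl times_divide_eq_right)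
        qed
        finally show ?thesis unfolding h_def by simp
      qed
      finally show "(\<integral>\<omega>. \<bar>M i \<omega>\<bar> * of_bool (c < \<bar>M i \<omega>\<bar>) \<partial>P) \<le> h c" .
    qed
    finally show ?thesis .
  qed
  have hlim: "(h \<longlongrightarrow> 0) at_top"
  proof -
    have sq: "filterlim sqrt at_top at_top" by (rule sqrt_at_top)
    have "((\<lambda>c. \<integral>\<omega>. \<bar>X \<omega>\<bar> * of_bool (sqrt c < \<bar>X \<omega>\<bar>) \<partial>P) \<longlongrightarrow> (\<integral>\<omega>. 0 \<partial>P)) at_top"
    proof (rule integral_dominated_convergence_at_top[where w="\<lambda>\<omega>. \<bar>X \<omega>\<bar>"])
      show "AE \<omega> in P. ((\<lambda>c. \<bar>X \<omega>\<bar> * of_bool (sqrt c < \<bar>X \<omega>\<bar>)) \<longlongrightarrow> 0) at_top"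
      proof (rule AE_I2)
        fix \<omega>
        have "eventually (\<lambda>c. \<bar>X \<omega>\<bar> \<le> sqrt c) at_top" using sq unfolding filterlim_at_top by blast
        then have "eventually (\<lambda>c. \<bar>X \<omega>\<bar> * of_bool (sqrt c < \<bar>X \<omega>\<bar>) = 0) at_top" by eventually_elim simp
        then show "((\<lambda>c. \<bar>X \<omega>\<bar> * of_bool (sqrt c < \<bar>X \<omega>\<bar>)) \<longlongrightarrow> 0) at_top" by (rule tendsto_eventually)
      qed
      show "\<forall>\<^sub>F c in at_top. AE \<omega> in P. norm (\<bar>X \<omega>\<bar> * of_bool (sqrt c < \<bar>X \<omega>\<bar>)) \<le> \<bar>X \<omega>\<bar>" by simp
    qed (use iX in simp_all)
    moreover have "((\<lambda>c. ?E / sqrt c) \<longlongrightarrow> 0) at_top"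
      by (rule real_tendsto_divide_at_top[OF tendsto_const sq])
    ultimately have "(h \<longlongrightarrow> (\<integral>\<omega>. 0 \<partial>P) + 0) at_top" unfolding h_def by (rule tendsto_add)
    then show ?thesis by simp
  qed
  show ?thesis unfolding uniformly_integrable_def
  proof (intro conjI ballI Mm)
    have "((\<lambda>c. ennreal (h c)) \<longlongrightarrow> ennreal 0) at_top" by (rule tendsto_ennrealI[OF hlim])
    then have hl: "((\<lambda>c. ennreal (h c)) \<longlongrightarrow> 0) at_top" by simp
    show "((\<lambda>c::real. SUP i\<in>UNIV. \<integral>\<^sup>+\<omega>. ennreal \<bar>M i \<omega>\<bar> * indicator {\<omega>. c < \<bar>M i \<omega>\<bar>} \<omega> \<partial>P) \<longlongrightarrow> 0) at_top"
    proof (rule tendsto_sandwich[OF _ _ tendsto_const hl])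
      show "\<forall>\<^sub>F c in at_top. (SUP i\<in>UNIV. \<integral>\<^sup>+\<omega>. ennreal \<bar>M i \<omega>\<bar> * indicator {\<omega>. c < \<bar>M i \<omega>\<bar>} \<omega> \<partial>P) \<le> ennreal (h c)"
        using eventually_gt_at_top[of "0::real"] by eventually_elim (rule SUP_least, rule bound)
    qed simp
  qed
qed

section \<open>The martingale on the closed time axis\<close>

locale centred_embedding = embedding +
  assumes g_mean: "(LINT u:{0<..<1}|lborel. g u) = 0"
begin

definition R :: "path \<Rightarrow> real \<Rightarrow> real" where
  "R x r = X (nat \<lfloor>r\<rfloor>) x (r - real (nat \<lfloor>r\<rfloor>))"

definition path_mart :: "ennreal \<Rightarrow> path \<Rightarrow> real" where
  "path_mart t x = (if t = \<top> then g (V x) else R x (enn2real t))"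

text \<open>Paths have to be continuous everywhere on the space, not just almost surely, so the
  space is restricted. An almost sure statement provides a measurable set inside
  \<open>good\<close>, and one such set is fixed.\<close>

definition good_paths :: "path set" where "good_paths = (SOME S. S \<in> sets noise \<and> - S \<in> null_sets noise \<and> (\<forall>x\<in>S. good x))"

lemma good_paths: "good_paths \<in> sets noise" "- good_paths \<in> null_sets noise" "x \<in> good_paths \<Longrightarrow> good x"
proof -
  obtain N where N: "{x \<in> space noise. \<not> good x} \<subseteq> N" "emeasure noise N = 0" "N \<in> sets noise"
    using AE_good by (rule AE_E)
  have "- N \<in> sets noise \<and> - (- N) \<in> null_sets noise \<and> (\<forall>x\<in>- N. good x)"
  proof -
    have "- N \<in> sets noise" using sets.compl_sets[OF N(3)] by (simp add: Compl_eq_Diff_UNIV)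
    then show ?thesis using N by (auto simp: null_sets_def)
  qed
  then have "good_paths \<in> sets noise \<and> - good_paths \<in> null_sets noise \<and> (\<forall>x\<in>good_paths. good x)" unfolding good_paths_def by (rule someI)
  then show "good_paths \<in> sets noise" "- good_paths \<in> null_sets noise" "x \<in> good_paths \<Longrightarrow> good x" by auto
qed

lemma AE_good_paths: "AE x in noise. x \<in> good_paths"
  using AE_not_in[OF good_paths(2)] by simp

definition path_prob :: "path measure" where "path_prob = restrict_space noise good_paths"

text \<open>The natural filtration of the martingale. The larger sigma-algebras \<open>past\<close>,
  which are indexed by dyadic times, serve only to verify the martingale property.\<close>

definition path_filtration :: "ennreal \<Rightarrow> path measure" where
  "path_filtration t = sigma good_paths {path_mart u -` B \<inter> good_paths | u B. u \<le> t \<and> B \<in> sets borel}"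

lemma space_path_prob: "space path_prob = good_paths" by (simp add: path_prob_def space_restrict_space)

lemma good_paths_space: "good_paths \<inter> space noise \<in> sets noise" using good_paths(1) by simp

lemma integral_path_prob:
  fixes f :: "path \<Rightarrow> real"
  assumes "f \<in> borel_measurable noise" shows "(\<integral>x. f x \<partial>path_prob) = (\<integral>x. f x \<partial>noise)"
  unfolding path_prob_def integral_restrict_space[OF good_paths_space]
proof (rule integral_cong_AE)
  show "AE x in noise. indicat_real good_paths x *\<^sub>R f x = f x" using AE_good_paths by eventually_elim simp
qed (use assms good_paths(1) in \<open>auto intro!: borel_measurable_times\<close>)

lemma integrable_path_prob:
  fixes f :: "path \<Rightarrow> real"
  assumes "integrable noise f" shows "integrable path_prob f"
  unfolding path_prob_def integrable_restrict_space[OF good_paths_space] by (rule integrable_mult_indicator[OF good_paths(1) assms])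

lemma prob_space_path_prob: "prob_space path_prob"
proof
  have "emeasure noise good_paths = emeasure noise (space noise)"
    by (rule emeasure_eq_AE) (use AE_good_paths good_paths(1) sets.top[of noise] in \<open>auto elim: eventually_mono\<close>)
  then show "emeasure path_prob (space path_prob) = 1"
    unfolding space_path_prob by (simp add: path_prob_def emeasure_restrict_space[OF good_paths_space] noise.emeasure_space_1[simplified])
qed

lemma R_eq:
  assumes "real m \<le> r" "r < real m + 1" shows "R x r = X m x (r - real m)"
proof -
  have "\<lfloor>r\<rfloor> = int m" by (rule floor_unique) (use assms in simp_all)
  then have "nat \<lfloor>r\<rfloor> = m" by simp
  then show ?thesis by (simp add: R_def)
qed

text \<open>Including the right end point makes the pieces overlap, so that continuity can be glued:
  there one segment ends at the value with which the next one begins.\<close>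

lemma R_eq':
  assumes "real m \<le> r" "r \<le> real m + 1" shows "R x r = X m x (r - real m)"
proof (cases "r = real m + 1")
  case True
  then have "R x r = X (Suc m) x (r - real (Suc m))" by (intro R_eq) simp_all
  then show ?thesis using True by (simp add: X_0 X_1)
qed (use assms in \<open>auto intro!: R_eq\<close>)

lemma R_continuous: assumes "good x" shows "continuous_on {0..} (R x)"
proof -
  have seg: "continuous_on {real N..real N + 1} (R x)" for N
  proof -
    have "continuous_on {real N..real N + 1} (\<lambda>r. X N x (r - real N))"
      by (rule continuous_on_compose2[OF X_continuous[OF assms]]) (auto intro!: continuous_intros)
    then show ?thesis by (rule continuous_on_eq) (auto intro!: R_eq'[symmetric])
  qed
  have fin: "continuous_on {0..real N} (R x)" for N
  proof (induction N)
    case (Suc N)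
    have "{0..real (Suc N)} = {0..real N} \<union> {real N..real N + 1}" by auto
    then show ?case using continuous_on_closed_Un[OF _ _ Suc seg[of N]] by simp
  qed simp
  show ?thesis unfolding continuous_on_def
  proof
    fix r :: real assume r: "r \<in> {0..}"
    obtain N :: nat where N: "r < real N" using reals_Archimedean2 by blast
    have "(R x \<longlongrightarrow> R x r) (at r within {0..real N})" using fin[of N] r N unfolding continuous_on_def by simp
    moreover have "at r within {0..real N} = at r within {0..}"
      by (rule at_within_nhd[of r "{..<real N}"]) (use N in auto)
    ultimately show "(R x \<longlongrightarrow> R x r) (at r within {0..})" by simp
  qed
qed

lemma path_mart_continuous: assumes x: "good x" shows "continuous_on UNIV (\<lambda>t. path_mart t x)"
  unfolding continuous_on_def
proof
  fix t :: ennreal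
  show "((\<lambda>t. path_mart t x) \<longlongrightarrow> path_mart t x) (at t within UNIV)"
  proof (cases "t = \<top>")
    case True
    have g: "0 < V x" "V x < 1" "isCont g (V x)" using x by (auto simp: good_def)
    show ?thesis unfolding True
    proof (rule tendstoI)
      fix e :: real assume "0 < e"
      then obtain N where N: "\<And>m s. N \<le> m \<Longrightarrow> \<bar>X m x s - g (V x)\<bar> < e" using X_limit[OF g] by blast
      have "\<forall>\<^sub>F t in at \<top>. ennreal (real N) < t"
        by (rule order_tendstoD(1)[OF tendsto_ident_at]) simp
      then show "\<forall>\<^sub>F t in at \<top>. dist (path_mart t x) (path_mart \<top> x) < e"
      proof eventually_elim
        case (elim t)
        show ?case
        proof (cases "t = \<top>")
          case False
          then obtain r where r: "t = ennreal r" "0 \<le> r" by (cases t) auto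
          then have "real N < r" using elim by (simp add: ennreal_less_iff)
          then have "N \<le> nat \<lfloor>r\<rfloor>" by (simp add: le_nat_floor)
          then show ?thesis using N r by (simp add: path_mart_def R_def dist_real_def)
        qed (use \<open>0 < e\<close> in simp)
      qed
    qed
  next
    case False
    then obtain r where r: "t = ennreal r" "0 \<le> r" by (cases t) auto
    have "((\<lambda>t. t) \<longlongrightarrow> ennreal r) (at t)" unfolding r(1) by (rule tendsto_ident_at)
    then have "(enn2real \<longlongrightarrow> r) (at t)" by (rule tendsto_enn2real[OF _ r(2)])
    then have "((\<lambda>t. R x (enn2real t)) \<longlongrightarrow> R x r) (at t)"
      by (rule continuous_on_tendsto_compose[OF R_continuous[OF x]]) (use r in simp_all)
    moreover have "\<forall>\<^sub>F s in at t. s < \<top>"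
      by (rule order_tendstoD(2)[OF tendsto_ident_at]) (use False in \<open>simp add: top.not_eq_extremum\<close>)
    then have "\<forall>\<^sub>F s in at t. path_mart s x = R x (enn2real s)" by eventually_elim (auto simp: path_mart_def)
    moreover have "path_mart t x = R x r" using r by (simp add: path_mart_def)
    ultimately show ?thesis by (simp add: tendsto_cong)
  qed
qed

lemma path_mart_finite:
  assumes "t < \<top>"
  obtains m s where "0 \<le> s" "s < 1" "t = ennreal (real m + s)" "\<And>x. path_mart t x = X m x s"
proof -
  obtain r where r: "t = ennreal r" "0 \<le> r" using assms by (cases t) auto
  let ?m = "nat \<lfloor>r\<rfloor>"
  have 1: "0 \<le> r - real ?m" "r - real ?m < 1" using r(2) by (simp_all add: of_nat_nat) linarith
  show thesis
  proof (rule that[of "r - real ?m" ?m])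
    show "path_mart t x = X ?m x (r - real ?m)" for x using r by (simp add: path_mart_def R_def)
  qed (use 1 r in simp_all)
qed

lemma measurable_path_mart_noise: "path_mart t \<in> borel_measurable noise"
proof (cases "t < \<top>")
  case True
  then obtain m s where "0 \<le> s" "s < 1" "\<And>x. path_mart t x = X m x s" by (rule path_mart_finite) blast
  then show ?thesis using measurable_X_noise[of s m] by (simp cong: measurable_cong)
next
  case False
  then have "path_mart t = (\<lambda>x. g (V x))" by (simp add: path_mart_def fun_eq_iff top.not_eq_extremum)
  then show ?thesis using integrable_gV by (simp add: borel_measurable_integrable)
qed

lemma integrable_path_mart_noise: "integrable noise (path_mart t)"
proof (cases "t < \<top>")
  case True
  then obtain m s where ms: "0 \<le> s" "s < 1" "\<And>x. path_mart t x = X m x s" by (rule path_mart_finite) blast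
  obtain B where B: "\<And>x u. \<bar>X m x u\<bar> \<le> B" using X_bounded by blast
  show ?thesis by (rule noise.integrable_const_bound[of _ B]) (use ms B measurable_path_mart_noise in simp_all)
next
  case False
  then have "path_mart t = (\<lambda>x. g (V x))" by (simp add: path_mart_def fun_eq_iff top.not_eq_extremum)
  then show ?thesis using integrable_gV by simp
qed

text \<open>The whole natural filtration at time \<open>m + s\<close> has to be placed in one
  sigma-algebra, so the earlier unit intervals are needed as well as the current one.\<close>

lemma past_path_mart:
  assumes s: "0 \<le> s" "s < 1" "s \<le> real k / 2 ^ n" and k: "k \<le> 2 ^ n" and u: "u \<le> ennreal (real m + s)"
  shows "path_mart u \<in> borel_measurable (past m n k)"
proof -
  have "u < \<top>" using u by (rule le_less_trans) simp
  then obtain m' s' where ms: "0 \<le> s'" "s' < 1" "u = ennreal (real m' + s')" "\<And>x. path_mart u x = X m' x s'" by (rule path_mart_finite) blast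
  have le: "real m' + s' \<le> real m + s" using u s(1) unfolding ms(3) by (subst (asm) ennreal_le_iff) simp_all
  then have "real m' < real (Suc m)" using ms s by simp
  then have "m' \<le> m" by simp
  have "(\<lambda>x. X m' x s') \<in> borel_measurable (past m n k)"
  proof (cases "m' = m")
    case True
    then show ?thesis using past_X[of s' k n m] ms le s k by simp
  next
    case False
    then have "m' < m" using \<open>m' \<le> m\<close> by simp
    have "(\<lambda>x. X m' x s') \<in> borel_measurable (past m' 0 1)" by (rule past_X) (use ms in simp_all)
    then show ?thesis by (rule subsetD[OF measurable_mono[OF order_refl refl past_earlier[OF \<open>m' < m\<close>]], rotated]) simp_all
  qed
  then show ?thesis using ms(4) by (simp cong: measurable_cong)
qed

lemma space_path_filtration: "space (path_filtration t) = good_paths" unfolding path_filtration_def by (rule space_measure_of) auto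

lemma sets_path_filtration: "sets (path_filtration t) = sigma_sets good_paths {path_mart u -` B \<inter> good_paths | u B. u \<le> t \<and> B \<in> sets borel}"
  unfolding path_filtration_def by (rule sets_measure_of) auto

lemma sets_path_filtration_subset:
  assumes N: "\<And>u. u \<le> t \<Longrightarrow> path_mart u \<in> borel_measurable N" "space N = UNIV"
  shows "sets (path_filtration t) \<subseteq> sets (restrict_space N good_paths)"
proof -
  have sp: "space (restrict_space N good_paths) = good_paths" using N(2) by (simp add: space_restrict_space)
  have "sigma_sets (space (restrict_space N good_paths)) {path_mart u -` B \<inter> good_paths | u B. u \<le> t \<and> B \<in> sets borel} \<subseteq> sets (restrict_space N good_paths)"
  proof (rule sets.sigma_sets_subset, safe)
    fix u and B :: "real set" assume "u \<le> t" "B \<in> sets borel"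
    then have "path_mart u -` B \<inter> space N \<in> sets N" using measurable_sets[OF N(1)] by blast
    then show "path_mart u -` B \<inter> good_paths \<in> sets (restrict_space N good_paths)" using N(2) by (auto simp: sets_restrict_space)
  qed
  then show ?thesis unfolding sets_path_filtration sp .
qed

lemma sets_path_filtration_mono: "s \<le> t \<Longrightarrow> sets (path_filtration s) \<subseteq> sets (path_filtration t)"
  unfolding sets_path_filtration by (rule sigma_sets_mono') (auto intro: order_trans)

lemma filtration_path_filtration: "filtration (space path_prob) path_filtration"
  by standard (simp_all add: space_path_filtration space_path_prob sets_path_filtration_mono)

lemma subalgebra_path_filtration: "subalgebra path_prob (path_filtration t)"
  unfolding subalgebra_def space_path_filtration space_path_prob
  using sets_path_filtration_subset[of t noise] measurable_path_mart_noise by (simp add: path_prob_def)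

lemma adapted_path_filtration: "path_mart t \<in> borel_measurable (path_filtration t)"
proof (rule measurableI)
  fix B :: "real set" assume "B \<in> sets borel"
  then show "path_mart t -` B \<inter> space (path_filtration t) \<in> sets (path_filtration t)"
    unfolding space_path_filtration sets_path_filtration by (intro sigma_sets.Basic) auto
qed simp

lemma integral_path_filtration:
  assumes A: "A \<in> sets (path_filtration t)"
  shows "(\<integral>x. indicator A x * path_mart \<top> x \<partial>noise) = (\<integral>x. indicator A x * path_mart t x \<partial>noise)"
proof (cases "t < \<top>")
  case True
  then obtain m s where ms: "0 \<le> s" "s < 1" "t = ennreal (real m + s)" "\<And>x. path_mart t x = X m x s" by (rule path_mart_finite) blast
  have AN: "A \<in> sets noise"
    using A sets_path_filtration_subset[of t noise] measurable_path_mart_noise sets_restrict_space_iff[OF good_paths_space] by auto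
  have "(\<integral>x. indicator A x * g (V x) \<partial>noise) = (\<integral>x. indicator A x * X m x s \<partial>noise)"
  proof (rule integral_real_time[OF ms(1,2) AN])
    fix n k :: nat assume k: "k < 2 ^ n" "s \<le> real k / 2 ^ n"
    have "sets (path_filtration t) \<subseteq> sets (restrict_space (past m n k) good_paths)"
      by (rule sets_path_filtration_subset) (use past_path_mart[OF ms(1,2) k(2)] k(1) ms(3) in auto)
    then obtain A' where A': "A' \<in> sets (past m n k)" "A = good_paths \<inter> A'" using A by (auto simp: sets_restrict_space)
    then have "AE x in noise. x \<in> A' \<longleftrightarrow> x \<in> A" using AE_good_paths by (auto elim!: eventually_mono)
    then show "\<exists>A'\<in>sets (past m n k). AE x in noise. x \<in> A' \<longleftrightarrow> x \<in> A" using A'(1) by blast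
  qed
  then show ?thesis by (simp add: ms(4)) (simp add: path_mart_def)
next
  case False
  then have "t = \<top>" using top.not_eq_extremum by blast
  then show ?thesis by simp
qed

lemma set_integral_path_filtration:
  assumes A: "A \<in> sets (path_filtration s)" and st: "s \<le> t"
  shows "(\<integral>x\<in>A. path_mart t x \<partial>path_prob) = (\<integral>x\<in>A. path_mart s x \<partial>path_prob)"
proof -
  have AN: "A \<in> sets noise"
    using A sets_path_filtration_subset[of s noise] measurable_path_mart_noise sets_restrict_space_iff[OF good_paths_space] by auto
  have e: "(\<integral>x\<in>A. path_mart u x \<partial>path_prob) = (\<integral>x. indicator A x * path_mart u x \<partial>noise)" for u
    unfolding set_lebesgue_integral_def real_scaleR_def
    by (rule integral_path_prob) (intro borel_measurable_times borel_measurable_indicator AN measurable_path_mart_noise)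
  show ?thesis unfolding e using integral_path_filtration[OF A] integral_path_filtration[of A t] A sets_path_filtration_mono[OF st] by auto
qed

lemma calM_embedding: "calM (distr unif borel g) path_prob path_filtration path_mart"
proof -
  interpret path_prob: prob_space path_prob by (rule prob_space_path_prob)
  have int: "integrable path_prob (path_mart t)" for t by (rule integrable_path_prob[OF integrable_path_mart_noise])
  have mart: "martingale path_prob path_filtration path_mart"
    unfolding martingale_def
  proof (intro conjI allI impI adapted_path_filtration int)
    fix s t :: ennreal assume st: "s \<le> t"
    interpret finite_measure_subalgebra path_prob "path_filtration s" by unfold_locales (rule subalgebra_path_filtration)
    show "AE \<omega> in path_prob. real_cond_exp path_prob (path_filtration s) (path_mart t) \<omega> = path_mart s \<omega>"
      by (rule real_cond_exp_charact[OF set_integral_path_filtration[OF _ st] int int adapted_path_filtration])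
  qed
  have ui: "uniformly_integrable path_prob UNIV path_mart"
  proof (rule uniformly_integrable_closed[OF prob_space_path_prob int int[of \<top>]])
    fix t and B :: "real set" assume B: "B \<in> sets borel"
    have A: "path_mart t -` B \<inter> good_paths \<in> sets (path_filtration t)" using measurable_sets[OF adapted_path_filtration B] by (simp add: space_path_filtration)
    have "(\<integral>\<omega>. path_mart u \<omega> * of_bool (path_mart t \<omega> \<in> B) \<partial>path_prob) = (\<integral>x\<in>path_mart t -` B \<inter> good_paths. path_mart u x \<partial>path_prob)" for u
      unfolding set_lebesgue_integral_def by (rule Bochner_Integration.integral_cong[OF refl]) (simp add: space_path_prob indicator_def)
    then show "(\<integral>\<omega>. path_mart \<top> \<omega> * of_bool (path_mart t \<omega> \<in> B) \<partial>path_prob) = (\<integral>\<omega>. path_mart t \<omega> * of_bool (path_mart t \<omega> \<in> B) \<partial>path_prob)"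
      using set_integral_path_filtration[OF A, of \<top>] by simp
  qed
  have zero: "path_mart 0 x = 0" for x
  proof -
    have "path_mart 0 x = val 0 x" by (simp add: path_mart_def R_def X_0)
    also have "\<dots> = 0" unfolding val_def using avg_eq[OF g_meas, of 1 0] g_mean by simp
    finally show ?thesis .
  qed
  have law: "distr path_prob borel (path_mart \<infinity>) = distr unif borel g"
  proof (rule measure_eqI)
    fix B assume "B \<in> sets (distr path_prob borel (path_mart \<infinity>))"
    then have B: "B \<in> sets borel" by simp
    have m: "path_mart \<infinity> \<in> borel_measurable path_prob" using int by (rule borel_measurable_integrable)
    have sB: "path_mart \<infinity> -` B \<in> sets noise" using measurable_sets[OF measurable_path_mart_noise B] by simp
    have "emeasure (distr path_prob borel (path_mart \<infinity>)) B = emeasure path_prob (path_mart \<infinity> -` B \<inter> good_paths)"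
      by (subst emeasure_distr[OF m B]) (simp add: space_path_prob)
    also have "\<dots> = emeasure noise (path_mart \<infinity> -` B \<inter> good_paths)"
      unfolding path_prob_def by (rule emeasure_restrict_space[OF good_paths_space]) simp
    also have "\<dots> = emeasure noise (path_mart \<infinity> -` B)"
      by (rule emeasure_eq_AE) (use AE_good_paths sB good_paths(1) in \<open>auto elim: eventually_mono\<close>)
    also have "\<dots> = emeasure (distr noise borel V) (g -` B)"
    proof -
      have "g -` B \<in> sets borel" using measurable_sets[OF g_meas B] by simp
      then show ?thesis by (subst emeasure_distr[OF measurable_V]) (simp_all add: path_mart_def vimage_def)
    qed
    also have "\<dots> = emeasure (distr unif borel g) B"
      unfolding distr_V using B g_meas by (subst emeasure_distr) simp_all
    finally show "emeasure (distr path_prob borel (path_mart \<infinity>)) B = emeasure (distr unif borel g) B" .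
  qed simp
  show ?thesis unfolding calM_def
    using prob_space_path_prob filtration_path_filtration subalgebra_path_filtration mart ui law zero path_mart_continuous good_paths(3) by (simp add: space_path_prob)
qed

end

section \<open>Quantiles and barycentres\<close>

text \<open>By Lindelof's theorem a half-line that misses the support is covered by countably many
  null open sets. It follows that the maximum with \<open>left_end\<close> in the definition of
  \<open>quantile\<close> has no effect at positive levels.\<close>

lemma ereal_less_left_end:
  assumes "real_distribution \<mu>" "0 < cdf \<mu> x"
  shows "left_end \<mu> \<le> ereal x"
proof (rule ccontr)
  interpret real_distribution \<mu> by fact
  assume n: "\<not> left_end \<mu> \<le> ereal x"
  have "\<exists>U. open U \<and> y \<in> U \<and> emeasure \<mu> U = 0" if "y \<in> {..x}" for y
  proof -
    have "y \<notin> supp \<mu>"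
    proof
      assume "y \<in> supp \<mu>"
      then have "left_end \<mu> \<le> ereal y" unfolding left_end_def by (intro Inf_lower) auto
      also have "\<dots> \<le> ereal x" using that by simp
      finally show False using n by simp
    qed
    then show ?thesis by (auto simp: supp_def not_less)
  qed
  then obtain U where U: "\<And>y. y \<in> {..x} \<Longrightarrow> open (U y) \<and> y \<in> U y \<and> emeasure \<mu> (U y) = 0" by metis
  obtain F' where F': "F' \<subseteq> U ` {..x}" "countable F'" "\<Union>F' = \<Union>(U ` {..x})"
    using Lindelof[of "U ` {..x}"] U by blast
  have "emeasure \<mu> (\<Union>F') = 0"
  proof -
    have "(\<Union>A\<in>F'. A) \<in> null_sets \<mu>"
      by (rule null_sets_UN'[OF F'(2)]) (use F'(1) U in \<open>auto simp: null_sets_def\<close>)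
    then show ?thesis by (simp add: null_setsD1)
  qed
  moreover have "{..x} \<subseteq> \<Union>F'" unfolding F'(3) using U by blast
  moreover have "\<Union>F' \<in> sets \<mu>"
  proof -
    have "open (\<Union>F')" by (rule open_Union) (use F'(1) U in blast)
    then show ?thesis by simp
  qed
  ultimately have "emeasure \<mu> {..x} = 0" using emeasure_mono[of "{..x}" "\<Union>F'" \<mu>] by simp
  then show False using assms(2) by (simp add: cdf_def measure_def)
qed

section \<open>The quantile function on the unit interval\<close>

locale centred_law =
  fixes \<mu> :: "real measure" and bl bu :: real
  assumes bl: "bl < 0" and bu: "0 < bu"
    and rd: "real_distribution \<mu>"
    and int: "integrable \<mu> (\<lambda>x. x)" and mean: "(\<integral>x. x \<partial>\<mu>) = 0"
begin

sublocale real_distribution \<mu> by (rule rd)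
sublocale cdf_distribution \<mu> by unfold_locales

abbreviation "F \<equiv> cdf \<mu>"

text \<open>The real-valued version of \<open>quantile\<close> on the open unit interval, where the
  infimum is finite. The value 0 elsewhere makes it Borel measurable on the whole line.\<close>

definition Q :: "real \<Rightarrow> real" where "Q u = (if u \<in> {0<..<1} then Inf {x. u \<le> F x} else 0)"

lemma Q_le_iff: "0 < u \<Longrightarrow> u < 1 \<Longrightarrow> Q u \<le> x \<longleftrightarrow> u \<le> F x"
  unfolding Q_def using pseudoinverse[of u x] by simp

lemma Q_meas: "Q \<in> borel_measurable borel"
proof -
  have "(\<lambda>u. if u \<in> {0<..<1} then Inf {x. u \<le> F x} else 0) \<in> borel_measurable borel"
    by (subst measurable_restrict_space_iff[symmetric]) (use measurable_CI in simp_all)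
  then show ?thesis unfolding Q_def[abs_def] .
qed

lemma Q_mono: "0 < u \<Longrightarrow> u \<le> v \<Longrightarrow> v < 1 \<Longrightarrow> Q u \<le> Q v"
  using Q_le_iff[of u "Q v"] Q_le_iff[of v "Q v"] by auto

lemma F_bounds: "0 \<le> F x" "F x \<le> 1"
  by (rule cdf_nonneg, rule cdf_bounded_prob)

lemma unif_Q: "AE u in unif. Q u \<le> x \<longleftrightarrow> u \<le> F x"
  using AE_unif by eventually_elim (simp add: Q_le_iff)

lemma distr_Q: "distr unif borel Q = \<mu>"
proof (rule cdf_unique)
  show "real_distribution (distr unif borel Q)"
    by (rule unif.real_distribution_distr) (use Q_meas in simp)
  show "real_distribution \<mu>" by (rule rd)
  have "cdf (distr unif borel Q) x = F x" for x
  proof -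
    have m: "Q \<in> unif \<rightarrow>\<^sub>M borel" using Q_meas by simp
    have "cdf (distr unif borel Q) x = measure unif {u. Q u \<le> x}"
      unfolding cdf_def by (subst measure_distr[OF m]) (simp_all add: vimage_def)
    also have "\<dots> = measure unif {..F x}"
      unfolding measure_def
    proof (rule arg_cong[where f=enn2real], rule emeasure_eq_AE)
      show "AE u in unif. u \<in> {u. Q u \<le> x} \<longleftrightarrow> u \<in> {..F x}" using unif_Q by simp
      show "{u. Q u \<le> x} \<in> sets unif" using measurable_sets[OF Q_meas, of "{..x}"] by (simp add: vimage_def)
    qed simp
    also have "\<dots> = clamp (F x)" using cdf_unif[of "F x"] by (simp add: cdf_def)
    also have "\<dots> = F x" using F_bounds[of x] by (simp add: clamp_def)
    finally show ?thesis .
  qed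
  then show "cdf (distr unif borel Q) = F" by (simp add: fun_eq_iff)
qed

lemma Q_int: "set_integrable lborel {0<..<1} Q"
proof -
  have m: "Q \<in> unif \<rightarrow>\<^sub>M borel" using Q_meas by simp
  have "integrable (distr unif borel Q) (\<lambda>x. x)" unfolding distr_Q by (rule int)
  then have "integrable unif Q" by (subst (asm) integrable_distr_eq[OF m]) simp_all
  then show ?thesis by (simp only: integrable_unif[OF Q_meas])
qed

lemma Q_discont: "countable {u \<in> {0<..<1}. \<not> isCont Q u}"
  by (rule mono_on_ctble_discont_open) (auto simp: mono_on_def intro: Q_mono)

text \<open>The first moment of the quantile slice between \<open>a\<close> and \<open>b\<close>; as
  a function of \<open>b\<close> with \<open>a = 0\<close> it is the unnormalised Lorenz curve of
  the law.\<close>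

definition IQ :: "real \<Rightarrow> real \<Rightarrow> real" where "IQ a b = (LINT u:{a<..<b}|lborel. Q u)"

lemma IQ_01: "IQ 0 1 = 0"
proof -
  have m: "Q \<in> unif \<rightarrow>\<^sub>M borel" using Q_meas by simp
  have "IQ 0 1 = (\<integral>u. Q u \<partial>unif)" unfolding IQ_def by (rule integral_unif[OF Q_meas, symmetric])
  also have "\<dots> = (\<integral>x. x \<partial>distr unif borel Q)" by (subst integral_distr[OF m]) simp_all
  finally show ?thesis unfolding distr_Q mean .
qed

lemma Q_int_sub: "0 \<le> a \<Longrightarrow> b \<le> 1 \<Longrightarrow> set_integrable lborel {a<..<b} Q"
  by (rule set_integrable_subset[OF Q_int]) auto

lemma IQ_same[simp]: "IQ a a = 0" by (simp add: IQ_def set_lebesgue_integral_def)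

lemma IQ_split: "0 \<le> a \<Longrightarrow> a \<le> b \<Longrightarrow> b \<le> c \<Longrightarrow> c \<le> 1 \<Longrightarrow> IQ a c = IQ a b + IQ b c"
proof -
  assume a: "0 \<le> a" "a \<le> b" "b \<le> c" "c \<le> 1"
  show ?thesis
  proof (cases "a < b \<and> b < c")
    case True
    then show ?thesis unfolding IQ_def using a by (intro set_integral_split Q_int_sub) simp_all
  next
    case False
    then have "a = b \<or> b = c" using a by linarith
    then show ?thesis by auto
  qed
qed

lemma IQ_greater:
  assumes "0 \<le> a" "a < b" "b \<le> 1" "\<And>u. a < u \<Longrightarrow> u < b \<Longrightarrow> c < Q u"
  shows "c * (b - a) < IQ a b"
proof -
  have "c < avg Q a (b - a)" by (rule avg_greater[OF Q_meas]) (use assms Q_int_sub in auto)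
  then show ?thesis using assms(2) by (simp add: avg_eq[OF Q_meas] IQ_def field_simps)
qed

lemma IQ_less:
  assumes "0 \<le> a" "a < b" "b \<le> 1" "\<And>u. a < u \<Longrightarrow> u < b \<Longrightarrow> Q u < c"
  shows "IQ a b < c * (b - a)"
proof -
  have "avg Q a (b - a) < c" by (rule avg_less[OF Q_meas]) (use assms Q_int_sub in auto)
  then show ?thesis using assms(2) by (simp add: avg_eq[OF Q_meas] IQ_def field_simps)
qed

lemma IQ_const:
  assumes "a \<le> b" "\<And>u. a < u \<Longrightarrow> u < b \<Longrightarrow> Q u = c"
  shows "IQ a b = c * (b - a)"
proof -
  have "IQ a b = (LINT u:{a<..<b}|lborel. c)"
    unfolding IQ_def by (rule set_lebesgue_integral_cong) (use assms in auto)
  then show ?thesis using assms(1) by (simp add: set_integral_const measure_def)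
qed

lemma IQ_continuous: "continuous_on {0..1} (IQ 0)"
  unfolding continuous_on_sequentially
proof (intro allI ballI impI)
  fix x :: "nat \<Rightarrow> real" and a assume a: "a \<in> {0..1}" and x: "(\<forall>n. x n \<in> {0..1}) \<and> x \<longlonglongrightarrow> a"
  have "(\<lambda>n. \<integral>u. indicator {0<..<x n} u *\<^sub>R Q u \<partial>lborel) \<longlonglongrightarrow> (\<integral>u. indicator {0<..<a} u *\<^sub>R Q u \<partial>lborel)"
  proof (rule integral_dominated_convergence[where w="\<lambda>u. \<bar>indicator {0<..<1} u *\<^sub>R Q u\<bar>"])
    show "integrable lborel (\<lambda>u. \<bar>indicator {0<..<1} u *\<^sub>R Q u\<bar>)"
      using Q_int unfolding set_integrable_def by (rule integrable_abs)
    show "(\<lambda>u. indicator {0<..<a} u *\<^sub>R Q u) \<in> borel_measurable lborel" "(\<lambda>u. indicator {0<..<x n} u *\<^sub>R Q u) \<in> borel_measurable lborel" for n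
      using Q_meas by (auto intro!: borel_measurable_scaleR)
    show "AE u in lborel. (\<lambda>n. indicator {0<..<x n} u *\<^sub>R Q u) \<longlonglongrightarrow> indicator {0<..<a} u *\<^sub>R Q u"
      using AE_lborel_singleton[of a]
    proof eventually_elim
      case (elim u)
      have "\<forall>\<^sub>F n in sequentially. u < x n \<longleftrightarrow> u < a"
      proof (cases "u < a")
        case True
        then show ?thesis using order_tendstoD(1)[of x a sequentially u] x by (auto elim: eventually_mono)
      next
        case False
        then have "a < u" using elim by simp
        then show ?thesis using order_tendstoD(2)[of x a sequentially u] x by (auto elim: eventually_mono)
      qed
      then have "\<forall>\<^sub>F n in sequentially. indicator {0<..<x n} u *\<^sub>R Q u = indicator {0<..<a} u *\<^sub>R Q u"
        by eventually_elim (simp add: indicator_def)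
      then show ?case by (rule tendsto_eventually)
    qed
    show "AE u in lborel. norm (indicator {0<..<x n} u *\<^sub>R Q u) \<le> \<bar>indicator {0<..<1} u *\<^sub>R Q u\<bar>" for n
    proof (rule AE_I2)
      fix u
      have "x n \<le> 1" using x by auto
      then show "norm (indicator {0<..<x n} u *\<^sub>R Q u) \<le> \<bar>indicator {0<..<1} u *\<^sub>R Q u\<bar>" by (auto simp: indicator_def)
    qed
  qed
  then show "(IQ 0 \<circ> x) \<longlonglongrightarrow> IQ 0 a" by (simp add: IQ_def set_lebesgue_integral_def comp_def)
qed

lemma F_left_le: "cdf_left \<mu> x \<le> F x"
  unfolding cdf_left_def cdf_def by (rule finite_measure_mono) auto

lemma F_left_bounds: "0 \<le> cdf_left \<mu> x" "cdf_left \<mu> x \<le> 1"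
  unfolding cdf_left_def by simp_all

lemma F_le_left: "x < y \<Longrightarrow> F x \<le> cdf_left \<mu> y"
  unfolding cdf_left_def cdf_def by (rule finite_measure_mono) auto

lemma Q_less_left:
  assumes "0 < u" "u < cdf_left \<mu> x" shows "Q u < x"
proof -
  have u1: "u < 1" using assms F_left_bounds[of x] by simp
  have "(F \<longlongrightarrow> cdf_left \<mu> x) (at_left x)" unfolding cdf_left_def by (rule cdf_at_left)
  from order_tendstoD(1)[OF this assms(2)] have "\<forall>\<^sub>F y in at_left x. u < F y" .
  moreover have "\<forall>\<^sub>F y in at_left x. y < x" by (simp add: eventually_at_filter)
  ultimately have "\<forall>\<^sub>F y in at_left x. u < F y \<and> y < x" by (rule eventually_conj)
  then obtain y where "u < F y" "y < x" using eventually_happens' trivial_limit_at_left_real by blast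
  then show ?thesis using Q_le_iff[OF assms(1) u1, of y] by simp
qed

lemma Q_ge_left:
  assumes "0 < u" "u < 1" "cdf_left \<mu> x < u" shows "x \<le> Q u"
proof (rule ccontr)
  assume "\<not> x \<le> Q u"
  then have "F (Q u) \<le> cdf_left \<mu> x" by (intro F_le_left) simp
  moreover have "u \<le> F (Q u)" using Q_le_iff[OF assms(1,2), of "Q u"] by simp
  ultimately show False using assms(3) by simp
qed

lemma Q_greater: "0 < u \<Longrightarrow> u < 1 \<Longrightarrow> F x < u \<Longrightarrow> x < Q u"
  using Q_le_iff[of u x] by simp

section \<open>Slices of the law as images of intervals\<close>

lemma emeasure_slice_distr:
  assumes ab: "0 \<le> a" "a \<le> b" "b \<le> 1"
  shows "slice \<mu> a b = distr (density lborel (\<lambda>u. ennreal (indicator {a<..<b} u))) borel Q"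
proof -
  let ?D = "density lborel (\<lambda>u. ennreal (indicator {a<..<b} u))"
  have m: "Q \<in> ?D \<rightarrow>\<^sub>M borel" using Q_meas by simp
  have Dx: "emeasure (distr ?D borel Q) {..x} = ennreal (max (min (F x) b - a) 0)" for x
  proof -
    have sQ: "{u. Q u \<le> x} \<in> sets borel" using measurable_sets[OF Q_meas, of "{..x}"] by (simp add: vimage_def)
    have "emeasure (distr ?D borel Q) {..x} = emeasure ?D {u. Q u \<le> x}"
      by (subst emeasure_distr[OF m]) (simp_all add: vimage_def)
    also have "\<dots> = (\<integral>\<^sup>+u. ennreal (indicator {a<..<b} u) * indicator {u. Q u \<le> x} u \<partial>lborel)"
      by (rule emeasure_density) (use sQ in simp_all)
    also have "\<dots> = (\<integral>\<^sup>+u. indicator ({a<..<b} \<inter> {..F x}) u \<partial>lborel)"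
    proof (rule nn_integral_cong)
      fix u
      show "ennreal (indicator {a<..<b} u) * indicator {u. Q u \<le> x} u = indicator ({a<..<b} \<inter> {..F x}) u"
        using Q_le_iff[of u x] ab by (auto simp: indicator_def)
    qed
    also have "\<dots> = emeasure lborel ({a<..<b} \<inter> {..F x})" by (rule nn_integral_indicator) simp
    also have "\<dots> = ennreal (max (min (F x) b - a) 0)"
    proof -
      consider "F x \<le> a" | "a < F x" "F x < b" | "a < F x" "b \<le> F x" by linarith
      then show ?thesis
      proof cases
        case 1
        then have "{a<..<b} \<inter> {..F x} = {}" by auto
        then show ?thesis using 1 by simp
      next
        case 2
        then have "{a<..<b} \<inter> {..F x} = {a<..F x}" by auto
        then show ?thesis using 2 by simp
      next
        case 3
        then have "{a<..<b} \<inter> {..F x} = {a<..<b}" by auto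
        then show ?thesis using 3 ab by simp
      qed
    qed
    finally show ?thesis .
  qed
  show ?thesis
  proof (rule measure_eqI_generator_eq[where E="range atMost" and \<Omega>=UNIV and A="\<lambda>i::nat. {..real i}"])
    show "Int_stable (range atMost :: real set set)" by (auto simp: Int_stable_def)
    show "sets (slice \<mu> a b) = sigma_sets UNIV (range atMost)" "sets (distr ?D borel Q) = sigma_sets UNIV (range atMost)"
    proof -
      have "sets (borel :: real measure) = sigma_sets UNIV (range atMost)" by (subst borel_eq_atMost) simp
      then show "sets (slice \<mu> a b) = sigma_sets UNIV (range atMost)" "sets (distr ?D borel Q) = sigma_sets UNIV (range atMost)"
        by (simp_all add: slice_def)
    qed
    show "emeasure (slice \<mu> a b) X = emeasure (distr ?D borel Q) X" if "X \<in> range atMost" for X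
      using that Dx emeasure_slice_Iic[OF rd ab(1)] by auto
    show "(\<Union>i::nat. {..real i}) = UNIV" using real_arch_simple by auto
    show "emeasure (slice \<mu> a b) {..real i} \<noteq> \<infinity>" for i unfolding emeasure_slice_Iic[OF rd ab(1)] by simp
  qed auto
qed

lemma integral_slice:
  fixes f :: "real \<Rightarrow> real"
  assumes ab: "0 \<le> a" "a \<le> b" "b \<le> 1" and f: "f \<in> borel_measurable borel"
  shows "(\<integral>x. f x \<partial>slice \<mu> a b) = (LINT u:{a<..<b}|lborel. f (Q u))"
proof -
  let ?D = "density lborel (\<lambda>u. ennreal (indicator {a<..<b} u))"
  have m: "Q \<in> ?D \<rightarrow>\<^sub>M borel" using Q_meas by simp
  have "(\<integral>x. f x \<partial>slice \<mu> a b) = (\<integral>u. f (Q u) \<partial>?D)"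
    unfolding emeasure_slice_distr[OF ab] by (rule integral_distr[OF m f])
  also have "\<dots> = (LINT u:{a<..<b}|lborel. f (Q u))"
    unfolding set_lebesgue_integral_def by (rule integral_density) (use measurable_compose[OF Q_meas f] in simp_all)
  finally show ?thesis .
qed

lemma integral_slice_shift:
  assumes ab: "0 \<le> a" "a \<le> b" "b \<le> 1"
  shows "(\<integral>x. x - c \<partial>slice \<mu> a b) = IQ a b - c * (b - a)"
proof -
  have "(\<integral>x. x - c \<partial>slice \<mu> a b) = (LINT u:{a<..<b}|lborel. Q u - c)"
    by (rule integral_slice[OF ab]) simp
  also have "\<dots> = IQ a b - (LINT u:{a<..<b}|lborel. c)"
    unfolding IQ_def by (rule set_integral_diff(2)) (use ab Q_int_sub in \<open>simp_all add: set_integrable_def\<close>)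
  also have "(LINT u:{a<..<b}|lborel. c) = c * (b - a)" using ab by (simp add: set_integral_const measure_def)
  finally show ?thesis .
qed

lemma barycentre_eq:
  assumes "0 \<le> p" "p < q" "q \<le> 1"
  shows "barycentre \<mu> p q = ereal (IQ p q / (q - p))"
  using integral_slice_shift[of p q 0] assms by (simp add: barycentre_def)

lemma quantile_eq:
  assumes "0 < q" shows "quantile \<mu> q = Inf (ereal ` {x. q \<le> F x})"
proof -
  have "left_end \<mu> \<le> Inf (ereal ` {x. q \<le> F x})"
    by (rule Inf_greatest) (use ereal_less_left_end[OF rd] assms in \<open>auto intro: less_le_trans\<close>)
  then show ?thesis unfolding quantile_def by (rule max_absorb1)
qed

lemma quantile_le: "0 < q \<Longrightarrow> q \<le> F x \<Longrightarrow> quantile \<mu> q \<le> ereal x"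
  unfolding quantile_eq by (rule Inf_lower) auto

lemma Q_le_quantile: "0 < u \<Longrightarrow> u < 1 \<Longrightarrow> u \<le> q \<Longrightarrow> ereal (Q u) \<le> quantile \<mu> q"
  by (subst quantile_eq) (auto intro!: Inf_greatest simp: Q_le_iff)

lemma quantile_le_Q: "0 < q \<Longrightarrow> q \<le> u \<Longrightarrow> u < 1 \<Longrightarrow> quantile \<mu> q \<le> ereal (Q u)"
  using Q_le_iff[of u "Q u"] by (intro quantile_le) auto

section \<open>Barycentres, rho and pi in terms of a valley-shaped function\<close>

abbreviation "Fm \<equiv> cdf_left \<mu> bu"
abbreviation "Fb \<equiv> cdf \<mu> bu"
abbreviation "Fl \<equiv> cdf \<mu> bl"
text \<open>Comparing \<open>m\<^sub>p\<^sup>q\<close> with \<open>bu\<close> is comparing \<open>J q\<close> with \<open>J p\<close>. As \<open>Q - bu\<close> is negative before \<open>Fm\<close>,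
  zero up to \<open>Fb\<close> and positive afterwards, \<open>J\<close> decreases strictly, is constant and increases strictly;
  \<open>\<rho>\<^sub>+(q)\<close> is the point on the decreasing branch with the value \<open>J q\<close>.\<close>

definition p0 :: real where "p0 = - bl / (bu - bl)"
definition J :: "real \<Rightarrow> real" where "J x = IQ 0 x - bu * x"
abbreviation "rho \<equiv> rho_plus \<mu> bu"
abbreviation "rinv \<equiv> rho_plus_inv \<mu> bu"
abbreviation "pi0 \<equiv> pi_star \<mu> bl bu"

text \<open>\<open>p0\<close> is the gambler's ruin probability: the chance of a continuous
  martingale from 0 to leave the interval between \<open>bl\<close> and \<open>bu\<close> at
  \<open>bu\<close>. It is the mass of the slice in case II and the threshold between the
  cases.\<close>

lemma p0: "0 < p0" "p0 < 1" "(bu - bl) * p0 = - bl"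
proof -
  have w: "0 < bu - bl" using bl bu by simp
  show "0 < p0" "p0 < 1" unfolding p0_def using w bl bu by (simp_all add: zero_less_divide_iff divide_less_eq del: divide_minus_left)
  show "(bu - bl) * p0 = - bl" unfolding p0_def using w by simp
qed

lemma F_facts: "0 \<le> Fm" "Fm \<le> Fb" "Fb \<le> 1" "0 \<le> Fl" "Fl \<le> Fm"
  using F_left_bounds[of bu] F_left_le[of bu] F_bounds[of bu] F_bounds[of bl] F_le_left[of bl bu] bl bu by simp_all

lemma J_diff: "0 \<le> a \<Longrightarrow> a \<le> b \<Longrightarrow> b \<le> 1 \<Longrightarrow> J b - J a = IQ a b - bu * (b - a)"
  using IQ_split[of 0 a b] by (simp add: J_def algebra_simps)

lemma J_0: "J 0 = 0" by (simp add: J_def)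
lemma J_1: "J 1 = - bu" by (simp add: J_def IQ_01)

lemma J_continuous: "continuous_on {0..1} J"
  unfolding J_def by (intro continuous_intros IQ_continuous)

lemma J_dec:
  assumes "0 \<le> a" "a < b" "b \<le> Fm" shows "J b < J a"
proof -
  have b1: "b \<le> 1" using assms F_facts by linarith
  have "IQ a b < bu * (b - a)"
  proof (rule IQ_less[OF assms(1,2) b1])
    fix u assume "a < u" "u < b"
    then show "Q u < bu" using assms by (intro Q_less_left) linarith+
  qed
  then show ?thesis using J_diff[of a b] assms b1 by linarith
qed

lemma J_inc:
  assumes "Fb \<le> a" "a < b" "b \<le> 1" shows "J a < J b"
proof -
  have a0: "0 \<le> a" using assms F_facts by linarith
  have "bu * (b - a) < IQ a b"
  proof (rule IQ_greater[OF a0 assms(2,3)])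
    fix u assume "a < u" "u < b"
    then show "bu < Q u" using assms a0 by (intro Q_greater) linarith+
  qed
  then show ?thesis using J_diff[of a b] assms a0 by linarith
qed

lemma J_flat:
  assumes "Fm \<le> a" "a \<le> b" "b \<le> Fb" shows "J a = J b"
proof -
  have "IQ a b = bu * (b - a)"
  proof (rule IQ_const[OF assms(2)])
    fix u assume u: "a < u" "u < b"
    then have u01: "0 < u" "u < 1" "Fm < u" "u \<le> Fb" using assms F_facts by linarith+
    show "Q u = bu" using Q_ge_left[OF u01(1-3)] Q_le_iff[OF u01(1,2), of bu] u01(4) by simp
  qed
  then show ?thesis using J_diff[of a b] assms F_facts by linarith
qed

lemma J_min: assumes "0 \<le> u" "u \<le> 1" shows "J Fm \<le> J u"
proof -
  consider "u < Fm" | "Fm \<le> u" "u \<le> Fb" | "Fb < u" by linarith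
  then show ?thesis
  proof cases
    case 1 then show ?thesis using J_dec[of u Fm] assms by simp
  next
    case 2 then show ?thesis using J_flat[of Fm u] by simp
  next
    case 3 then show ?thesis using J_inc[of Fb u] J_flat[of Fm Fb] F_facts assms by simp
  qed
qed

text \<open>On an interval, a valley-shaped function does not exceed the larger of its end
  values.\<close>

lemma J_valley:
  assumes "0 \<le> a" "a \<le> Fm" "a \<le> u" "u \<le> q" "Fb \<le> q" "q \<le> 1" "J q \<le> J a"
  shows "J u \<le> J a"
proof -
  consider "u \<le> Fm" | "Fm \<le> u" "u \<le> Fb" | "Fb < u" by linarith
  then show ?thesis
  proof cases
    case 1 then show ?thesis using J_dec[of a u] assms by (cases "a = u") simp_all
  next
    case 2 then show ?thesis using J_flat[of Fm u] J_min[of a] assms F_facts by simp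
  next
    case 3 then show ?thesis using J_inc[of u q] assms by (cases "u = q") simp_all
  qed
qed

lemma Fb_pos: "0 < Fb"
proof (rule ccontr)
  assume "\<not> 0 < Fb"
  then have z: "Fb = 0" "Fm = 0" using F_facts by linarith+
  then have "J 0 < J 1" using J_inc[of 0 1] by simp
  then show False using J_0 J_1 bu by simp
qed

text \<open>The degenerate slice occurs only if \<open>p\<close>, \<open>q\<close>,
  \<open>Fm\<close> and \<open>Fb\<close> coincide. There the convention by \<open>quantile\<close>
  has to agree with the trivial comparison of \<open>J\<close> with itself, which it does as
  \<open>quantile\<close> at \<open>Fb\<close> is at most \<open>bu\<close>.\<close>

lemma barycentre_le_iff:
  assumes p: "0 \<le> p" "p \<le> Fm" and q: "Fb \<le> q" "q \<le> 1"
  shows "barycentre \<mu> p q \<le> ereal bu \<longleftrightarrow> J q \<le> J p"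
proof (cases "p < q")
  case True
  have "barycentre \<mu> p q \<le> ereal bu \<longleftrightarrow> IQ p q \<le> bu * (q - p)"
    unfolding barycentre_eq[OF p(1) True q(2)] using True by (simp add: divide_le_eq)
  also have "\<dots> \<longleftrightarrow> J q \<le> J p" using J_diff[of p q] p q True by auto
  finally show ?thesis .
next
  case False
  then have e: "p = q" "q = Fb" using p q F_facts by linarith+
  have "quantile \<mu> q \<le> ereal bu" by (rule quantile_le) (use e Fb_pos in simp_all)
  then show ?thesis using e False by (simp add: barycentre_def)
qed

lemma J_neg: assumes "Fb \<le> q" "q \<le> 1" shows "J q < 0"
  using J_inc[of q 1] assms J_1 bu by (cases "q = 1") simp_all

lemma J_inj_right: "Fb \<le> a \<Longrightarrow> a \<le> 1 \<Longrightarrow> Fb \<le> b \<Longrightarrow> b \<le> 1 \<Longrightarrow> J a = J b \<Longrightarrow> a = b"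
  using J_inc[of a b] J_inc[of b a] by (cases a b rule: linorder_cases) simp_all

text \<open>As \<open>J\<close> decreases strictly up to \<open>Fm\<close>, the set in the
  definition of \<open>rho_plus\<close> is the segment that ends where \<open>J\<close> takes the
  value \<open>J q\<close>.\<close>

lemma rho_unique:
  assumes q: "Fb \<le> q" "q \<le> 1" and p: "0 \<le> p" "p \<le> Fm" "J p = J q"
  shows "rho q = p"
proof -
  have "{p'. 0 \<le> p' \<and> p' \<le> Fm \<and> barycentre \<mu> p' q \<le> ereal bu} = {0..p}"
  proof (intro set_eqI iffI)
    fix p' assume "p' \<in> {p'. 0 \<le> p' \<and> p' \<le> Fm \<and> barycentre \<mu> p' q \<le> ereal bu}"
    then have "0 \<le> p'" "p' \<le> Fm" "J q \<le> J p'" using barycentre_le_iff[of p' q] q by auto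
    then show "p' \<in> {0..p}" using J_dec[of p p'] p by (cases "p' \<le> p") simp_all
  next
    fix p' assume a: "p' \<in> {0..p}"
    then have "J p \<le> J p'" using J_dec[of p' p] p by (cases "p' = p") simp_all
    then show "p' \<in> {p'. 0 \<le> p' \<and> p' \<le> Fm \<and> barycentre \<mu> p' q \<le> ereal bu}"
      using a p barycentre_le_iff[of p' q] q by auto
  qed
  then show ?thesis unfolding rho_plus_def using p by simp
qed

lemma rho_spec:
  assumes q: "Fb \<le> q" "q \<le> 1" shows "0 \<le> rho q" "rho q \<le> Fm" "J (rho q) = J q"
proof -
  have "J Fm \<le> J q" using J_min[of q] q F_facts by simp
  moreover have "J q \<le> J 0" using J_neg[OF q] by (simp add: J_0)
  moreover have "continuous_on {0..Fm} J" by (rule continuous_on_subset[OF J_continuous]) (use F_facts in auto)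
  ultimately obtain p where p: "0 \<le> p" "p \<le> Fm" "J p = J q" using IVT2'[of J Fm "J q" 0] F_facts by blast
  then show "0 \<le> rho q" "rho q \<le> Fm" "J (rho q) = J q" using rho_unique[OF q p] by simp_all
qed

lemma rho_inj: "inj_on rho {Fb..1}"
proof (rule inj_onI)
  fix q q' assume q: "q \<in> {Fb..1}" "q' \<in> {Fb..1}" and "rho q = rho q'"
  then have "J q = J q'" using rho_spec(3)[of q] rho_spec(3)[of q'] by simp
  then show "q = q'" using J_inj_right[of q q'] q by simp
qed

lemma rho1: "0 < rho 1" "rho 1 \<le> Fm" "J (rho 1) = - bu"
proof -
  note r = rho_spec[of 1] F_facts
  show "rho 1 \<le> Fm" "J (rho 1) = - bu" using r J_1 by simp_all
  then show "0 < rho 1" using r J_0 bu by (cases "rho 1 = 0") simp_all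
qed

lemma rinv_unique:
  assumes q: "Fb \<le> q" "q \<le> 1" and p: "0 \<le> p" "p \<le> Fm" "J p = J q"
  shows "rinv p = q"
  unfolding rho_plus_inv_def
  by (rule the_inv_into_f_eq[OF rho_inj rho_unique[OF q p]]) (use q in simp)

text \<open>The lower bound on \<open>p\<close> marks the range of \<open>rho\<close>: before
  \<open>rho 1\<close> the values of \<open>J\<close> exceed \<open>J 1\<close>, the largest value
  on the increasing branch.\<close>

lemma rinv_spec:
  assumes p: "rho 1 \<le> p" "p \<le> Fm" shows "Fb \<le> rinv p" "rinv p \<le> 1" "J (rinv p) = J p"
proof -
  have p0: "0 \<le> p" using p rho1 by simp
  have "J Fb \<le> J p" using J_min[of p] J_flat[of Fm Fb] p p0 F_facts by simp
  moreover have "J p \<le> J 1" using J_dec[of "rho 1" p] p rho1 J_1 by (cases "rho 1 = p") simp_all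
  moreover have "continuous_on {Fb..1} J" by (rule continuous_on_subset[OF J_continuous]) (use F_facts in auto)
  ultimately obtain q where q: "Fb \<le> q" "q \<le> 1" "J q = J p" using IVT'[of J Fb "J p" 1] F_facts by blast
  then have "rinv p = q" by (intro rinv_unique p0 p) simp_all
  then show "Fb \<le> rinv p" "rinv p \<le> 1" "J (rinv p) = J p" using q by simp_all
qed

lemma rinv_rho1: "rinv (rho 1) = 1"
  by (rule rinv_unique) (use rho1 F_facts J_1 in simp_all)

definition pi_low :: real where "pi_low = max (rho 1) Fl"
definition S :: "real set" where "S = {p \<in> {pi_low..Fm}. rinv p - p \<le> p0}"

lemma pi_low_le: "pi_low \<le> Fm" "rho 1 \<le> pi_low" "Fl \<le> pi_low" using rho1 F_facts by (simp_all add: pi_low_def)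

lemma pi0_eq: "pi0 = (if S = {} then Fm else Inf S)"
proof -
  have e: "pi0 = real_of_ereal (min (Inf (ereal ` S)) (ereal Fm))"
    unfolding pi_star_def S_def pi_low_def p0_def ..
  show ?thesis
  proof (cases "S = {}")
    case True then show ?thesis unfolding e by (simp add: top_ereal_def)
  next
    case False
    have bd: "bdd_below S" unfolding S_def by (rule bdd_belowI[of _ pi_low]) simp
    have "Inf (ereal ` S) = ereal (Inf S)" using ereal_Inf'[OF bd False] by simp
    moreover have "Inf S \<le> Fm"
    proof -
      obtain s where "s \<in> S" using False by blast
      then have "Inf S \<le> s" "s \<le> Fm" using cInf_lower[OF _ bd] by (auto simp: S_def)
      then show ?thesis by simp
    qed
    ultimately show ?thesis unfolding e using False by (simp add: min_def)
  qed
qed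

lemma pi0_bounds: "pi_low \<le> pi0" "pi0 \<le> Fm"
proof -
  have bd: "bdd_below S" unfolding S_def by (rule bdd_belowI[of _ pi_low]) simp
  show "pi_low \<le> pi0" unfolding pi0_eq using pi_low_le by (auto intro!: cInf_greatest simp: S_def)
  show "pi0 \<le> Fm" unfolding pi0_eq
  proof (cases "S = {}")
    case False
    then obtain s where "s \<in> S" by blast
    then have "Inf S \<le> s" "s \<le> Fm" using cInf_lower[OF _ bd] by (auto simp: S_def)
    then show "(if S = {} then Fm else Inf S) \<le> Fm" using False by simp
  qed simp
qed

lemma pi0_facts: "rho 1 \<le> pi0" "Fl \<le> pi0" "0 < pi0" "pi0 \<le> Fm"
  using pi0_bounds pi_low_le rho1 by linarith+

lemma pi0_lower: "p \<in> S \<Longrightarrow> pi0 \<le> p"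
proof -
  assume p: "p \<in> S"
  have "bdd_below S" unfolding S_def by (rule bdd_belowI[of _ pi_low]) simp
  then show ?thesis unfolding pi0_eq using p by (auto intro: cInf_lower)
qed

text \<open>A strict inequality at \<open>pi0\<close> would persist slightly to the left, against
  the choice of the infimum. Only continuity of \<open>J\<close> is used for this: once
  \<open>x + p0\<close> is on the increasing branch, \<open>J x < J (x + p0)\<close> already says
  that \<open>rinv x\<close> is below \<open>x + p0\<close>.\<close>

lemma pi0_eq_low:
  assumes v: "rinv pi0 - pi0 < p0" shows "pi0 = pi_low"
proof (rule ccontr)
  assume "pi0 \<noteq> pi_low"
  then have gt: "pi_low < pi0" using pi0_bounds by simp
  define q where "q = rinv pi0"
  note q = rinv_spec[OF pi0_facts(1,4), folded q_def]
  have "J pi0 < J (rho 1)" by (rule J_dec) (use rho1 pi_low_le gt pi0_bounds in simp_all)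
  then have "q \<noteq> 1" using q(3) rho1(3) J_1 by auto
  then have q1: "q < 1" using q(2) by simp
  \<comment> \<open>Capped at 1 because \<open>J\<close> is continuous on the unit interval and
    increasing only up to 1.\<close>
  let ?m = "\<lambda>x. min 1 (x + p0)"
  have qm: "q < ?m pi0" using v q1 unfolding q_def by simp
  have "J pi0 < J (?m pi0)" using J_inc[OF q(1) qm] q(3) by simp
  have cm: "continuous_on {pi_low..pi0} (\<lambda>x. J (?m x) - J x)"
  proof (intro continuous_on_diff)
    show "continuous_on {pi_low..pi0} (\<lambda>x. J (?m x))"
      by (rule continuous_on_compose2[OF J_continuous]) (use pi_low_le rho1 p0 in \<open>auto intro!: continuous_intros\<close>)
    show "continuous_on {pi_low..pi0} J" by (rule continuous_on_subset[OF J_continuous]) (use pi_low_le rho1 pi0_bounds F_facts in auto)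
  qed
  have "((\<lambda>x. J (?m x) - J x) \<longlongrightarrow> J (?m pi0) - J pi0) (at pi0 within {pi_low..pi0})"
    using cm gt unfolding continuous_on_def by simp
  from order_tendstoD(1)[OF this, of 0] have e1: "\<forall>\<^sub>F x in at pi0 within {pi_low..pi0}. J x < J (?m x)"
    using \<open>J pi0 < J (?m pi0)\<close> by simp
  have "((\<lambda>x. ?m x) \<longlongrightarrow> ?m pi0) (at pi0 within {pi_low..pi0})" by (intro tendsto_intros)
  from order_tendstoD(1)[OF this qm] have e2: "\<forall>\<^sub>F x in at pi0 within {pi_low..pi0}. q < ?m x" .
  have e3: "\<forall>\<^sub>F x in at pi0 within {pi_low..pi0}. pi_low \<le> x \<and> x < pi0"
    unfolding eventually_at_filter by (rule always_eventually) auto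
  have "at pi0 within {pi_low..pi0} \<noteq> bot" using gt by (simp add: trivial_limit_within islimpt_Icc)
  then obtain x where x: "J x < J (?m x)" "q < ?m x" "pi_low \<le> x" "x < pi0"
    using eventually_happens'[OF _ eventually_conj[OF e1 eventually_conj[OF e2 e3]]] by blast
  have xr: "rho 1 \<le> x" "x \<le> Fm" using x pi_low_le pi0_bounds by linarith+
  note qx = rinv_spec[OF xr]
  have "rinv x \<le> ?m x"
  proof (rule ccontr)
    assume "\<not> rinv x \<le> ?m x"
    then have "J (?m x) < J (rinv x)" by (intro J_inc) (use x q qx in auto)
    then show False using qx(3) x(1) by simp
  qed
  then have "x \<in> S" unfolding S_def using x xr by auto
  then show False using pi0_lower[of x] x(4) by simp
qed

section \<open>The three cases and their slices\<close>

lemma IQ_le: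
  assumes "0 \<le> a" "a \<le> b" "b \<le> 1" "\<And>u. a < u \<Longrightarrow> u < b \<Longrightarrow> Q u \<le> c"
  shows "IQ a b \<le> c * (b - a)"
proof -
  have "IQ a b \<le> (LINT u:{a<..<b}|lborel. c)" unfolding IQ_def
    by (rule set_integral_mono) (use assms Q_int_sub in \<open>simp_all add: set_integrable_def\<close>)
  then show ?thesis using assms(2) by (simp add: set_integral_const measure_def mult.commute)
qed

lemma IQ_low: "IQ 0 Fl \<le> bl * Fl"
proof -
  have "IQ 0 Fl \<le> bl * (Fl - 0)"
  proof (rule IQ_le)
    fix u assume "0 < u" "u < Fl"
    then show "Q u \<le> bl" using Q_le_iff[of u bl] F_bounds[of bl] by simp
  qed (use F_bounds[of bl] in simp_all)
  then show ?thesis by simp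
qed

lemma Q_gt_bl: "Fl \<le> a \<Longrightarrow> a < u \<Longrightarrow> u < 1 \<Longrightarrow> bl < Q u"
  by (rule Q_greater) (use F_facts in linarith)+

text \<open>If \<open>rho 1 = Fl\<close>, the part of the law up to this level lies at or below
  \<open>bl\<close>, while the rest has barycentre \<open>bu\<close>. Since the mean is 0, the rest
  has mass at least \<open>p0\<close>.\<close>

lemma not_I_and_III: "\<not> (pi0 = Fl \<and> pi0 = rho 1 \<and> 1 - pi0 < p0)"
proof
  assume a: "pi0 = Fl \<and> pi0 = rho 1 \<and> 1 - pi0 < p0"
  have "IQ (rho 1) 1 = bu * (1 - rho 1)" using J_diff[of "rho 1" 1] rho1 J_1 F_facts by simp
  moreover have "IQ 0 (rho 1) + IQ (rho 1) 1 = 0" using IQ_split[of 0 "rho 1" 1] rho1 F_facts IQ_01 by simp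
  moreover have "IQ 0 (rho 1) \<le> bl * rho 1"
  proof -
    have "Fl = rho 1" using a by metis
    then show ?thesis using IQ_low by metis
  qed
  ultimately have "- bl \<le> (bu - bl) * (1 - rho 1)" by (simp add: algebra_simps)
  also have "\<dots> < (bu - bl) * p0" by (rule mult_strict_left_mono) (use a bl bu in simp_all)
  finally show False using p0 by simp
qed

text \<open>Outside case II, \<open>pi0\<close> is the left end \<open>max (rho 1) Fl\<close> of its
  range; cases I and III say which of the two it is. Since \<open>rinv (rho 1) = 1\<close>, the
  inequalities in cases I and III agree.\<close>

lemma trichotomy:
  "(case_I \<mu> bl bu \<and> \<not> case_II \<mu> bl bu \<and> \<not> case_III \<mu> bl bu) \<or>
   (\<not> case_I \<mu> bl bu \<and> case_II \<mu> bl bu \<and> \<not> case_III \<mu> bl bu) \<or>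
   (\<not> case_I \<mu> bl bu \<and> \<not> case_II \<mu> bl bu \<and> case_III \<mu> bl bu)"
proof (cases "rinv pi0 - pi0 < p0")
  case True
  then have "pi0 = rho 1 \<or> pi0 = Fl" using pi0_eq_low by (auto simp: pi_low_def max_def)
  moreover have "pi0 = rho 1 \<Longrightarrow> 1 - pi0 < p0" using True rinv_rho1 by simp
  ultimately show ?thesis using True not_I_and_III
    unfolding case_I_def case_II_def case_III_def p0_def by auto
next
  case False
  then have "\<not> (pi0 = rho 1 \<and> 1 - pi0 < p0)" using rinv_rho1 by auto
  then show ?thesis using False unfolding case_I_def case_II_def case_III_def p0_def by auto
qed

lemma solves_xi_iff: "solves_xi \<mu> bl \<xi> \<longleftrightarrow> Fl \<le> \<xi> \<and> \<xi> \<le> 1 \<and> IQ Fl \<xi> - bl * (\<xi> - Fl) = - bl"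
  unfolding solves_xi_def using integral_slice_shift[of Fl \<xi> bl] F_facts by auto

lemma ex_xi: "\<exists>\<xi>. solves_xi \<mu> bl \<xi>"
proof -
  let ?f = "\<lambda>x. IQ 0 x - IQ 0 Fl - bl * (x - Fl)"
  have "continuous_on {Fl..1} ?f"
    by (intro continuous_intros continuous_on_subset[OF IQ_continuous]) (use F_facts in auto)
  moreover have "?f Fl \<le> - bl" using bl by simp
  \<comment> \<open>The value at 1 is the mean of the positive part of \<open>x - bl\<close>, which
    is at least the mean \<open>- bl\<close> of \<open>x - bl\<close> itself.\<close>
  moreover have "- bl \<le> ?f 1" using IQ_low IQ_01 by (simp add: algebra_simps)
  ultimately have "\<exists>x\<ge>Fl. x \<le> 1 \<and> ?f x = - bl" using F_facts by (intro IVT') simp_all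
  then obtain \<xi> where x: "Fl \<le> \<xi>" "\<xi> \<le> 1" "?f \<xi> = - bl" by (elim exE conjE)
  then have "IQ Fl \<xi> = IQ 0 \<xi> - IQ 0 Fl" using IQ_split[of 0 Fl \<xi>] F_facts by simp
  then show ?thesis using x unfolding solves_xi_iff by (intro exI[of _ \<xi>]) simp
qed

text \<open>The equation for \<open>\<xi>\<close> says that the law outside the slice has barycentre
  \<open>bl\<close>. The slice that ends at \<open>rinv pi0\<close> has barycentre \<open>bu\<close>
  but mass below \<open>p0\<close>, too little for this; so \<open>\<xi>\<close> lies further right,
  on the increasing branch, and the barycentre of its slice exceeds \<open>bu\<close>. This in turn
  keeps its mass below \<open>p0\<close>.\<close>

lemma case_I_slice:
  assumes c: "case_I \<mu> bl bu" and x: "solves_xi \<mu> bl \<xi>"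
  shows "Fl < \<xi>" "\<xi> \<le> 1" "\<xi> - Fl < 1" "bu * (\<xi> - Fl) < IQ Fl \<xi>" "IQ Fl \<xi> = bl * (\<xi> - Fl) - bl"
proof -
  have x': "Fl \<le> \<xi>" "\<xi> \<le> 1" "IQ Fl \<xi> - bl * (\<xi> - Fl) = - bl" using x unfolding solves_xi_iff by auto
  show "\<xi> \<le> 1" by (rule x')
  show e: "IQ Fl \<xi> = bl * (\<xi> - Fl) - bl" using x'(3) by simp
  have "\<xi> \<noteq> Fl" using e bl by auto
  then show lt: "Fl < \<xi>" using x' by simp
  have pi: "pi0 = Fl" "rinv pi0 - pi0 < p0" using c unfolding case_I_def p0_def by auto
  define q where "q = rinv pi0"
  note q = rinv_spec[OF pi0_facts(1,4), folded q_def]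
  have qF: "Fl \<le> q" using q(1) F_facts by simp
  have Iq: "IQ Fl q = bu * (q - Fl)" using J_diff[of Fl q] q qF F_facts pi(1) by simp
  have "q < \<xi>"
  proof (rule ccontr)
    assume "\<not> q < \<xi>"
    then have le: "\<xi> \<le> q" by simp
    have "bl * (q - \<xi>) \<le> IQ \<xi> q"
    proof (cases "\<xi> = q")
      case False
      have "bl * (q - \<xi>) < IQ \<xi> q"
      proof (rule IQ_greater)
        fix u assume "\<xi> < u" "u < q"
        then show "bl < Q u" using x'(1) q(2) by (intro Q_gt_bl[of \<xi>]) linarith+
      qed (use False le x'(1) q(2) F_facts in linarith)+
      then show ?thesis by simp
    qed simp
    moreover have "IQ Fl q = IQ Fl \<xi> + IQ \<xi> q" by (rule IQ_split) (use x' le q F_facts in simp_all)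
    ultimately have "- bl \<le> IQ Fl q - bl * (q - Fl)" unfolding e by (simp add: algebra_simps)
    also have "\<dots> = (bu - bl) * (q - Fl)" unfolding Iq by (simp add: algebra_simps)
    also have "\<dots> < (bu - bl) * p0" by (rule mult_strict_left_mono) (use pi bl bu q_def in simp_all)
    finally show False using p0 by simp
  qed
  then have "J q < J \<xi>" by (intro J_inc q x')
  then show big: "bu * (\<xi> - Fl) < IQ Fl \<xi>" using J_diff[of Fl \<xi>] q(3) pi(1) x' F_facts by simp
  have "(bu - bl) * (\<xi> - Fl) < (bu - bl) * p0" using big unfolding e p0(3) by (simp add: algebra_simps)
  then have "\<xi> - Fl < p0" using bl bu by (simp add: mult_less_cancel_left)
  then show "\<xi> - Fl < 1" using p0 by simp
qed

text \<open>A window of fixed length \<open>p0\<close> is moved to the right from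
  \<open>pi0\<close>. At first its barycentre is at most \<open>bu\<close>, because it ends before
  \<open>rinv pi0\<close>. It is at least \<open>bu\<close> when the window begins at
  \<open>Fm\<close> or, if that does not fit, when it ends at 1.\<close>

lemma case_II_slice:
  assumes c: "case_II \<mu> bl bu"
  shows "\<exists>a\<ge>Fl. a + p0 \<le> 1 \<and> IQ a (a + p0) = bu * p0"
proof -
  define q where "q = rinv pi0"
  note q = rinv_spec[OF pi0_facts(1,4), folded q_def]
  have le: "pi0 + p0 \<le> q" using c unfolding case_II_def p0_def q_def by simp
  have K0: "J (pi0 + p0) - J pi0 \<le> 0"
    using J_valley[of pi0 "pi0 + p0" q] pi0_facts p0 le q by simp
  have "\<exists>a1\<ge>pi0. a1 + p0 \<le> 1 \<and> 0 \<le> J (a1 + p0) - J a1"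
  proof (cases "Fm + p0 \<le> 1")
    case True
    have "J Fm \<le> J (Fm + p0)" by (rule J_min) (use True F_facts p0 in linarith)+
    then show ?thesis using True pi0_facts by (intro exI[of _ Fm]) simp
  next
    case False
    have "J (1 - p0) \<le> J (rho 1)"
      using J_dec[of "rho 1" "1 - p0"] False rho1 pi0_facts le q by (cases "rho 1 = 1 - p0") simp_all
    then have "0 \<le> J (1 - p0 + p0) - J (1 - p0)" using rho1 J_1 by simp
    moreover have "pi0 \<le> 1 - p0" using le q by linarith
    ultimately show ?thesis by (intro exI[of _ "1 - p0"]) simp
  qed
  then obtain a1 where a1: "pi0 \<le> a1" "a1 + p0 \<le> 1" "0 \<le> J (a1 + p0) - J a1" by blast
  have "continuous_on {pi0..a1} (\<lambda>x. J (x + p0) - J x)"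
  proof (intro continuous_on_diff)
    show "continuous_on {pi0..a1} (\<lambda>x. J (x + p0))"
      by (rule continuous_on_compose2[OF J_continuous]) (use a1 p0 pi0_facts in \<open>auto intro!: continuous_intros\<close>)
    show "continuous_on {pi0..a1} J" by (rule continuous_on_subset[OF J_continuous]) (use a1 p0 pi0_facts in auto)
  qed
  then obtain a where a: "pi0 \<le> a" "a \<le> a1" "J (a + p0) - J a = 0"
    using IVT'[of "\<lambda>x. J (x + p0) - J x" pi0 0 a1] K0 a1 by blast
  have "IQ a (a + p0) = bu * p0" using J_diff[of a "a + p0"] a a1 p0 pi0_facts by simp
  then show ?thesis using a a1 pi0_facts by (intro exI[of _ a]) simp
qed

lemma case_III_slice:
  assumes c: "case_III \<mu> bl bu"
  shows "Fl \<le> rho 1" "pi0 = rho 1" "IQ (rho 1) 1 = bu * (1 - rho 1)" "1 - rho 1 < p0"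
proof -
  show pi: "pi0 = rho 1" and "1 - rho 1 < p0" using c unfolding case_III_def p0_def by auto
  show "Fl \<le> rho 1" using pi pi0_facts by simp
  show "IQ (rho 1) 1 = bu * (1 - rho 1)" using J_diff[of "rho 1" 1] rho1 J_1 F_facts by simp
qed

end

section \<open>The extremal martingales\<close>

text \<open>Strictness before time 1 prevents a path from meeting, on its way, the barycentre of the
  part that it will not choose.\<close>

lemma (in embedding) X_strict:
  assumes "s < 1" "avg g 0 (1 - p) < avg g (1 - p) p"
  shows "avg g 0 (1 - p) < X 0 x s" "X 0 x s < avg g (1 - p) p"
proof -
  let ?u = "gate 0 (threshold 0) x s"
  have u: "0 < ?u" "?u < 1" using gate_strict assms(1) by blast+
  have e: "lower 0 x = avg g 0 (1 - p)" "upper 0 x = avg g (1 - p) p" by (simp_all add: lower_def upper_def digit_prob_def)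
  have "0 < ?u * (upper 0 x - lower 0 x)" "0 < (1 - ?u) * (upper 0 x - lower 0 x)" using u assms(2) by (simp_all add: e)
  then show "avg g 0 (1 - p) < X 0 x s" "X 0 x s < avg g (1 - p) p"
    unfolding X_def e by (simp_all add: algebra_simps)
qed

context centred_embedding begin

sublocale mart: calM_mart "distr unif borel g" path_prob path_filtration path_mart
  by unfold_locales (rule calM_embedding)

lemma avg_low: "(1 - p) * avg g 0 (1 - p) = - p * avg g (1 - p) p"
proof -
  have "val 0 x = 0" for x unfolding val_def using avg_eq[OF g_meas, of 1 0] g_mean by simp
  then show ?thesis using val_split[of 0] by (simp add: lower_def upper_def digit_prob_def)
qed

lemma path_mart_1: "path_mart 1 x = (if D 0 x then avg g (1 - p) p else avg g 0 (1 - p))"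
proof -
  have "path_mart 1 x = X 0 x 1" using R_eq'[of 0 1 x] by (simp add: path_mart_def)
  also have "\<dots> = (if D 0 x then upper 0 x else lower 0 x)" unfolding X_1 by (rule val_Suc)
  also have "\<dots> = (if D 0 x then avg g (1 - p) p else avg g 0 (1 - p))" by (simp add: lower_def upper_def digit_prob_def)
  finally show ?thesis .
qed

lemma path_mart_before_1:
  assumes "t < 1" "avg g 0 (1 - p) < avg g (1 - p) p"
  shows "avg g 0 (1 - p) < path_mart t x" "path_mart t x < avg g (1 - p) p"
proof -
  have "t < \<top>" using assms(1) by (rule less_le_trans) simp
  then obtain m s where ms: "0 \<le> s" "s < 1" "t = ennreal (real m + s)" "\<And>x. path_mart t x = X m x s" by (rule path_mart_finite) blast
  have "real m + s < 1" using assms(1) ms(1) unfolding ms(3) by (subst (asm) ennreal_less_one_iff) simp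
  then have m: "m = 0" using ms(1) by (cases m) simp_all
  then show "avg g 0 (1 - p) < path_mart t x" "path_mart t x < avg g (1 - p) p"
    unfolding ms(4) m using X_strict[OF ms(2)] assms by blast+
qed

lemma V_open: "x \<in> good_paths \<Longrightarrow> D 0 x \<Longrightarrow> 1 - p < V x \<and> V x < 1" "x \<in> good_paths \<Longrightarrow> \<not> D 0 x \<Longrightarrow> 0 < V x \<and> V x < 1 - p"
  using good_paths(3)[of x] V_digit[of x] by (auto simp: good_def less_le)

lemma path_mart_top: "path_mart \<top> x = g (V x)" by (simp add: path_mart_def)

lemma after_1:
  assumes "1 \<le> t" "t < \<top>"
  obtains m s where "\<And>x. path_mart t x = X (Suc m) x s"
proof -
  obtain m s where ms: "0 \<le> s" "s < 1" "t = ennreal (real m + s)" "\<And>x. path_mart t x = X m x s"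
    using assms(2) by (rule path_mart_finite) blast
  have "1 \<le> real m + s" using assms(1) unfolding ms(3) by simp
  then obtain n where "m = Suc n" using ms(2) by (cases m) simp_all
  then show thesis using ms(4) that by blast
qed

lemma path_mart_greater_after_1:
  assumes x: "x \<in> good_paths" "D 0 x" and t: "1 \<le> t" and g: "\<And>u. 1 - p < u \<Longrightarrow> u < 1 \<Longrightarrow> k < g u"
  shows "k < path_mart t x"
proof (cases "t < \<top>")
  case True
  obtain m s where m: "\<And>x. path_mart t x = X (Suc m) x s" using after_1[OF t True] by blast
  show ?thesis unfolding m
  proof (rule X_greater)
    fix u assume "left (Suc m) x < u" "u < left (Suc m) x + width (Suc m) x"
    then show "k < g u" using left_digit(1)[OF x(2), of m] left_width_le[of "Suc m" x] by (intro g) linarith+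
  qed
next
  case False
  then have "t = \<top>" using top.not_eq_extremum by blast
  then show ?thesis using V_open(1)[OF x] by (simp add: path_mart_top g)
qed

lemma path_mart_less_after_1:
  assumes x: "x \<in> good_paths" "\<not> D 0 x" and t: "1 \<le> t" and g: "\<And>u. 0 < u \<Longrightarrow> u < 1 - p \<Longrightarrow> g u < k"
  shows "path_mart t x < k"
proof (cases "t < \<top>")
  case True
  obtain m s where m: "\<And>x. path_mart t x = X (Suc m) x s" using after_1[OF t True] by blast
  show ?thesis unfolding m
  proof (rule X_less)
    fix u assume "left (Suc m) x < u" "u < left (Suc m) x + width (Suc m) x"
    then show "g u < k" using left_digit(2)[OF x(2), of m] left_nonneg[of "Suc m" x] by (intro g) linarith+
  qed
next
  case False
  then have "t = \<top>" using top.not_eq_extremum by blast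
  then show ?thesis using V_open(2)[OF x] by (simp add: path_mart_top g)
qed

lemma path_mart_less:
  assumes x: "x \<in> good_paths" and g: "\<And>u. 0 < u \<Longrightarrow> u < 1 \<Longrightarrow> g u < k"
  shows "path_mart t x < k"
proof (cases "t < \<top>")
  case True
  then obtain m s where m: "\<And>x. path_mart t x = X m x s" by (rule path_mart_finite) blast
  show ?thesis unfolding m
  proof (rule X_less)
    fix u assume "left m x < u" "u < left m x + width m x"
    then show "g u < k" using left_width_le[of m x] left_nonneg[of m x] by (intro g) linarith+
  qed
next
  case False
  then have "t = \<top>" using top.not_eq_extremum by blast
  then show ?thesis using good_paths(3)[OF x] by (simp add: path_mart_top g good_def)
qed

text \<open>Three stretches of time: before 1 the path is above the lower barycentre, hence above
  \<open>bl\<close>; at 1 it equals the upper one, which is at least \<open>bu\<close>; afterwards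
  it obeys the lower bound of \<open>g\<close> on the selected part.\<close>

lemma touch_on_digit:
  assumes x: "x \<in> good_paths" "D 0 x" and c: "bl \<le> avg g 0 (1 - p)" and d: "bu \<le> avg g (1 - p) p" "bl < bu"
    and g: "\<And>u. 1 - p < u \<Longrightarrow> u < 1 \<Longrightarrow> bl < g u" and cd: "avg g 0 (1 - p) < avg g (1 - p) p"
  shows "bu \<le> path_sup path_mart x" "bl < path_inf path_mart x" "bl < path_mart t x"
proof -
  have co: "continuous_on UNIV (\<lambda>t. path_mart t x)" by (rule path_mart_continuous[OF good_paths(3)[OF x(1)]])
  have "bu \<le> path_mart 1 x" using d x(2) by (simp add: path_mart_1)
  then show "bu \<le> path_sup path_mart x" unfolding path_sup_ge_iff[of path_mart x, OF co] by blast
  have gt: "bl < path_mart t x" for t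
  proof (cases "t < 1")
    case True
    then show ?thesis using path_mart_before_1(1)[OF True cd, of x] c by simp
  next
    case False
    then show ?thesis by (intro path_mart_greater_after_1[OF x] g) simp_all
  qed
  then show "bl < path_inf path_mart x" "bl < path_mart t x" unfolding path_inf_gt_iff[of path_mart x, OF co] by blast+
qed

end

section \<open>Pathwise criteria for equality\<close>

context calM_mart begin

lemma touch_prob_eq_integral:
  assumes "\<And>\<omega>. \<omega> \<in> space P \<Longrightarrow> G \<omega> = of_bool (bu \<le> path_sup M \<omega> \<and> bl < path_inf M \<omega>)"
  shows "touch_prob bl bu P M = (\<integral>\<omega>. G \<omega> \<partial>P)"
  unfolding touch_prob_eq by (rule Bochner_Integration.integral_cong) (simp_all add: assms)

text \<open>If \<open>z\<close> is not below \<open>bu\<close>, the limit is taken under the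
  integral. On paths that reach \<open>bu\<close> the terminal value is at least \<open>bu\<close>,
  so the payoff is 1 for every strike below \<open>bu\<close>; on the others it vanishes once the
  strike has passed the terminal value.\<close>

lemma attains_III:
  assumes s: "\<And>\<omega>. \<omega> \<in> space P \<Longrightarrow>
      bu \<le> path_sup M \<omega> \<and> bl < path_inf M \<omega> \<and> z \<le> M \<infinity> \<omega> \<or> \<not> bu \<le> path_sup M \<omega> \<and> M \<infinity> \<omega> \<le> z"
  shows "attains_III bl bu P M z"
proof (cases "z < bu")
  case True
  have "touch_prob bl bu P M = (\<integral>\<omega>. G_III bu M z \<omega> \<partial>P)"
  proof (rule touch_prob_eq_integral)
    fix \<omega> assume "\<omega> \<in> space P"
    from s[OF this] show "G_III bu M z \<omega> = of_bool (bu \<le> path_sup M \<omega> \<and> bl < path_inf M \<omega>)"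
      using True by (auto simp: G_III_def add_divide_distrib[symmetric])
  qed
  then show ?thesis using True by (simp add: attains_III_def)
next
  case False
  have G1: "G_III bu M k \<omega> = 1" if "\<omega> \<in> space P" "bu \<le> path_sup M \<omega>" "k < bu" for k \<omega>
    using s[OF that(1)] that False by (auto simp: G_III_def add_divide_distrib[symmetric])
  have below: "M \<infinity> \<omega> < bu" if "\<omega> \<in> space P" "\<not> bu \<le> path_sup M \<omega>" for \<omega>
    using that path_sup_ge_iff[of M \<omega>, OF cont[OF that(1)], of bu] by (auto simp: not_le)
  have "((\<lambda>k. \<integral>\<omega>. G_III bu M k \<omega> \<partial>P) \<longlongrightarrow> touch_prob bl bu P M) (at_left bu)"
  proof (rule tendsto_at_left_sequentially[of "bu - 1"])
    fix k :: "nat \<Rightarrow> real" assume k: "\<And>n. k n < bu" and lim: "k \<longlonglongrightarrow> bu"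
    show "(\<lambda>n. \<integral>\<omega>. G_III bu M (k n) \<omega> \<partial>P) \<longlonglongrightarrow> touch_prob bl bu P M"
      unfolding touch_prob_eq
    proof (rule integral_dominated_convergence[where w="\<lambda>_. 1"])
      show "(\<lambda>\<omega>. of_bool (bu \<le> path_sup M \<omega> \<and> bl < path_inf M \<omega>) :: real) \<in> borel_measurable P"
        by (rule borel_measurable_integrable[OF integrable_of_bool]) measurable
      show "G_III bu M (k n) \<in> borel_measurable P" for n by (rule borel_measurable_integrable[OF integrable_G_III])
      show "AE \<omega> in P. (\<lambda>n. G_III bu M (k n) \<omega>) \<longlonglongrightarrow> of_bool (bu \<le> path_sup M \<omega> \<and> bl < path_inf M \<omega>)"
      proof (rule AE_I2)
        fix \<omega> assume \<omega>: "\<omega> \<in> space P"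
        show "(\<lambda>n. G_III bu M (k n) \<omega>) \<longlonglongrightarrow> of_bool (bu \<le> path_sup M \<omega> \<and> bl < path_inf M \<omega>)"
        proof (cases "bu \<le> path_sup M \<omega>")
          case True
          then show ?thesis using s[OF \<omega>] G1[OF \<omega> True k] by simp
        next
          case F: False
          have "\<forall>\<^sub>F n in sequentially. M \<infinity> \<omega> < k n" using lim below[OF \<omega> F] by (rule order_tendstoD(1))
          then have "\<forall>\<^sub>F n in sequentially. G_III bu M (k n) \<omega> = 0" by eventually_elim (use F in \<open>simp add: G_III_def\<close>)
          then show ?thesis using F by (simp add: tendsto_eventually)
        qed
      qed
      show "AE \<omega> in P. norm (G_III bu M (k n) \<omega>) \<le> 1" for n
      proof (rule AE_I2)
        fix \<omega> assume \<omega>: "\<omega> \<in> space P"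
        show "norm (G_III bu M (k n) \<omega>) \<le> 1"
        proof (cases "bu \<le> path_sup M \<omega>")
          case True
          then show ?thesis using G1[OF \<omega> True k] by simp
        next
          case F: False
          then show ?thesis using below[OF \<omega> F] k[of n] by (simp add: G_III_def)
        qed
      qed
    qed simp
  qed simp
  then show ?thesis using False by (simp add: attains_III_def)
qed

end

section \<open>The martingale of a quantile slice\<close>

locale law_slice = centred_law +
  fixes a b :: real
  assumes ab: "0 \<le> a" "a < b" "b \<le> 1" "b - a < 1"
begin

text \<open>Moves the slice to the upper end of the unit interval, so that the first digit selects it.\<close>

definition shuffle :: "real \<Rightarrow> real" where
  "shuffle u = (if 1 - (b - a) < u then u + (b - 1) else if u < a then u else u + (b - a))"

lemma shuffle_meas[measurable]: "shuffle \<in> borel_measurable borel"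
  unfolding shuffle_def by measurable

lemma shuffle_unit: "0 < u \<Longrightarrow> u < 1 \<Longrightarrow> u \<noteq> 1 - (b - a) \<Longrightarrow> 0 < shuffle u \<and> shuffle u < 1"
  using ab by (auto simp: shuffle_def)

text \<open>An exchange of three intervals: each piece is translated, and up to end points the
  images again tile the unit interval.\<close>

lemma distr_shuffle: "distr unif borel shuffle = unif"
proof (rule measure_eqI)
  fix B assume "B \<in> sets (distr unif borel shuffle)"
  then have B[measurable]: "B \<in> sets borel" by simp
  let ?I = "\<lambda>l r (u::real). indicator {l<..<r} u :: ennreal"
  let ?B = "indicator B :: real \<Rightarrow> ennreal"
  have shift: "(\<integral>\<^sup>+u. ?I l r u * ?B u \<partial>lborel) = (\<integral>\<^sup>+u. ?I (l - c) (r - c) u * ?B (u + c) \<partial>lborel)" for l r c :: real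
  proof -
    have "(\<integral>\<^sup>+u. ?I l r u * ?B u \<partial>lborel) = ennreal \<bar>1\<bar> * (\<integral>\<^sup>+u. ?I l r (c + 1 * u) * ?B (c + 1 * u) \<partial>lborel)"
      by (rule nn_integral_real_affine) simp_all
    also have "\<dots> = (\<integral>\<^sup>+u. ?I (l - c) (r - c) u * ?B (u + c) \<partial>lborel)"
      by (simp add: indicator_def add.commute less_diff_eq diff_less_eq)
    finally show ?thesis .
  qed
  have m0: "(\<lambda>u. ?I l r u * ?B u) \<in> borel_measurable lborel" for l r
    by (intro borel_measurable_times_ennreal borel_measurable_indicator) simp_all
  have m: "(\<lambda>u. ?I l r u * ?B (u + c)) \<in> borel_measurable lborel" for l r c :: real
  proof (intro borel_measurable_times_ennreal borel_measurable_indicator)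
    have "(\<lambda>u. u + c) \<in> lborel \<rightarrow>\<^sub>M borel" by measurable
    then show "(\<lambda>u. ?B (u + c)) \<in> borel_measurable lborel" by (rule measurable_compose) simp
  qed simp
  have "emeasure (distr unif borel shuffle) B = emeasure unif (shuffle -` B)"
    by (subst emeasure_distr) simp_all
  also have "\<dots> = (\<integral>\<^sup>+u. ?I 0 1 u * ?B (shuffle u) \<partial>lborel)"
    unfolding unif_def using measurable_sets[OF shuffle_meas B]
    by (subst emeasure_density) (auto intro!: nn_integral_cong simp: indicator_def)
  also have "\<dots> = (\<integral>\<^sup>+u. ?I 0 a u * ?B u + ?I a (1 - (b - a)) u * ?B (u + (b - a)) + ?I (1 - (b - a)) 1 u * ?B (u + (b - 1)) \<partial>lborel)"
  proof (rule nn_integral_cong_AE)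
    show "AE u in lborel. ?I 0 1 u * ?B (shuffle u) = ?I 0 a u * ?B u + ?I a (1 - (b - a)) u * ?B (u + (b - a)) + ?I (1 - (b - a)) 1 u * ?B (u + (b - 1))"
      using AE_lborel_singleton[of a] AE_lborel_singleton[of "1 - (b - a)"]
    proof eventually_elim
      case (elim u)
      consider "u < a" | "a < u" "u < 1 - (b - a)" | "1 - (b - a) < u" using elim by linarith
      then show ?case
      proof cases
        case 1
        then show ?thesis using ab by (simp add: shuffle_def indicator_def)
      next
        case 2
        then show ?thesis using ab by (simp add: shuffle_def indicator_def)
      next
        case 3
        then have "u - (1 - b) = u + (b - 1)" by simp
        then show ?thesis using 3 ab by (simp add: shuffle_def indicator_def)
      qed
    qed
  qed
  also have "\<dots> = (\<integral>\<^sup>+u. ?I 0 a u * ?B u \<partial>lborel) + (\<integral>\<^sup>+u. ?I a (1 - (b - a)) u * ?B (u + (b - a)) \<partial>lborel)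
      + (\<integral>\<^sup>+u. ?I (1 - (b - a)) 1 u * ?B (u + (b - 1)) \<partial>lborel)"
    unfolding nn_integral_add[OF borel_measurable_add[OF m0 m] m] nn_integral_add[OF m0 m] ..
  also have "\<dots> = (\<integral>\<^sup>+u. ?I 0 a u * ?B u \<partial>lborel) + (\<integral>\<^sup>+u. ?I b 1 u * ?B u \<partial>lborel) + (\<integral>\<^sup>+u. ?I a b u * ?B u \<partial>lborel)"
    using shift[of b 1 "b - a"] shift[of a b "b - 1"] by (simp add: algebra_simps)
  also have "\<dots> = (\<integral>\<^sup>+u. ?I 0 a u * ?B u + ?I b 1 u * ?B u + ?I a b u * ?B u \<partial>lborel)"
    unfolding nn_integral_add[OF borel_measurable_add[OF m0 m0] m0] nn_integral_add[OF m0 m0] ..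
  also have "\<dots> = (\<integral>\<^sup>+u. ?I 0 1 u * ?B u \<partial>lborel)"
  proof (rule nn_integral_cong_AE)
    show "AE u in lborel. ?I 0 a u * ?B u + ?I b 1 u * ?B u + ?I a b u * ?B u = ?I 0 1 u * ?B u"
      using AE_lborel_singleton[of a] AE_lborel_singleton[of b]
    proof eventually_elim
      case (elim u)
      then show ?case using ab by (auto simp: indicator_def)
    qed
  qed
  also have "\<dots> = emeasure unif B" unfolding unif_def by (subst emeasure_density) (auto intro!: nn_integral_cong simp: indicator_def)
  finally show "emeasure (distr unif borel shuffle) B = emeasure unif B" .
qed simp

definition G :: "real \<Rightarrow> real" where "G u = Q (shuffle u)"

lemma G_meas: "G \<in> borel_measurable borel"
  unfolding G_def by (rule measurable_compose[OF shuffle_meas Q_meas])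

lemma distr_G: "distr unif borel G = \<mu>"
proof -
  have "distr (distr unif borel shuffle) borel Q = distr unif borel (Q \<circ> shuffle)"
    by (rule distr_distr) (use Q_meas in simp_all)
  then show ?thesis by (simp add: distr_shuffle distr_Q comp_def G_def[abs_def])
qed

lemma G_int: "set_integrable lborel {0<..<1} G"
proof -
  have m: "G \<in> unif \<rightarrow>\<^sub>M borel" using G_meas by simp
  have "integrable (distr unif borel G) (\<lambda>x. x)" unfolding distr_G by (rule int)
  then have "integrable unif G" by (subst (asm) integrable_distr_eq[OF m]) simp_all
  then show ?thesis by (simp only: integrable_unif[OF G_meas])
qed

lemma G_mean: "(LINT u:{0<..<1}|lborel. G u) = 0"
proof -
  have m: "G \<in> unif \<rightarrow>\<^sub>M borel" using G_meas by simp
  have "(LINT u:{0<..<1}|lborel. G u) = (\<integral>u. G u \<partial>unif)" by (rule integral_unif[OF G_meas, symmetric])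
  also have "\<dots> = (\<integral>x. x \<partial>distr unif borel G)" by (subst integral_distr[OF m]) simp_all
  finally show ?thesis unfolding distr_G mean .
qed

text \<open>Away from the two cut points \<open>shuffle\<close> is locally a translation, so every
  other discontinuity is a translate of one of \<open>Q\<close>.\<close>

lemma G_cont: "countable {u \<in> {0<..<1}. \<not> isCont G u}"
proof (rule countable_subset)
  let ?N = "{u \<in> {0<..<1}. \<not> isCont Q u}"
  let ?S = "{a, 1 - (b - a)} \<union> (\<Union>c\<in>{b - 1, 0, b - a}. (\<lambda>v. v - c) ` ?N)"
  show "countable ?S" using Q_discont by auto
  show "{u \<in> {0<..<1}. \<not> isCont G u} \<subseteq> ?S"
  proof
    fix u assume "u \<in> {u \<in> {0<..<1}. \<not> isCont G u}"
    then have u: "0 < u" "u < 1" "\<not> isCont G u" by auto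
    show "u \<in> ?S"
    proof (cases "u = a \<or> u = 1 - (b - a)")
      case False
      obtain c where c: "c \<in> {b - 1, 0, b - a}" "\<forall>\<^sub>F v in nhds u. shuffle v = v + c"
      proof -
        consider "u < a" | "a < u" "u < 1 - (b - a)" | "1 - (b - a) < u" using False by linarith
        then show thesis
        proof cases
          case 1
          have "\<forall>\<^sub>F v in nhds u. v < a" by (rule order_tendstoD(2)[OF filterlim_ident 1])
          then have "\<forall>\<^sub>F v in nhds u. shuffle v = v + 0" by eventually_elim (use ab in \<open>simp add: shuffle_def\<close>)
          then show thesis by (intro that[of 0]) simp_all
        next
          case 2
          have "\<forall>\<^sub>F v in nhds u. a < v" by (rule order_tendstoD(1)[OF filterlim_ident 2(1)])
          moreover have "\<forall>\<^sub>F v in nhds u. v < 1 - (b - a)" by (rule order_tendstoD(2)[OF filterlim_ident 2(2)])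
          ultimately have "\<forall>\<^sub>F v in nhds u. shuffle v = v + (b - a)" by eventually_elim (simp add: shuffle_def)
          then show thesis by (intro that[of "b - a"]) simp_all
        next
          case 3
          have "\<forall>\<^sub>F v in nhds u. 1 - (b - a) < v" by (rule order_tendstoD(1)[OF filterlim_ident 3])
          then have "\<forall>\<^sub>F v in nhds u. shuffle v = v + (b - 1)" by eventually_elim (simp add: shuffle_def)
          then show thesis by (intro that[of "b - 1"]) simp_all
        qed
      qed
      have "shuffle u = u + c" using c(2) by (rule eventually_nhds_x_imp_x)
      then have 1: "0 < u + c" "u + c < 1" using shuffle_unit[OF u(1,2)] False by simp_all
      have "\<not> isCont Q (u + c)"
      proof
        assume q: "isCont Q (u + c)"
        have "isCont (\<lambda>v. Q (v + c)) u" by (rule isCont_o2[of u "\<lambda>v. v + c" Q, OF _ q]) simp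
        moreover have "\<forall>\<^sub>F v in nhds u. G v = Q (v + c)" using c(2) by eventually_elim (simp add: G_def)
        ultimately have "isCont G u" by (simp add: isCont_cong)
        with u(3) show False by simp
      qed
      then have "u + c \<in> ?N" using 1 by simp
      then have "u \<in> (\<lambda>v. v - c) ` ?N" by (rule rev_image_eqI) simp
      then show ?thesis using c(1) by blast
    qed auto
  qed
qed

sublocale emb: centred_embedding "b - a" G
  by unfold_locales (use ab G_meas G_int G_cont G_mean in simp_all)

lemma avg_high: "avg G (1 - (b - a)) (b - a) = IQ a b / (b - a)"
proof -
  have "avg G (1 - (b - a)) (b - a) = avg Q a (b - a)" unfolding avg_def
  proof (rule integral_cong_AE)
    show "AE u in unif. G (1 - (b - a) + (b - a) * u) = Q (a + (b - a) * u)"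
      using AE_unif
    proof eventually_elim
      case (elim u)
      have "1 - (b - a) < 1 - (b - a) + (b - a) * u" using elim ab by simp
      then show ?case unfolding G_def shuffle_def by simp
    qed
    have [measurable]: "(\<lambda>u. l + (b - a) * u) \<in> unif \<rightarrow>\<^sub>M borel" for l :: real by measurable
    show "(\<lambda>u. G (1 - (b - a) + (b - a) * u)) \<in> borel_measurable unif" by (rule measurable_compose[OF _ G_meas]) measurable
    show "(\<lambda>u. Q (a + (b - a) * u)) \<in> borel_measurable unif" by (rule measurable_compose[OF _ Q_meas]) measurable
  qed
  then show ?thesis using ab by (simp add: avg_eq[OF Q_meas] IQ_def)
qed

lemma avg_low: "avg G 0 (1 - (b - a)) = - IQ a b / (1 - (b - a))"
proof -
  have "(1 - (b - a)) * avg G 0 (1 - (b - a)) = - (b - a) * (IQ a b / (b - a))" using emb.avg_low unfolding avg_high .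
  also have "\<dots> = - IQ a b" using ab by (simp del: minus_diff_eq)
  finally have "(1 - (b - a)) * avg G 0 (1 - (b - a)) = - IQ a b" .
  then show ?thesis using ab by (simp add: field_simps)
qed

lemma top_on:
  assumes "x \<in> emb.good_paths" "emb.D 0 x"
  obtains v where "a < v" "v < b" "emb.path_mart \<top> x = Q v"
proof (rule that)
  have v: "1 - (b - a) < emb.V x \<and> emb.V x < 1" by (rule emb.V_open(1)[OF assms])
  then show "a < shuffle (emb.V x)" "shuffle (emb.V x) < b" by (simp_all add: shuffle_def)
  show "emb.path_mart \<top> x = Q (shuffle (emb.V x))" by (simp add: emb.path_mart_top G_def)
qed

lemma top_off:
  assumes "x \<in> emb.good_paths" "\<not> emb.D 0 x"
  obtains v where "0 < v" "v < 1" "v < a \<or> b \<le> v" "emb.path_mart \<top> x = Q v"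
proof (rule that)
  have v: "0 < emb.V x \<and> emb.V x < 1 - (b - a)" by (rule emb.V_open(2)[OF assms])
  then show "shuffle (emb.V x) < a \<or> b \<le> shuffle (emb.V x)" "0 < shuffle (emb.V x)" "shuffle (emb.V x) < 1"
    using ab by (auto simp: shuffle_def)
  show "emb.path_mart \<top> x = Q (shuffle (emb.V x))" by (simp add: emb.path_mart_top G_def)
qed

lemma calM_slice: "calM \<mu> emb.path_prob emb.path_filtration emb.path_mart"
  using emb.calM_embedding unfolding distr_G .

lemma path_mart_cont: "x \<in> emb.good_paths \<Longrightarrow> continuous_on UNIV (\<lambda>t. emb.path_mart t x)"
  by (rule emb.path_mart_continuous[OF emb.good_paths(3)])

text \<open>Off the slice the path sits at \<open>bl\<close> at time 1, which rules out the event
  whatever its supremum.\<close>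

lemma slice_touch_iff:
  assumes x: "x \<in> emb.good_paths" and c: "- IQ a b / (1 - (b - a)) = bl" and d: "bu * (b - a) \<le> IQ a b" and a: "Fl \<le> a"
  shows "bu \<le> path_sup emb.path_mart x \<and> bl < path_inf emb.path_mart x \<longleftrightarrow> emb.D 0 x"
    and "emb.D 0 x \<Longrightarrow> bl < emb.path_mart t x"
    and "\<not> emb.D 0 x \<Longrightarrow> emb.path_mart 1 x = bl"
proof -
  have low: "avg G 0 (1 - (b - a)) = bl" using c avg_low by simp
  have high: "bu \<le> avg G (1 - (b - a)) (b - a)" unfolding avg_high using d ab by (simp add: field_simps)
  have G: "bl < G u" if "1 - (b - a) < u" "u < 1" for u
    unfolding G_def by (rule Q_gt_bl[OF a]) (use that ab in \<open>simp_all add: shuffle_def\<close>)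
  have lt: "avg G 0 (1 - (b - a)) < avg G (1 - (b - a)) (b - a)" using low high bl bu by simp
  note on = emb.touch_on_digit[OF x _ _ high _ G lt]
  show gt: "emb.D 0 x \<Longrightarrow> bl < emb.path_mart t x" for t by (rule on(3)) (use low bl bu in simp_all)
  show M1: "\<not> emb.D 0 x \<Longrightarrow> emb.path_mart 1 x = bl" by (simp add: emb.path_mart_1 low)
  show "bu \<le> path_sup emb.path_mart x \<and> bl < path_inf emb.path_mart x \<longleftrightarrow> emb.D 0 x"
  proof
    assume "emb.D 0 x"
    then show "bu \<le> path_sup emb.path_mart x \<and> bl < path_inf emb.path_mart x" using on(1,2) low bl bu by simp
  next
    assume "bu \<le> path_sup emb.path_mart x \<and> bl < path_inf emb.path_mart x"
    then have "bl < emb.path_mart 1 x" using path_inf_gt_iff[of emb.path_mart x, OF path_mart_cont[OF x]] by blast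
    then show "emb.D 0 x" using M1 by fastforce
  qed
qed

lemma never_hit: "(\<And>t. bl < M t x) \<Longrightarrow> hit M bl x = \<top>"
  unfolding hit_def by (auto simp: less_le)

text \<open>With \<open>K = quantile \<mu> b\<close>, terminal values on the slice lie above
  \<open>bl\<close> and do not exceed \<open>K\<close>, while those off it are at most
  \<open>bl\<close> or at least \<open>K\<close>: the equality case of the first bound. The strike
  can be \<infinity> if \<open>b = 1\<close>.\<close>

lemma slice_I:
  assumes "- IQ a b / (1 - (b - a)) = bl" "bu * (b - a) \<le> IQ a b" "a = Fl"
  shows "touch_prob bl bu emb.path_prob emb.path_mart = (\<integral>x. G_I bl emb.path_mart (quantile \<mu> b) x \<partial>emb.path_prob)"
proof -
  interpret m: calM_mart \<mu> emb.path_prob emb.path_filtration emb.path_mart by unfold_locales (rule calM_slice)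
  have b0: "0 < b" using ab by simp
  have "ereal bl < ereal (Q ((a + b) / 2))" using Q_gt_bl[of a "(a + b) / 2"] ab assms(3) by simp
  also have "\<dots> \<le> quantile \<mu> b" by (rule Q_le_quantile) (use ab in simp_all)
  finally have K: "ereal bl < quantile \<mu> b" .
  show ?thesis
  proof (rule m.touch_prob_eq_integral)
    fix x assume "x \<in> space emb.path_prob"
    then have x: "x \<in> emb.good_paths" by (simp add: emb.space_path_prob)
    note t = slice_touch_iff[OF x assms(1,2) eq_refl[OF assms(3)[symmetric]]]
    show "G_I bl emb.path_mart (quantile \<mu> b) x = of_bool (bu \<le> path_sup emb.path_mart x \<and> bl < path_inf emb.path_mart x)"
    proof (cases "emb.D 0 x")
      case True
      obtain v where v: "a < v" "v < b" "emb.path_mart \<top> x = Q v" using top_on[OF x True] .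
      have gt: "bl < emb.path_mart t x" for t by (rule t(2)[OF True])
      have h: "hit emb.path_mart bl x = \<top>" by (rule never_hit) (rule gt)
      have "ereal (Q v) \<le> quantile \<mu> b" by (rule Q_le_quantile) (use v ab in simp_all)
      then have "quantile \<mu> b \<noteq> \<infinity> \<Longrightarrow> Q v \<le> real_of_ereal (quantile \<mu> b)" using K by (cases "quantile \<mu> b") simp_all
      moreover have "bl < Q v" using gt[of \<top>] v(3) by simp
      ultimately show ?thesis using t(1) True by (simp add: G_I_def h v(3))
    next
      case False
      obtain v where v: "0 < v" "v < 1" "v < a \<or> b \<le> v" "emb.path_mart \<top> x = Q v" using top_off[OF x False] .
      have "hit emb.path_mart bl x \<le> 1" by (rule hit_le) (rule t(3)[OF False])
      then have h: "hit emb.path_mart bl x < \<infinity>" by (rule le_less_trans) simp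
      have "G_I bl emb.path_mart (quantile \<mu> b) x = 0" using v(3)
      proof
        assume "v < a"
        then have "v \<le> Fl" using assms(3) by linarith
        then have "Q v \<le> bl" using Q_le_iff[OF v(1,2)] by simp
        moreover have "quantile \<mu> b \<noteq> \<infinity> \<Longrightarrow> bl < real_of_ereal (quantile \<mu> b)" using K by (cases "quantile \<mu> b") simp_all
        ultimately show ?thesis using h by (cases "quantile \<mu> b = \<infinity>") (simp_all add: G_I_def v(4))
      next
        assume "b \<le> v"
        then have "quantile \<mu> b \<le> ereal (Q v)" using b0 v(2) by (intro quantile_le_Q)
        then obtain k where k: "quantile \<mu> b = ereal k" "bl < k" "k \<le> Q v" using K by (cases "quantile \<mu> b") simp_all
        then show ?thesis using h by (simp add: G_I_def v(4) field_simps)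
      qed
      then show ?thesis using t(1) False by simp
    qed
  qed
qed

text \<open>Only the order of the two hits matters. On the slice \<open>bu\<close> is met by time 1
  and \<open>bl\<close> never; off the slice \<open>bl\<close> is met by time 1, and before that the
  path is strictly below \<open>bu\<close>.\<close>

lemma slice_II:
  assumes "- IQ a b / (1 - (b - a)) = bl" "bu * (b - a) = IQ a b" "Fl \<le> a"
  shows "touch_prob bl bu emb.path_prob emb.path_mart = (\<integral>x. G_II bl bu emb.path_mart x \<partial>emb.path_prob)"
proof -
  interpret m: calM_mart \<mu> emb.path_prob emb.path_filtration emb.path_mart by unfold_locales (rule calM_slice)
  have high: "avg G (1 - (b - a)) (b - a) = bu" unfolding avg_high using assms(2) ab by (simp add: field_simps)
  have low: "avg G 0 (1 - (b - a)) = bl" using assms(1) avg_low by simp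
  show ?thesis
  proof (rule m.touch_prob_eq_integral)
    fix x assume "x \<in> space emb.path_prob"
    then have x: "x \<in> emb.good_paths" by (simp add: emb.space_path_prob)
    note t = slice_touch_iff[OF x assms(1) eq_refl[OF assms(2)] assms(3)]
    have w: "0 < bu - bl" using bl bu by simp
    show "G_II bl bu emb.path_mart x = of_bool (bu \<le> path_sup emb.path_mart x \<and> bl < path_inf emb.path_mart x)"
    proof (cases "emb.D 0 x")
      case True
      have h: "hit emb.path_mart bl x = \<top>" by (rule never_hit) (rule t(2)[OF True])
      have "hit emb.path_mart bu x \<le> 1" by (rule hit_le) (use True high in \<open>simp add: emb.path_mart_1\<close>)
      then have "hit emb.path_mart bu x < \<infinity>" by (rule le_less_trans) simp
      then have "G_II bl bu emb.path_mart x = 1" using w by (simp add: G_II_def h diff_divide_distrib[symmetric])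
      then show ?thesis using t(1) True by simp
    next
      case False
      have h: "hit emb.path_mart bl x \<le> 1" by (rule hit_le) (rule t(3)[OF False])
      have "\<not> hit emb.path_mart bu x \<le> 1"
      proof
        assume "hit emb.path_mart bu x \<le> 1"
        then obtain s where s: "s \<le> 1" "emb.path_mart s x = bu" using hit_le_iff[of emb.path_mart x, OF path_mart_cont[OF x], of 1 bu] by auto
        show False
        proof (cases "s = 1")
          case True
          then show False using s t(3)[OF False] w by simp
        next
          case ne: False
          then have "s < 1" using s(1) by simp
          then show False using emb.path_mart_before_1(2)[of s x] s(2) w unfolding high low by simp
        qed
      qed
      then have "hit emb.path_mart bl x < hit emb.path_mart bu x" using h by (simp add: not_le le_less_trans)
      moreover have "hit emb.path_mart bl x < \<infinity>" using h by (rule le_less_trans) simp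
      moreover have "\<not> hit emb.path_mart bu x < hit emb.path_mart bl x" using calculation(1) by (rule order_less_not_sym)
      ultimately have "G_II bl bu emb.path_mart x = 0" by (simp add: G_II_def)
      then show ?thesis using t(1) False by simp
    qed
  qed
qed

end

section \<open>Attainment in the three cases\<close>

context centred_law begin

lemma attained_I:
  assumes c: "case_I \<mu> bl bu" and x: "solves_xi \<mu> bl \<xi>"
  shows "\<exists>(P :: path measure) \<F> M. calM \<mu> P \<F> M \<and> touch_prob bl bu P M = (\<integral>\<omega>. G_I bl M (quantile \<mu> \<xi>) \<omega> \<partial>P)"
proof -
  note s = case_I_slice[OF c x]
  interpret S: law_slice \<mu> bl bu Fl \<xi> by unfold_locales (use s F_facts in simp_all)
  have "- IQ Fl \<xi> / (1 - (\<xi> - Fl)) = bl" unfolding s(5) using s(3) by (simp add: field_simps)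
  from S.slice_I[OF this less_imp_le[OF s(4)] refl] S.calM_slice show ?thesis by blast
qed

lemma attained_II:
  assumes c: "case_II \<mu> bl bu"
  shows "\<exists>(P :: path measure) \<F> M. calM \<mu> P \<F> M \<and> touch_prob bl bu P M = (\<integral>\<omega>. G_II bl bu M \<omega> \<partial>P) \<and>
           (\<integral>\<omega>. G_II bl bu M \<omega> \<partial>P) = - bl / (bu - bl)"
proof -
  obtain a where a: "Fl \<le> a" "a + p0 \<le> 1" "IQ a (a + p0) = bu * p0" using case_II_slice[OF c] by blast
  interpret S: law_slice \<mu> bl bu a "a + p0" by unfold_locales (use a F_facts p0 in simp_all)
  have "- IQ a (a + p0) / (1 - (a + p0 - a)) = bl" unfolding a(3) using p0 by (simp add: field_simps)
  moreover have "bu * (a + p0 - a) = IQ a (a + p0)" using a(3) by simp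
  ultimately have 1: "touch_prob bl bu S.emb.path_prob S.emb.path_mart = (\<integral>\<omega>. G_II bl bu S.emb.path_mart \<omega> \<partial>S.emb.path_prob)" by (rule S.slice_II) (rule a)
  interpret m: calM_mart \<mu> S.emb.path_prob S.emb.path_filtration S.emb.path_mart by unfold_locales (rule S.calM_slice)
  have 2: "(\<integral>\<omega>. G_II bl bu S.emb.path_mart \<omega> \<partial>S.emb.path_prob) = - bl / (bu - bl)" unfolding m.integral_G_II mean by simp
  show ?thesis using S.calM_slice 1 2 by blast
qed

lemma attained_III:
  assumes c: "case_III \<mu> bl bu"
  shows "\<exists>(P :: path measure) \<F> M. calM \<mu> P \<F> M \<and> attains_III bl bu P M (real_of_ereal (quantile \<mu> pi0))"
proof -
  define r where "r = rho 1"
  note s = case_III_slice[OF c, folded r_def]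
  have r: "0 < r" "r \<le> Fm" "r \<le> 1" using rho1 F_facts unfolding r_def by linarith+
  define z where "z = real_of_ereal (quantile \<mu> r)"
  have "quantile \<mu> r \<le> ereal bu" by (rule quantile_le) (use r F_facts in linarith)+
  moreover have "ereal (Q (r / 2)) \<le> quantile \<mu> r" by (rule Q_le_quantile) (use r in linarith)+
  ultimately have z: "quantile \<mu> r = ereal z" unfolding z_def by (cases "quantile \<mu> r") simp_all
  have Qz: "Q u \<le> z" if "0 < u" "u < 1" "u \<le> r" for u using Q_le_quantile[OF that] z by simp
  have zQ: "z \<le> Q u" if "r \<le> u" "u < 1" for u using quantile_le_Q[OF r(1) that] z by simp
  have Qbu: "Q u < bu" if "0 < u" "u < r" for u using that r by (intro Q_less_left) linarith+
  show ?thesis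
  proof (cases "r < 1")
    case True
    interpret S: law_slice \<mu> bl bu r 1 by unfold_locales (use r True in simp_all)
    interpret m: calM_mart \<mu> S.emb.path_prob S.emb.path_filtration S.emb.path_mart by unfold_locales (rule S.calM_slice)
    have high: "avg S.G (1 - (1 - r)) (1 - r) = bu" unfolding S.avg_high s(3) using True by simp
    have low: "r * avg S.G 0 (1 - (1 - r)) = - bu * (1 - r)" unfolding S.avg_low s(3) using r by simp
    \<comment> \<open>A slice with barycentre \<open>bu\<close> and mass below \<open>p0\<close>
      leaves the rest of the law with a barycentre above \<open>bl\<close>.\<close>
    have "bl * r < - bu * (1 - r)"
    proof -
      have "(bu - bl) * (1 - r) < (bu - bl) * p0" by (rule mult_strict_left_mono) (use s(4) bl bu in simp_all)
      then show ?thesis using p0(3) by (simp add: algebra_simps)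
    qed
    then have "r * bl < r * avg S.G 0 (1 - (1 - r))" unfolding low by (simp add: mult.commute)
    then have bl_low: "bl < avg S.G 0 (1 - (1 - r))" using r by simp
    have "r * avg S.G 0 (1 - (1 - r)) < 0" unfolding low using True bu by simp
    then have "avg S.G 0 (1 - (1 - r)) < 0" using r by (simp add: mult_less_0_iff)
    then have lt: "avg S.G 0 (1 - (1 - r)) < avg S.G (1 - (1 - r)) (1 - r)" using high bu by simp
    have G1: "bl < S.G u" if "1 - (1 - r) < u" "u < 1" for u
      unfolding S.G_def by (rule Q_gt_bl[OF s(1)]) (use that in \<open>simp_all add: S.shuffle_def\<close>)
    have G0: "S.G u < bu" if "0 < u" "u < 1 - (1 - r)" for u
      using Qbu[of u] that by (simp add: S.G_def S.shuffle_def)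
    have "attains_III bl bu S.emb.path_prob S.emb.path_mart z"
    proof (rule m.attains_III)
      fix x assume "x \<in> space S.emb.path_prob"
      then have x: "x \<in> S.emb.good_paths" unfolding S.emb.space_path_prob .
      show "bu \<le> path_sup S.emb.path_mart x \<and> bl < path_inf S.emb.path_mart x \<and> z \<le> S.emb.path_mart \<infinity> x \<or> \<not> bu \<le> path_sup S.emb.path_mart x \<and> S.emb.path_mart \<infinity> x \<le> z"
      proof (cases "S.emb.D 0 x")
        case D: True
        obtain v where v: "r < v" "v < 1" "S.emb.path_mart \<top> x = Q v" using S.top_on[OF x D] .
        have "bl < bu" using bl bu by simp
        note S.emb.touch_on_digit[OF x D less_imp_le[OF bl_low] eq_refl[OF high[symmetric]] this G1 lt]
        then show ?thesis using zQ[of v] v by simp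
      next
        case D: False
        obtain v where v: "0 < v" "v < 1" "v < r \<or> 1 \<le> v" "S.emb.path_mart \<top> x = Q v" using S.top_off[OF x D] .
        have "S.emb.path_mart t x < bu" for t
        proof (cases "t < 1")
          case True
          then show ?thesis using S.emb.path_mart_before_1(2)[OF True lt, of x] high by simp
        next
          case False
          then show ?thesis by (intro S.emb.path_mart_less_after_1[OF x D] G0) simp_all
        qed
        then have "\<not> bu \<le> path_sup S.emb.path_mart x" using path_sup_ge_iff[of S.emb.path_mart x, OF S.path_mart_cont[OF x]] by (simp add: not_le)
        then show ?thesis using Qz[of v] v by simp
      qed
    qed
    then show ?thesis using S.calM_slice unfolding s(2) z_def by blast
  next
    case False
    then have r1: "r = 1" using r by simp
    \<comment> \<open>The slice above \<open>r\<close> is empty and all mass lies strictly below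
      \<open>bu\<close>, so no path reaches \<open>bu\<close>. Any cut gives a suitable martingale;
      \<open>1 / 2\<close> is arbitrary.\<close>
    interpret S: law_slice \<mu> bl bu "1 / 2" 1 by unfold_locales simp_all
    interpret m: calM_mart \<mu> S.emb.path_prob S.emb.path_filtration S.emb.path_mart by unfold_locales (rule S.calM_slice)
    have G: "S.G u < bu" if "0 < u" "u < 1" for u
    proof (cases "u = 1 - (1 - 1 / 2)")
      case True
      \<comment> \<open>here the shuffle leaves the open unit interval, outside of which \<open>Q\<close> is 0\<close>
      then show ?thesis using bu by (simp add: S.G_def S.shuffle_def Q_def)
    next
      case False
      then show ?thesis unfolding S.G_def using S.shuffle_unit[OF that False] r1 by (intro Qbu) simp_all
    qed
    have "attains_III bl bu S.emb.path_prob S.emb.path_mart z"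
    proof (rule m.attains_III)
      fix x assume "x \<in> space S.emb.path_prob"
      then have x: "x \<in> S.emb.good_paths" unfolding S.emb.space_path_prob .
      have "S.emb.path_mart t x < bu" for t by (rule S.emb.path_mart_less[OF x G])
      then have "\<not> bu \<le> path_sup S.emb.path_mart x" using path_sup_ge_iff[of S.emb.path_mart x, OF S.path_mart_cont[OF x]] by (simp add: not_le)
      moreover have "S.emb.path_mart \<infinity> x \<le> z"
      proof (cases "S.emb.D 0 x")
        case True
        obtain v where "1 / 2 < v" "v < 1" "S.emb.path_mart \<top> x = Q v" using S.top_on[OF x True] .
        then show ?thesis using Qz[of v] r1 by simp
      next
        case False
        obtain v where "0 < v" "v < 1" "v < 1 / 2 \<or> 1 \<le> v" "S.emb.path_mart \<top> x = Q v" using S.top_off[OF x False] .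
        then show ?thesis using Qz[of v] r1 by simp
      qed
      ultimately show "bu \<le> path_sup S.emb.path_mart x \<and> bl < path_inf S.emb.path_mart x \<and> z \<le> S.emb.path_mart \<infinity> x \<or> \<not> bu \<le> path_sup S.emb.path_mart x \<and> S.emb.path_mart \<infinity> x \<le> z" by simp
    qed
    then show ?thesis using S.calM_slice unfolding s(2) z_def by blast
  qed
qed

end

theorem theorem2p2:
  fixes \<mu> :: "real measure" and bl bu :: real
  assumes "bl < 0" "0 < bu"
    and "real_distribution \<mu>"
    and "integrable \<mu> (\<lambda>x. x)" "(\<integral>x. x \<partial>\<mu>) = 0"
    and "\<mu> \<noteq> return borel 0"
  shows
    "(\<forall>(P :: 'a measure) \<F> M. calM \<mu> P \<F> M \<longrightarrow> touch_prob bl bu P M \<le> upper_bound bl bu P M) \<and>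
     (\<forall>(P :: 'a measure) \<F> M (P' :: 'b measure) \<F>' M'.
        calM \<mu> P \<F> M \<and> calM \<mu> P' \<F>' M' \<longrightarrow> upper_bound bl bu P M = upper_bound bl bu P' M') \<and>
     ((case_I \<mu> bl bu \<and> \<not> case_II \<mu> bl bu \<and> \<not> case_III \<mu> bl bu) \<or>
      (\<not> case_I \<mu> bl bu \<and> case_II \<mu> bl bu \<and> \<not> case_III \<mu> bl bu) \<or>
      (\<not> case_I \<mu> bl bu \<and> \<not> case_II \<mu> bl bu \<and> case_III \<mu> bl bu)) \<and>
     (case_I \<mu> bl bu \<longrightarrow>
        (\<exists>\<xi>. solves_xi \<mu> bl \<xi>) \<and>
        (\<forall>\<xi>. solves_xi \<mu> bl \<xi> \<longrightarrow>
           (\<exists>(P :: path measure) \<F> M. calM \<mu> P \<F> M \<and>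
              touch_prob bl bu P M = (\<integral>\<omega>. G_I bl M (quantile \<mu> \<xi>) \<omega> \<partial>P)))) \<and>
     (case_II \<mu> bl bu \<longrightarrow>
        (\<exists>(P :: path measure) \<F> M. calM \<mu> P \<F> M \<and>
           touch_prob bl bu P M = (\<integral>\<omega>. G_II bl bu M \<omega> \<partial>P) \<and>
           (\<integral>\<omega>. G_II bl bu M \<omega> \<partial>P) = - bl / (bu - bl))) \<and>
     (case_III \<mu> bl bu \<longrightarrow>
        (\<exists>(P :: path measure) \<F> M. calM \<mu> P \<F> M \<and>
           attains_III bl bu P M (real_of_ereal (quantile \<mu> (pi_star \<mu> bl bu)))))"
proof -
  interpret centred_law \<mu> bl bu by (rule centred_law.intro) (fact assms)+
  have bound: "touch_prob bl bu P M \<le> upper_bound bl bu P M" if "calM \<mu> P \<F> M"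
    for P :: "'a measure" and \<F> M
    by (rule calM_mart.touch_prob_le_upper_bound[OF calM_mart.intro[OF that] assms(1,2)])
  have same: "upper_bound bl bu P M = upper_bound bl bu P' M'" if "calM \<mu> P \<F> M" "calM \<mu> P' \<F>' M'"
    for P :: "'a measure" and \<F> M and P' :: "'b measure" and \<F>' M'
    unfolding calM_mart.upper_bound_eq[OF calM_mart.intro[OF that(1)] assms(2)]
      calM_mart.upper_bound_eq[OF calM_mart.intro[OF that(2)] assms(2)] ..
  show ?thesis
  proof (intro conjI allI impI)
    show "touch_prob bl bu P M \<le> upper_bound bl bu P M" if "calM \<mu> P \<F> M"
      for P :: "'a measure" and \<F> M using that by (rule bound)
    show "upper_bound bl bu P M = upper_bound bl bu P' M'" if "calM \<mu> P \<F> M \<and> calM \<mu> P' \<F>' M'"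
      for P :: "'a measure" and \<F> M and P' :: "'b measure" and \<F>' M' using that by (elim conjE) (rule same)
  qed (rule trichotomy ex_xi attained_I attained_II attained_III; assumption?)+
qed

end
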